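(* The Independent Dominating Set problem (given a graph $G$ and an integer $k$, decide whether $G$ has an independent dominating set of size at most $k$), parameterized by $k$, is W[1]-hard even when restricted to $2$-clubs.
   Context: An independent dominating set of $G$ is a set $D\subseteq V(G)$ that is independent and satisfies $N[D]=V(G)$, where $N[D]$ is the union of closed neighborhoods of vertices of $D$. A $2$-club is a graph in which every two vertices are at distance at most $2$. *)

theory Defs
  imports "Graph_Theory.Pair_Digraph" "Graph_Theory.Shortest_Path"
begin

section \<open>Model of computation\<close>

text \<open>
  Jones' WHILE language: imperative programs whose variables hold binary trees. Binary trees play
  the role of strings; their size is the number of inner nodes, which is proportional to the length
  of their bracket representation. An assignment costs the size of the assigned value (plus one), so
  that the size of every value in the store is bounded by the input size plus the running time, and
  running times agree with those of multi-tape Turing machines up to a polynomial.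
\<close>

datatype tree = Leaf | Node tree tree

datatype exp = Var nat | Const_Leaf | Mk_Node exp exp | Left exp | Right exp

datatype com = Assign nat exp | Seq com com | Cond nat com com | While nat com

type_synonym store = "nat \<Rightarrow> tree"

fun left :: "tree \<Rightarrow> tree" where
  "left Leaf = Leaf"
| "left (Node a b) = a"

fun right :: "tree \<Rightarrow> tree" where
  "right Leaf = Leaf"
| "right (Node a b) = b"

fun exp_value :: "exp \<Rightarrow> store \<Rightarrow> tree" where
  "exp_value (Var i) s = s i"
| "exp_value Const_Leaf s = Leaf"
| "exp_value (Mk_Node e1 e2) s = Node (exp_value e1 s) (exp_value e2 s)"
| "exp_value (Left e) s = left (exp_value e s)"
| "exp_value (Right e) s = right (exp_value e s)"

text \<open>\<open>exec c s t s'\<close>: started in store \<open>s\<close>, program \<open>c\<close> halts in store \<open>s'\<close> after time \<open>t\<close>.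
  In tests, \<open>Leaf\<close> counts as false and every other tree as true.\<close>

inductive exec :: "com \<Rightarrow> store \<Rightarrow> nat \<Rightarrow> store \<Rightarrow> bool" where
  Assign: "exec (Assign i e) s (1 + size (exp_value e s)) (s(i := exp_value e s))"
| Seq: "exec c1 s t1 s' \<Longrightarrow> exec c2 s' t2 s'' \<Longrightarrow> exec (Seq c1 c2) s (t1 + t2) s''"
| Cond_True: "s i \<noteq> Leaf \<Longrightarrow> exec c1 s t s' \<Longrightarrow> exec (Cond i c1 c2) s (1 + t) s'"
| Cond_False: "s i = Leaf \<Longrightarrow> exec c2 s t s' \<Longrightarrow> exec (Cond i c1 c2) s (1 + t) s'"
| While_False: "s i = Leaf \<Longrightarrow> exec (While i c) s 1 s"
| While_True: "s i \<noteq> Leaf \<Longrightarrow> exec c s t1 s' \<Longrightarrow> exec (While i c) s' t2 s''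
    \<Longrightarrow> exec (While i c) s (1 + t1 + t2) s''"

text \<open>Input and output are passed in variable 0; all other variables initially hold \<open>Leaf\<close>.\<close>

definition computes :: "com \<Rightarrow> tree \<Rightarrow> nat \<Rightarrow> tree \<Rightarrow> bool" where
  "computes c x t y \<longleftrightarrow> (\<exists>s. exec c ((\<lambda>_. Leaf)(0 := x)) t s \<and> s 0 = y)"


section \<open>Encodings\<close>

primrec enc_list :: "('a \<Rightarrow> tree) \<Rightarrow> 'a list \<Rightarrow> tree" where
  "enc_list f [] = Leaf"
| "enc_list f (x # xs) = Node (f x) (enc_list f xs)"

definition enc_bool :: "bool \<Rightarrow> tree" where
  "enc_bool b = (if b then Node Leaf Leaf else Leaf)"

text \<open>Numbers are written in unary. This affects no notion below: parameters enter running times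
  through arbitrary computable functions, and the numbers occurring in a circuit are less than its
  number of gates.\<close>

primrec enc_nat :: "nat \<Rightarrow> tree" where
  "enc_nat 0 = Leaf"
| "enc_nat (Suc n) = Node Leaf (enc_nat n)"

definition computable :: "(nat \<Rightarrow> nat) \<Rightarrow> bool" where
  "computable f \<longleftrightarrow> (\<exists>c. \<forall>n. \<exists>t. computes c (enc_nat n) t (enc_nat (f n)))"


section \<open>Parameterized problems and reductions\<close>

type_synonym problem = "(tree \<times> nat) set"

text \<open>A parameterized reduction from \<open>P\<close> to the restriction of \<open>Q\<close> to the instances in \<open>I\<close>: every
  input, including those that encode nothing meaningful for \<open>P\<close>, is mapped to an instance in \<open>I\<close>.\<close>

definition fpt_reducible :: "problem \<Rightarrow> problem \<Rightarrow> (tree \<times> nat) set \<Rightarrow> bool" where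
  "fpt_reducible P Q I \<longleftrightarrow>
     (\<exists>c f g e. computable f \<and> computable g \<and>
        (\<forall>x k. \<exists>x' k' t.
           computes c (Node x (enc_nat k)) t (Node x' (enc_nat k')) \<and>
           t \<le> f k * (size x + 1) ^ e \<and>
           k' \<le> g k \<and>
           (x', k') \<in> I \<and>
           ((x, k) \<in> P \<longleftrightarrow> (x', k') \<in> Q)))"


section \<open>Circuits and the W-hierarchy\<close>

text \<open>A circuit lists the nodes of a directed acyclic graph in a topological order, so that the
  in-neighbours of a gate are positions of earlier gates; the last gate is the output.\<close>

datatype gate = Input | Neg nat | Conj "nat list" | Disj "nat list"

type_synonym circuit = "gate list"

fun in_nbrs :: "gate \<Rightarrow> nat list" where
  "in_nbrs Input = []"
| "in_nbrs (Neg j) = [j]"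
| "in_nbrs (Conj js) = js"
| "in_nbrs (Disj js) = js"

fun fan_in_ok :: "gate \<Rightarrow> bool" where
  "fan_in_ok (Conj js) \<longleftrightarrow> length js \<ge> 2"
| "fan_in_ok (Disj js) \<longleftrightarrow> length js \<ge> 2"
| "fan_in_ok _ \<longleftrightarrow> True"

definition wf_circuit :: "circuit \<Rightarrow> bool" where
  "wf_circuit C \<longleftrightarrow> C \<noteq> [] \<and>
     (\<forall>i < length C. fan_in_ok (C ! i) \<and> distinct (in_nbrs (C ! i)) \<and>
        (\<forall>j \<in> set (in_nbrs (C ! i)). j < i))"

definition input_nodes :: "circuit \<Rightarrow> nat set" where
  "input_nodes C = {i. i < length C \<and> C ! i = Input}"

text \<open>\<open>gate_value A vs g\<close>: the value of gate \<open>g\<close> at position \<open>length vs\<close>, if \<open>vs\<close> are the values of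
  the earlier gates and \<open>A\<close> is the set of input nodes that receive the value true.\<close>

fun gate_value :: "nat set \<Rightarrow> bool list \<Rightarrow> gate \<Rightarrow> bool" where
  "gate_value A vs Input \<longleftrightarrow> length vs \<in> A"
| "gate_value A vs (Neg j) \<longleftrightarrow> \<not> vs ! j"
| "gate_value A vs (Conj js) \<longleftrightarrow> (\<forall>j \<in> set js. vs ! j)"
| "gate_value A vs (Disj js) \<longleftrightarrow> (\<exists>j \<in> set js. vs ! j)"

definition circuit_values :: "nat set \<Rightarrow> circuit \<Rightarrow> bool list" where
  "circuit_values A C = foldl (\<lambda>vs g. vs @ [gate_value A vs g]) [] C"

definition satisfies :: "nat set \<Rightarrow> circuit \<Rightarrow> bool" where
  "satisfies A C \<longleftrightarrow> last (circuit_values A C)"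

definition io_path :: "circuit \<Rightarrow> nat list \<Rightarrow> bool" where
  "io_path C p \<longleftrightarrow> p \<noteq> [] \<and> set p \<subseteq> {..<length C} \<and>
     hd p \<in> input_nodes C \<and> last p = length C - 1 \<and>
     successively (\<lambda>i j. i \<in> set (in_nbrs (C ! j))) p"

definition large :: "gate \<Rightarrow> bool" where
  "large g \<longleftrightarrow> length (in_nbrs g) > 2"

definition depth_at_most :: "nat \<Rightarrow> circuit \<Rightarrow> bool" where
  "depth_at_most d C \<longleftrightarrow> (\<forall>p. io_path C p \<longrightarrow> length p - 1 \<le> d)"

definition weft_at_most :: "nat \<Rightarrow> circuit \<Rightarrow> bool" where
  "weft_at_most t C \<longleftrightarrow> (\<forall>p. io_path C p \<longrightarrow> length (filter (\<lambda>i. large (C ! i)) p) \<le> t)"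

fun enc_gate :: "gate \<Rightarrow> tree" where
  "enc_gate Input = Node (enc_nat 0) Leaf"
| "enc_gate (Neg j) = Node (enc_nat 1) (enc_nat j)"
| "enc_gate (Conj js) = Node (enc_nat 2) (enc_list enc_nat js)"
| "enc_gate (Disj js) = Node (enc_nat 3) (enc_list enc_nat js)"

definition enc_circuit :: "circuit \<Rightarrow> tree" where
  "enc_circuit C = enc_list enc_gate C"

definition weighted_circuit_sat :: problem where
  "weighted_circuit_sat =
     {(enc_circuit C, k) | C k. wf_circuit C \<and>
        (\<exists>A \<subseteq> input_nodes C. card A = k \<and> satisfies A C)}"

definition weft_depth_instances :: "nat \<Rightarrow> nat \<Rightarrow> (tree \<times> nat) set" where
  "weft_depth_instances t d =
     {(enc_circuit C, k) | C k. wf_circuit C \<and> weft_at_most t C \<and> depth_at_most d C}"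

definition W_class :: "nat \<Rightarrow> problem set" where
  "W_class t = {P. \<exists>d. fpt_reducible P weighted_circuit_sat (weft_depth_instances t d)}"

text \<open>\<open>W_hard_on t Q I\<close>: the restriction of \<open>Q\<close> to the instances in \<open>I\<close> is W[\<open>t\<close>]-hard.\<close>

definition W_hard_on :: "nat \<Rightarrow> problem \<Rightarrow> (tree \<times> nat) set \<Rightarrow> bool" where
  "W_hard_on t Q I \<longleftrightarrow> (\<forall>P \<in> W_class t. fpt_reducible P Q I)"


section \<open>Independent dominating sets and 2-clubs\<close>

text \<open>Finite simple graphs are symmetric loop-free digraphs (\<open>pair_graph\<close>). As instances we take
  the graphs on a vertex set \<open>{..<n}\<close>, given by their adjacency matrices.\<close>

definition instance_graph :: "nat pair_pre_digraph \<Rightarrow> bool" where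
  "instance_graph G \<longleftrightarrow> pair_graph G \<and> (\<exists>n. pverts G = {..<n})"

definition enc_graph :: "nat pair_pre_digraph \<Rightarrow> tree" where
  "enc_graph G = (let vs = [0..<card (pverts G)] in
     enc_list (\<lambda>u. enc_list (\<lambda>v. enc_bool ((u, v) \<in> parcs G)) vs) vs)"

definition closed_nbhd :: "'a pair_pre_digraph \<Rightarrow> 'a \<Rightarrow> 'a set" where
  "closed_nbhd G v = insert v {w. (v, w) \<in> parcs G}"

definition independent :: "'a pair_pre_digraph \<Rightarrow> 'a set \<Rightarrow> bool" where
  "independent G D \<longleftrightarrow> (\<forall>u \<in> D. \<forall>v \<in> D. (u, v) \<notin> parcs G)"

definition independent_dominating_set :: "'a pair_pre_digraph \<Rightarrow> 'a set \<Rightarrow> bool" where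
  "independent_dominating_set G D \<longleftrightarrow>
     D \<subseteq> pverts G \<and> independent G D \<and> (\<Union>v \<in> D. closed_nbhd G v) = pverts G"

definition two_club :: "'a pair_pre_digraph \<Rightarrow> bool" where
  "two_club G \<longleftrightarrow>
     (\<forall>u \<in> pverts G. \<forall>v \<in> pverts G. wf_digraph.\<mu> (with_proj G) (\<lambda>_. 1) u v \<le> 2)"

definition independent_dominating_set_problem :: problem where
  "independent_dominating_set_problem =
     {(enc_graph G, k) | G k. instance_graph G \<and>
        (\<exists>D. independent_dominating_set G D \<and> card D \<le> k)}"

definition two_club_instances :: "(tree \<times> nat) set" where
  "two_club_instances = {(enc_graph G, k) | G k. instance_graph G \<and> two_club G}"

end

theory Submission
  imports Defs
begin

text \<open>
  A weight-\<open>k\<close> assignment of a circuit of weft one and depth \<open>d\<close> is a set of \<open>k\<close> input nodes, given by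
  its increasing enumeration. Knowing the enumeration at two successive indices settles the nodes in
  between, and so does knowing that a node is enumerated. As a path carries at most one large gate,
  at most \<open>2 ^ (d + 1)\<close> values of the enumeration certify the value of the output, provided that
  large gates without a known forcing in-neighbour are assumed to have their default value. Hence an
  assignment is satisfying iff some tuple of that length, merged with every other tuple of that
  length, leads to acceptance.

  The graph has a clique of candidate values for each tuple of indices and one more clique for the
  certificate; candidates of different cliques are adjacent iff they are incompatible. Two private
  neighbours per clique force an independent dominating set within the budget to pick exactly one
  candidate from each clique. A vertex that is adjacent to everything except a large independent set
  of vertices, which in turn are adjacent to all candidates, bounds all distances by two without
  being affordable in a dominating set. For fixed \<open>d\<close> the construction takes polynomial time, which
  is shown by closure properties of the functions computable by WHILE programs in polynomial time.
\<close>

section \<open>Running programs\<close>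

text \<open>Acceptance is not monotone in the information: a large conjunction counts as true as
  long as its false in-neighbours are unknown. Only a certificate is stable, in the sense that every
  truthful extension of it evaluates the output correctly, and such certificates exist for both
  truth values. If the assignment is rejected, the tuple that holds a certificate of rejection
  therefore refutes any tuple that it is merged with. The resulting test looks at only two tuples at
  a time, which is what the edges of a graph can express.

  The constant \<open>2 ^ Suc d\<close> arises because an input costs at most two pairs, a small
  gate at most doubles the cost, and a large gate needs a single in-neighbour or none. As
  \<open>d\<close> is fixed together with the problem, the tuple length \<open>r\<close> is a
  constant: there are polynomially many tuples of pairs, and the number of cliques,
  \<open>(k + 2) ^ r + 1\<close>, depends on \<open>k\<close> alone. No normal form of circuits is
  assumed; negations may occur anywhere, and large gates may be of either type.\<close>

definition steps :: "com \<Rightarrow> store \<Rightarrow> nat \<Rightarrow> store \<Rightarrow> bool" where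
  "steps c s T s' \<longleftrightarrow> (\<exists>t\<le>T. exec c s t s')"

lemma steps_mono: "steps c s T s' \<Longrightarrow> T \<le> T' \<Longrightarrow> steps c s T' s'"
  unfolding steps_def by (meson order_trans)

lemma steps_Assign: "Suc (size (exp_value e s)) \<le> T \<Longrightarrow> steps (Assign i e) s T (s(i := exp_value e s))"
  unfolding steps_def using exec.Assign[of i e s] by auto

lemma steps_Seq:
  assumes "steps c1 s T1 s'" "steps c2 s' T2 s''" "T1 + T2 \<le> T"
  shows "steps (Seq c1 c2) s T s''"
proof -
  from assms obtain t1 t2 where "exec c1 s t1 s'" "exec c2 s' t2 s''" "t1 \<le> T1" "t2 \<le> T2"
    unfolding steps_def by blast
  then show ?thesis
    unfolding steps_def using exec.Seq[of c1 s t1 s' c2 t2 s''] assms(3)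
      by (intro exI[of _ "t1 + t2"]) auto
qed

lemma steps_Cond:
  assumes "s i \<noteq> Leaf \<Longrightarrow> steps c1 s T s'" "s i = Leaf \<Longrightarrow> steps c2 s T s'" "Suc T \<le> T'"
  shows "steps (Cond i c1 c2) s T' s'"
proof (cases "s i = Leaf")
  case True
  then obtain t where "exec c2 s t s'" "t \<le> T" using assms(2) unfolding steps_def by blast
  then show ?thesis unfolding steps_def
    using exec.Cond_False[of s i c2 t s' c1] True assms(3) by (intro exI[of _ "1 + t"]) auto
next
  case False
  then obtain t where "exec c1 s t s'" "t \<le> T" using assms(1) unfolding steps_def by blast
  then show ?thesis unfolding steps_def
    using exec.Cond_True[of s i c1 t s' c2] False assms(3) by (intro exI[of _ "1 + t"]) auto
qed

lemma steps_While_False: "s i = Leaf \<Longrightarrow> 1 \<le> T \<Longrightarrow> steps (While i c) s T s"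
  unfolding steps_def using exec.While_False[of s i c] by auto

lemma steps_While_True:
  assumes "s i \<noteq> Leaf" "steps c s T1 s'" "steps (While i c) s' T2 s''" "Suc (T1 + T2) \<le> T"
  shows "steps (While i c) s T s''"
proof -
  from assms obtain t1 t2 where "exec c s t1 s'" "exec (While i c) s' t2 s''" "t1 \<le> T1" "t2 \<le> T2"
    unfolding steps_def by blast
  then show ?thesis
    unfolding steps_def using exec.While_True[of s i c t1 s' t2 s''] assms(1,4)
    by (intro exI[of _ "1 + t1 + t2"]) auto
qed

text \<open>Writing a value costs its size, so every value in the final store is an old one or has
  been paid for by the running time. This converts time bounds into size bounds.\<close>

lemma exec_size: "exec c s t s' \<Longrightarrow> size (s' i) \<le> max (size (s i)) t"
proof (induction rule: exec.induct)
  case (Seq c1 s t1 s' c2 t2 s'')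
  then show ?case by linarith
next
  case While_True
  then show ?case by linarith
qed auto

text \<open>The variables from 1 to \<open>m - 1\<close> are the workspace of \<open>c\<close>, which it finds and leaves empty. As
  it leaves all later variables unchanged, these can hold data for which \<open>c\<close> is a subroutine.\<close>

definition runs :: "com \<Rightarrow> nat \<Rightarrow> tree \<Rightarrow> nat \<Rightarrow> tree \<Rightarrow> bool" where
  "runs c m x T y \<longleftrightarrow>
     (\<forall>s. s 0 = x \<longrightarrow> (\<forall>i. 0 < i \<longrightarrow> i < m \<longrightarrow> s i = Leaf) \<longrightarrow> steps c s T (s(0 := y)))"

lemma runsI:
  assumes "\<And>s. s 0 = x \<Longrightarrow> (\<And>i. 0 < i \<Longrightarrow> i < m \<Longrightarrow> s i = Leaf) \<Longrightarrow> steps c s T (s(0 := y))"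
  shows "runs c m x T y"
  using assms unfolding runs_def by blast

lemma runsD:
  assumes "runs c m x T y" "s 0 = x" "\<And>i. 0 < i \<Longrightarrow> i < m \<Longrightarrow> s i = Leaf"
  shows "steps c s T (s(0 := y))"
  using assms unfolding runs_def by blast

lemma runs_mono: "runs c m x T y \<Longrightarrow> m \<le> m' \<Longrightarrow> T \<le> T' \<Longrightarrow> runs c m' x T' y"
  by (rule runsI) (meson runsD steps_mono order_less_le_trans)

lemma runs_size: "runs c m x T y \<Longrightarrow> size y \<le> size x + T"
proof -
  assume "runs c m x T y"
  then have "steps c ((\<lambda>_. Leaf)(0 := x)) T ((\<lambda>_. Leaf)(0 := y))"
    using runsD[of c m x T y "(\<lambda>_. Leaf)(0 := x)"]
      by (simp del: fun_upd_apply add: fun_upd_same fun_upd_other)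
  then obtain t where "t \<le> T" "exec c ((\<lambda>_. Leaf)(0 := x)) t ((\<lambda>_. Leaf)(0 := y))"
    unfolding steps_def by auto
  from exec_size[OF this(2), of 0] this(1) show ?thesis by simp
qed

lemma runs_computes: "runs c m x T y \<Longrightarrow> \<exists>t\<le>T. computes c x t y"
proof -
  assume "runs c m x T y"
  then have "steps c ((\<lambda>_. Leaf)(0 := x)) T ((\<lambda>_. Leaf)(0 := y))"
    using runsD[of c m x T y "(\<lambda>_. Leaf)(0 := x)"]
      by (simp del: fun_upd_apply add: fun_upd_same fun_upd_other)
  then show ?thesis
    unfolding steps_def computes_def by (metis fun_upd_same)
qed

lemma runs_Assign:
  assumes "\<And>s. s 0 = x \<Longrightarrow> exp_value e s = y"
  shows "runs (Assign 0 e) 0 x (Suc (size y)) y"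
  by (rule runsI) (metis steps_Assign assms order_refl)

lemma runs_Seq: "runs c1 m x T1 y \<Longrightarrow> runs c2 m y T2 z \<Longrightarrow> runs (Seq c1 c2) m x (T1 + T2) z"
proof (rule runsI)
  fix s assume "runs c1 m x T1 y" "runs c2 m y T2 z"
    and s: "s 0 = x" "\<And>i. 0 < i \<Longrightarrow> i < m \<Longrightarrow> s i = Leaf"
  then have "steps c1 s T1 (s(0 := y))" "steps c2 (s(0 := y)) T2 (s(0 := y, 0 := z))"
    by (intro runsD[of c1 m x] runsD[of c2 m y]; simp)+
  then show "steps (Seq c1 c2) s (T1 + T2) (s(0 := z))"
    by (auto intro: steps_Seq)
qed

section \<open>Program combinators: pairing, branching, folding over a list\<close>

definition pair_prog :: "nat \<Rightarrow> com \<Rightarrow> com \<Rightarrow> com" where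
  "pair_prog m c1 c2 =
     Seq (Assign m (Var 0)) (Seq c1 (Seq (Assign (m + 1) (Var 0)) (Seq (Assign 0 (Var m))
     (Seq c2 (Seq (Assign 0 (Mk_Node (Var (m + 1)) (Var 0)))
     (Seq (Assign m Const_Leaf) (Assign (m + 1) Const_Leaf)))))))"

lemma runs_pair:
  assumes "runs c1 m x T1 y1" "runs c2 m x T2 y2" "0 < m"
  shows "runs (pair_prog m c1 c2) (m + 2) x (9 * (T1 + T2 + size x + 1)) (Node y1 y2)"
proof (rule runsI)
  fix s assume s: "s 0 = x" "\<And>i. 0 < i \<Longrightarrow> i < m + 2 \<Longrightarrow> s i = Leaf"
  have y: "size y1 \<le> size x + T1" "size y2 \<le> size x + T2" using assms runs_size by blast+
  define s1 where "s1 = s(m := x)"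
  define s2 where "s2 = s1(0 := y1)"
  define s3 where "s3 = s2(m + 1 := y1)"
  define s4 where "s4 = s3(0 := x)"
  define s5 where "s5 = s4(0 := y2)"
  define s6 where "s6 = s5(0 := Node y1 y2)"
  define s7 where "s7 = s6(m := Leaf)"
  note defs = s1_def s2_def s3_def s4_def s5_def s6_def s7_def
  have 1: "steps (Assign m (Var 0)) s (Suc (size x)) s1"
    using steps_Assign[of "Var 0" s "Suc (size x)" m] s by (simp add: defs)
  have 2: "steps c1 s1 T1 s2"
    unfolding s2_def by (rule runsD[OF assms(1)]) (use s assms(3) in \<open>auto simp: defs\<close>)
  have 3: "steps (Assign (m + 1) (Var 0)) s2 (Suc (size y1)) s3"
    using steps_Assign[of "Var 0" s2 "Suc (size y1)" "m + 1"] s by (simp add: defs)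
  have 4: "steps (Assign 0 (Var m)) s3 (Suc (size x)) s4"
    using steps_Assign[of "Var m" s3 "Suc (size x)" 0] s assms(3) by (simp add: defs)
  have 5: "steps c2 s4 T2 s5"
    unfolding s5_def by (rule runsD[OF assms(2)]) (use s assms(3) in \<open>auto simp: defs\<close>)
  have 6: "steps (Assign 0 (Mk_Node (Var (m + 1)) (Var 0))) s5 (size y1 + size y2 + 2) s6"
    using steps_Assign[of "Mk_Node (Var (m + 1)) (Var 0)" s5 "size y1 + size y2 + 2" 0] s assms(3)
    by (simp add: defs)
  have 7: "steps (Assign m Const_Leaf) s6 1 s7"
    using steps_Assign[of Const_Leaf s6 1 m] by (simp add: defs)
  have "s(0 := Node y1 y2) = s7(m + 1 := Leaf)"
    using s assms(3) by (auto simp: defs fun_eq_iff)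
  then have 8: "steps (Assign (m + 1) Const_Leaf) s7 1 (s(0 := Node y1 y2))"
    using steps_Assign[of Const_Leaf s7 1 "m + 1"] by simp
  show "steps (pair_prog m c1 c2) s (9 * (T1 + T2 + size x + 1)) (s(0 := Node y1 y2))"
    unfolding pair_prog_def
    by (rule steps_mono, (rule steps_Seq 1 2 3 4 5 6 7 8 order_refl)+) (use y in simp)
qed

definition cond_prog :: "nat \<Rightarrow> com \<Rightarrow> com \<Rightarrow> com \<Rightarrow> com" where
  "cond_prog m c c1 c2 =
     Seq (Assign m (Var 0)) (Seq c (Seq (Assign (m + 1) (Var 0)) (Seq (Assign 0 (Var m))
     (Seq (Assign m Const_Leaf) (Seq (Cond (m + 1) (Seq (Assign (m + 1) Const_Leaf) c1) c2)
     (Assign (m + 1) Const_Leaf))))))"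

lemma runs_cond:
  assumes "runs c m x T (enc_bool b)" "b \<Longrightarrow> runs c1 m x T1 y" "\<not> b \<Longrightarrow> runs c2 m x T1 y" "0 < m"
  shows "runs (cond_prog m c c1 c2) (m + 2) x (9 * (T + T1 + size x + 1)) y"
proof (rule runsI)
  fix s assume s: "s 0 = x" "\<And>i. 0 < i \<Longrightarrow> i < m + 2 \<Longrightarrow> s i = Leaf"
  have y: "size (enc_bool b) \<le> 1" by (simp add: enc_bool_def)
  define s1 where "s1 = s(m := x)"
  define s2 where "s2 = s1(0 := enc_bool b)"
  define s3 where "s3 = s2(m + 1 := enc_bool b)"
  define s4 where "s4 = s3(0 := x)"
  define s5 where "s5 = s4(m := Leaf)"
  define s6 where "s6 = s(0 := y)"
  \<comment> \<open>Both branches effectively start from \<open>sa\<close>: the true branch empties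
    the flag itself, and in the false branch it is empty already.\<close>
  define sa where "sa = s5(m + 1 := Leaf)"
  note defs = s1_def s2_def s3_def s4_def s5_def s6_def sa_def
  have 1: "steps (Assign m (Var 0)) s (Suc (size x)) s1"
    using steps_Assign[of "Var 0" s "Suc (size x)" m] s by (simp add: defs)
  have 2: "steps c s1 T s2"
    unfolding s2_def by (rule runsD[OF assms(1)]) (use s assms(4) in \<open>auto simp: defs\<close>)
  have 3: "steps (Assign (m + 1) (Var 0)) s2 2 s3"
    using steps_Assign[of "Var 0" s2 2 "m + 1"] s y by (simp add: defs)
  have 4: "steps (Assign 0 (Var m)) s3 (Suc (size x)) s4"
    using steps_Assign[of "Var m" s3 "Suc (size x)" 0] s assms(4) by (simp add: defs)
  have 5: "steps (Assign m Const_Leaf) s4 1 s5"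
    using steps_Assign[of Const_Leaf s4 1 m] by (simp add: defs)
  have eq: "sa(0 := y) = s6" using s assms(4) by (auto simp: defs fun_eq_iff)
  have 6: "steps (Cond (m + 1) (Seq (Assign (m + 1) Const_Leaf) c1) c2) s5 (T1 + 2) s6"
  proof (rule steps_Cond[of _ _ _ "1 + T1"])
    assume "s5 (m + 1) \<noteq> Leaf"
    then have b: b by (simp add: defs enc_bool_def split: if_splits)
    have "steps (Assign (m + 1) Const_Leaf) s5 1 sa"
      using steps_Assign[of Const_Leaf s5 1 "m + 1"] by (simp add: defs)
    moreover have "steps c1 sa T1 s6"
      unfolding eq[symmetric]
      by (rule runsD[OF assms(2)]) (use s b assms(4) in \<open>auto simp: defs\<close>)
    ultimately show "steps (Seq (Assign (m + 1) Const_Leaf) c1) s5 (1 + T1) s6"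
      by (rule steps_Seq) simp
  next
    assume 0: "s5 (m + 1) = Leaf"
    then have b: "\<not> b" by (simp add: defs enc_bool_def split: if_splits)
    have "s5 = sa" using 0 by (auto simp: sa_def fun_eq_iff)
    moreover have "steps c2 sa T1 s6"
      unfolding eq[symmetric]
      by (rule runsD[OF assms(3)]) (use s b assms(4) in \<open>auto simp: defs\<close>)
    ultimately show "steps c2 s5 (1 + T1) s6" by (auto intro: steps_mono)
  qed simp
  have "s6(m + 1 := Leaf) = s(0 := y)" using s by (auto simp: defs fun_eq_iff)
  then have 7: "steps (Assign (m + 1) Const_Leaf) s6 1 (s(0 := y))"
    using steps_Assign[of Const_Leaf s6 1 "m + 1"] by simp
  show "steps (cond_prog m c c1 c2) s (9 * (T + T1 + size x + 1)) (s(0 := y))"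
    unfolding cond_prog_def
    by (rule steps_mono, (rule steps_Seq 1 2 3 4 5 6 7 order_refl)+) (use y in simp)
qed

definition fold_body :: "nat \<Rightarrow> com \<Rightarrow> com" where
  "fold_body m c =
     Seq (Assign 0 (Mk_Node (Var m) (Mk_Node (Left (Var (m + 1))) (Var 0))))
     (Seq c (Assign (m + 1) (Right (Var (m + 1)))))"

definition fold_prog :: "nat \<Rightarrow> com \<Rightarrow> com" where
  "fold_prog m c =
     Seq (Assign m (Left (Var 0))) (Seq (Assign (m + 1) (Left (Right (Var 0))))
     (Seq (Assign 0 (Right (Right (Var 0)))) (Seq (While (m + 1) (fold_body m c))
     (Assign m Const_Leaf))))"

text \<open>The premises speak only of states reached after a prefix of the list, since time and
  size bounds will be available for these alone. The environment \<open>e\<close> stays in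
  \<open>m\<close> and is handed to the body in every round; \<open>m + 1\<close> holds the rest of
  the list.\<close>

lemma steps_fold_loop:
  assumes "\<And>ys x zs. xs = ys @ x # zs \<Longrightarrow>
      runs c m (Node e (Node (f x) (S (fold h ys s0)))) T (S (fold h (ys @ [x]) s0))"
    and "\<And>ys zs. xs = ys @ zs \<Longrightarrow> size (S (fold h ys s0)) \<le> B"
    and "s 0 = S s0" "s m = e" "s (m + 1) = enc_list f xs"
    and "\<And>i. 0 < i \<Longrightarrow> i < m \<Longrightarrow> s i = Leaf" and "0 < m"
    and "size e + size (enc_list f xs) \<le> B"
  shows "steps (While (m + 1) (fold_body m c)) s (1 + length xs * (T + 3 * B + 9))
           (s(0 := S (fold h xs s0), m + 1 := Leaf))"
  using assms
proof (induction xs arbitrary: s0 s)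
  case Nil
  then have "s(0 := S (fold h [] s0), m + 1 := Leaf) = s" by (auto simp: fun_eq_iff)
  then show ?case using Nil steps_While_False[of s "m + 1"] by (simp del: fun_upd_apply)
next
  case (Cons x xs)
  define s1 where "s1 = s(0 := Node e (Node (f x) (S s0)))"
  define s2 where "s2 = s1(0 := S (h x s0))"
  define s3 where "s3 = s2(m + 1 := enc_list f xs)"
  note defs = s1_def s2_def s3_def
  have S: "size (S s0) \<le> B" using Cons.prems(2)[of "[]" "x # xs"] by simp
  have B: "size e \<le> B" "size (f x) \<le> B" "size (enc_list f xs) \<le> B" using Cons.prems(8)
    by simp_all
  have 1: "steps (Assign 0 (Mk_Node (Var m) (Mk_Node (Left (Var (m + 1))) (Var 0)))) s (2 * B + 3) s1"
    using steps_Assign[of "Mk_Node (Var m) (Mk_Node (Left (Var (m + 1))) (Var 0))" s "2 * B + 3" 0]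
      Cons.prems(3,4,5,8) S by (simp add: defs)
  have 2: "steps c s1 T s2"
    unfolding s2_def
    by (rule runsD) (use Cons.prems(1)[of "[]" x xs] Cons.prems(6,7) in \<open>auto simp: defs\<close>)
  have 3: "steps (Assign (m + 1) (Right (Var (m + 1)))) s2 (B + 1) s3"
    using steps_Assign[of "Right (Var (m + 1))" s2 "B + 1" "m + 1"] Cons.prems(5) B
    by (simp add: defs)
  have body: "steps (fold_body m c) s (T + 3 * B + 4) s3"
    unfolding fold_body_def by (rule steps_mono, (rule steps_Seq 1 2 3 order_refl)+) simp
  have "steps (While (m + 1) (fold_body m c)) s3 (1 + length xs * (T + 3 * B + 9))
           (s3(0 := S (fold h xs (h x s0)), m + 1 := Leaf))"
  proof (rule Cons.IH)
    fix ys y zs assume "xs = ys @ y # zs"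
    then show "runs c m (Node e (Node (f y) (S (fold h ys (h x s0))))) T
        (S (fold h (ys @ [y]) (h x s0)))"
      using Cons.prems(1)[of "x # ys" y zs] by simp
  next
    fix ys zs assume "xs = ys @ zs"
    then show "size (S (fold h ys (h x s0))) \<le> B"
      using Cons.prems(2)[of "x # ys" zs] by simp
  qed (use Cons.prems(3-8) in \<open>auto simp: defs\<close>)
  moreover have "s3(0 := S (fold h xs (h x s0)), m + 1 := Leaf)
      = s(0 := S (fold h (x # xs) s0), m + 1 := Leaf)"
    by (auto simp: defs fun_eq_iff)
  ultimately show ?case
    using steps_While_True[OF _ body, of "m + 1"] Cons.prems(5) by (simp del: fun_upd_apply)
qed

lemma runs_fold:
  assumes "\<And>ys x zs. xs = ys @ x # zs \<Longrightarrow>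
      runs c m (Node e (Node (f x) (S (fold h ys s0)))) T (S (fold h (ys @ [x]) s0))"
    and "\<And>ys zs. xs = ys @ zs \<Longrightarrow> size (S (fold h ys s0)) \<le> B"
    and "0 < m" and "size e + size (enc_list f xs) \<le> B"
  shows "runs (fold_prog m c) (m + 2) (Node e (Node (enc_list f xs) (S s0)))
           (9 * (B + 1) + length xs * (T + 3 * B + 9)) (S (fold h xs s0))"
proof (rule runsI)
  fix s assume s: "s 0 = Node e (Node (enc_list f xs) (S s0))"
    "\<And>i. 0 < i \<Longrightarrow> i < m + 2 \<Longrightarrow> s i = Leaf"
  define s1 where "s1 = s(m := e)"
  define s2 where "s2 = s1(m + 1 := enc_list f xs)"
  define s3 where "s3 = s2(0 := S s0)"
  define s4 where "s4 = s3(0 := S (fold h xs s0), m + 1 := Leaf)"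
  note defs = s1_def s2_def s3_def s4_def
  have S: "size (S s0) \<le> B" using assms(2)[of "[]" xs] by simp
  have 1: "steps (Assign m (Left (Var 0))) s (B + 1) s1"
    using steps_Assign[of "Left (Var 0)" s "B + 1" m] s assms(4) by (simp add: defs)
  have 2: "steps (Assign (m + 1) (Left (Right (Var 0)))) s1 (B + 1) s2"
    using steps_Assign[of "Left (Right (Var 0))" s1 "B + 1" "m + 1"] s assms(3,4)
      by (simp add: defs)
  have 3: "steps (Assign 0 (Right (Right (Var 0)))) s2 (B + 1) s3"
    using steps_Assign[of "Right (Right (Var 0))" s2 "B + 1" 0] s assms(3) S by (simp add: defs)
  have 4: "steps (While (m + 1) (fold_body m c)) s3 (1 + length xs * (T + 3 * B + 9)) s4"
    unfolding s4_def
    by (rule steps_fold_loop) (use assms s in \<open>auto simp: defs\<close>)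
  have "s4(m := Leaf) = s(0 := S (fold h xs s0))"
    using s assms(3) by (auto simp: defs fun_eq_iff)
  then have 5: "steps (Assign m Const_Leaf) s4 1 (s(0 := S (fold h xs s0)))"
    using steps_Assign[of Const_Leaf s4 1 m] by simp
  show "steps (fold_prog m c) s (9 * (B + 1) + length xs * (T + 3 * B + 9)) (s(0 := S (fold h xs s0)))"
    unfolding fold_prog_def
    by (rule steps_mono, (rule steps_Seq 1 2 3 4 5 order_refl)+) simp
qed

section \<open>Polynomial-time computable functions\<close>

text \<open>The arguments \<open>a\<close> range over an arbitrary type and are given by an encoding \<open>E\<close>; in nested
  constructions \<open>E a\<close> becomes the environment of all bound variables.\<close>

definition pbounded :: "('a \<Rightarrow> tree) \<Rightarrow> ('a \<Rightarrow> nat) \<Rightarrow> bool" where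
  "pbounded E T \<longleftrightarrow> (\<exists>e. \<forall>a. T a \<le> (size (E a) + 2) ^ e)"

definition ptime :: "('a \<Rightarrow> tree) \<Rightarrow> ('a \<Rightarrow> tree) \<Rightarrow> bool" where
  "ptime E F \<longleftrightarrow> (\<exists>c m T. pbounded E T \<and> (\<forall>a. runs c m (E a) (T a) (F a)))"

lemma pboundedI: "(\<And>a. T a \<le> (size (E a) + 2) ^ e) \<Longrightarrow> pbounded E T"
  unfolding pbounded_def by blast

lemma pbounded_mono: "pbounded E T \<Longrightarrow> (\<And>a. T' a \<le> T a) \<Longrightarrow> pbounded E T'"
  unfolding pbounded_def by (meson order_trans)

text \<open>The summand 2 keeps the base at least 2 even for encodings of size 0, so
  \<open>2 ^ n\<close> dominates the constant. For the same reason sums of polynomial bounds can be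
  absorbed into a higher exponent.\<close>

lemma pbounded_const: "pbounded E (\<lambda>_. n)"
proof (rule pboundedI)
  fix a
  have "n \<le> 2 ^ n" using less_exp[of n] by simp
  also have "\<dots> \<le> (size (E a) + 2) ^ n" by (rule power_mono) auto
  finally show "n \<le> (size (E a) + 2) ^ n" .
qed

lemma pbounded_size: "pbounded E (\<lambda>a. size (E a))"
  by (rule pboundedI[where e = 1]) simp

lemma pbounded_mult:
  assumes "pbounded E T" "pbounded E T'" shows "pbounded E (\<lambda>a. T a * T' a)"
proof -
  from assms obtain e e' where "\<And>a. T a \<le> (size (E a) + 2) ^ e" "\<And>a. T' a \<le> (size (E a) + 2) ^ e'"
    unfolding pbounded_def by blast
  then show ?thesis by (intro pboundedI[where e = "e + e'"]) (simp add: power_add mult_mono)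
qed

lemma pbounded_add:
  assumes "pbounded E T" "pbounded E T'" shows "pbounded E (\<lambda>a. T a + T' a)"
proof -
  from assms obtain e e' where e: "\<And>a. T a \<le> (size (E a) + 2) ^ e" "\<And>a. T' a \<le> (size (E a) + 2) ^ e'"
    unfolding pbounded_def by blast
  show ?thesis
  proof (rule pboundedI)
    fix a
    let ?n = "size (E a) + 2"
    have "?n ^ e \<le> ?n ^ (e + e')" "?n ^ e' \<le> ?n ^ (e + e')"
      by (rule power_increasing; simp)+
    with e[of a] have "T a + T' a \<le> 2 * ?n ^ (e + e')" by linarith
    also have "\<dots> \<le> ?n * ?n ^ (e + e')" by (rule mult_right_mono) auto
    finally show "T a + T' a \<le> ?n ^ Suc (e + e')" by simp
  qed
qed

lemma pbounded_Suc: "pbounded E T \<Longrightarrow> pbounded E (\<lambda>a. Suc (T a))"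
  using pbounded_add[OF _ pbounded_const[of E 1]] by simp

lemma pbounded_power: "pbounded E T \<Longrightarrow> pbounded E (\<lambda>a. T a ^ n)"
  by (induction n) (auto intro: pbounded_mult pbounded_const)

lemma pbounded_comp:
  assumes "pbounded E (\<lambda>a. size (E' (g a)))" "pbounded E' T"
  shows "pbounded E (\<lambda>a. T (g a))"
proof -
  from assms(2) obtain e where e: "\<And>a. T a \<le> (size (E' a) + 2) ^ e" unfolding pbounded_def
    by blast
  have "pbounded E (\<lambda>a. (size (E' (g a)) + 2) ^ e)"
    by (rule pbounded_power[OF pbounded_add[OF assms(1) pbounded_const]])
  then show ?thesis by (rule pbounded_mono) (rule e)
qed

lemmas pbounded_intros =
  pbounded_size pbounded_Suc pbounded_add pbounded_mult pbounded_power pbounded_const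

lemma ptimeI: "(\<And>a. runs c m (E a) (T a) (F a)) \<Longrightarrow> pbounded E T \<Longrightarrow> ptime E F"
  unfolding ptime_def by blast

lemma ptimeE:
  assumes "ptime E F"
  obtains T m c where "pbounded E T" "\<forall>a m'. m \<le> m' \<longrightarrow> runs c m' (E a) (T a) (F a)"
proof -
  from assms obtain c m T where "pbounded E T" "\<And>a. runs c m (E a) (T a) (F a)"
    unfolding ptime_def by blast
  then show ?thesis by (intro that) (auto intro: runs_mono)
qed

lemma ptime_size: "ptime E F \<Longrightarrow> pbounded E (\<lambda>a. size (F a))"
proof -
  assume "ptime E F"
  then obtain c m T where T: "pbounded E T"
    and c: "\<forall>a m'. m \<le> m' \<longrightarrow> runs c m' (E a) (T a) (F a)"
    by (rule ptimeE)
  note c = c[rule_format]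
  have "size (F a) \<le> size (E a) + T a" for a using runs_size[OF c[OF order_refl]] .
  then show ?thesis by (rule pbounded_mono[OF pbounded_add[OF pbounded_size T]])
qed

text \<open>The type of \<open>g a\<close> may differ from that of \<open>a\<close>, so
  \<open>F\<close> has to be computed correctly on proper encodings only. The size bound for
  \<open>E' (g a)\<close> keeps the composed time polynomial.\<close>

lemma ptime_trans:
  assumes "ptime E (\<lambda>a. E' (g a))" "ptime E' F" shows "ptime E (\<lambda>a. F (g a))"
proof -
  obtain c m T where 1: "pbounded E T" "\<forall>a m'. m \<le> m' \<longrightarrow> runs c m' (E a) (T a) (E' (g a))"
    by (rule ptimeE[OF assms(1)])
  note 1 = 1[rule_format]
  obtain c' n T' where 2: "pbounded E' T'" "\<forall>a m'. n \<le> m' \<longrightarrow> runs c' m' (E' a) (T' a) (F a)"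
    by (rule ptimeE[OF assms(2)])
  note 2 = 2[rule_format]
  show ?thesis
  proof (rule ptimeI)
    show "runs (Seq c c') (max m n) (E a) (T a + T' (g a)) (F (g a))" for a
      using 1(2)[of "max m n" a] 2(2)[of "max m n" "g a"] by (auto intro: runs_Seq)
    show "pbounded E (\<lambda>a. T a + T' (g a))"
      by (intro pbounded_add 1(1) pbounded_comp[OF ptime_size[OF assms(1)] 2(1)])
  qed
qed

lemma ptime_trans_tree: "ptime E F \<Longrightarrow> ptime F G \<Longrightarrow> ptime E G"
  using ptime_trans[of E F "\<lambda>a. a" G] by simp

lemma ptime_exp:
  assumes "\<And>s a. s 0 = E a \<Longrightarrow> exp_value e s = F a" "\<And>a. size (F a) \<le> size (E a) + n"
  shows "ptime E F"
proof (rule ptimeI)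
  show "runs (Assign 0 e) 0 (E a) (Suc (size (F a))) (F a)" for a
    by (rule runs_Assign) (rule assms)
  show "pbounded E (\<lambda>a. Suc (size (F a)))"
    by (rule pbounded_mono[OF pbounded_Suc[OF pbounded_add[OF pbounded_size pbounded_const[of _ n]]]])
       (simp add: assms)
qed

lemma ptime_id: "ptime E E"
  by (rule ptime_exp[of _ "Var 0" _ 0]) auto

fun exp_of_tree :: "tree \<Rightarrow> exp" where
  "exp_of_tree Leaf = Const_Leaf"
| "exp_of_tree (Node a b) = Mk_Node (exp_of_tree a) (exp_of_tree b)"

lemma exp_value_exp_of_tree: "exp_value (exp_of_tree t) s = t"
  by (induction t) auto

lemma ptime_const: "ptime E (\<lambda>_. t)"
  by (rule ptime_exp[of _ "exp_of_tree t" _ "size t"]) (auto simp: exp_value_exp_of_tree)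

lemma size_left: "size (left t) \<le> size t" by (cases t) auto

lemma size_right: "size (right t) \<le> size t" by (cases t) auto

lemma ptime_left: "ptime E F \<Longrightarrow> ptime E (\<lambda>a. left (F a))"
  by (rule ptime_trans_tree, assumption, rule ptime_exp[of _ "exp.Left (Var 0)" _ 0])
     (auto simp: size_left)

lemma ptime_right: "ptime E F \<Longrightarrow> ptime E (\<lambda>a. right (F a))"
  by (rule ptime_trans_tree, assumption, rule ptime_exp[of _ "exp.Right (Var 0)" _ 0])
     (auto simp: size_right)

lemma ptime_Node:
  assumes "ptime E F" "ptime E G" shows "ptime E (\<lambda>a. Node (F a) (G a))"
proof -
  obtain c m T where 1: "pbounded E T" "\<forall>a m'. m \<le> m' \<longrightarrow> runs c m' (E a) (T a) (F a)"
    by (rule ptimeE[OF assms(1)])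
  note 1 = 1[rule_format]
  obtain c' n T' where 2: "pbounded E T'" "\<forall>a m'. n \<le> m' \<longrightarrow> runs c' m' (E a) (T' a) (G a)"
    by (rule ptimeE[OF assms(2)])
  note 2 = 2[rule_format]
  show ?thesis
  proof (rule ptimeI)
    show "runs (pair_prog (Suc (max m n)) c c') (Suc (max m n) + 2) (E a)
        (9 * (T a + T' a + size (E a) + 1)) (Node (F a) (G a))" for a
      by (intro runs_pair 1 2) auto
    show "pbounded E (\<lambda>a. 9 * (T a + T' a + size (E a) + 1))"
      by (intro pbounded_intros 1 2)
  qed
qed

lemma ptime_if:
  assumes "ptime E (\<lambda>a. enc_bool (b a))" "ptime E F" "ptime E G"
  shows "ptime E (\<lambda>a. if b a then F a else G a)"
proof -
  obtain c1 m1 T1 where 1: "pbounded E T1" "\<forall>a m'. m1 \<le> m' \<longrightarrow> runs c1 m' (E a) (T1 a) (enc_bool (b a))"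
    by (rule ptimeE[OF assms(1)])
  note 1 = 1[rule_format]
  obtain c2 m2 T2 where 2: "pbounded E T2" "\<forall>a m'. m2 \<le> m' \<longrightarrow> runs c2 m' (E a) (T2 a) (F a)"
    by (rule ptimeE[OF assms(2)])
  note 2 = 2[rule_format]
  obtain c3 m3 T3 where 3: "pbounded E T3" "\<forall>a m'. m3 \<le> m' \<longrightarrow> runs c3 m' (E a) (T3 a) (G a)"
    by (rule ptimeE[OF assms(3)])
  note 3 = 3[rule_format]
  let ?m = "Suc (m1 + m2 + m3)"
  show ?thesis
  proof (rule ptimeI)
    show "runs (cond_prog ?m c1 c2 c3) (?m + 2) (E a) (9 * (T1 a + (T2 a + T3 a) + size (E a) + 1))
        (if b a then F a else G a)" for a
    proof (rule runs_cond)
      show "b a \<Longrightarrow> runs c2 ?m (E a) (T2 a + T3 a) (if b a then F a else G a)"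
        using runs_mono[OF 2(2)[of ?m a]] by simp
      show "\<not> b a \<Longrightarrow> runs c3 ?m (E a) (T2 a + T3 a) (if b a then F a else G a)"
        using runs_mono[OF 3(2)[of ?m a]] by simp
    qed (auto intro: 1)
    show "pbounded E (\<lambda>a. 9 * (T1 a + (T2 a + T3 a) + size (E a) + 1))"
      by (intro pbounded_intros 1 2 3)
  qed
qed

section \<open>Sizes of encoded lists and bounded iteration\<close>

lemma size_enc_list: "size (enc_list f xs) = (\<Sum>x\<leftarrow>xs. Suc (size (f x)))"
  by (induction xs) auto

lemma size_enc_list_append: "size (enc_list f (xs @ ys)) = size (enc_list f xs) + size (enc_list f ys)"
  by (simp add: size_enc_list)

lemma size_enc_list_rev: "size (enc_list f (rev xs)) = size (enc_list f xs)"
  by (induction xs) (auto simp: size_enc_list_append)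

lemma length_le_size_enc_list: "length xs \<le> size (enc_list f xs)"
  by (induction xs) auto

lemma size_le_size_enc_list: "x \<in> set xs \<Longrightarrow> size (f x) \<le> size (enc_list f xs)"
  by (induction xs) auto

text \<open>Iterating a polynomial-time step may square the state in every round. Hence a polynomial
  bound \<open>B\<close> on all intermediate states is a premise, to be established separately for
  each use.\<close>

lemma ptime_fold:
  assumes xs: "ptime E (\<lambda>a. enc_list f (xs a))"
    and st: "ptime E (\<lambda>a. S (st a))"
    and h: "ptime (\<lambda>z. Node (E (fst z)) (Node (f (fst (snd z))) (S (snd (snd z)))))
              (\<lambda>z. S (h (fst z) (fst (snd z)) (snd (snd z))))"
    and B: "pbounded E B" "\<And>a ys zs. xs a = ys @ zs \<Longrightarrow> size (S (fold (h a) ys (st a))) \<le> B a"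
  shows "ptime E (\<lambda>a. S (fold (h a) (xs a) (st a)))"
proof -
  let ?E = "\<lambda>z. Node (E (fst z)) (Node (f (fst (snd z))) (S (snd (snd z))))"
  let ?X = "\<lambda>a. size (enc_list f (xs a))"
  obtain c m T where T: "pbounded ?E T" and
    c: "\<forall>z m'. m \<le> m' \<longrightarrow> runs c m' (?E z) (T z) (S (h (fst z) (fst (snd z)) (snd (snd z))))"
    by (rule ptimeE[OF h])
  note c = c[rule_format]
  obtain e where e: "\<And>z. T z \<le> (size (?E z) + 2) ^ e" using T unfolding pbounded_def
    by blast
  \<comment> \<open>One bound for all rounds: the argument of the step adds two nodes to its three
    components, and 2 more come from the base in \<open>pbounded\<close>, which explains the
    4.\<close>
  define T' where "T' a = (size (E a) + ?X a + B a + 4) ^ e" for a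
  define B' where "B' a = size (E a) + ?X a + B a" for a
  have X: "pbounded E ?X" by (rule ptime_size[OF xs])
  let ?F = "\<lambda>a. Node (E a) (Node (enc_list f (xs a)) (S (st a)))"
  have "ptime ?F (\<lambda>a. S (fold (h a) (xs a) (st a)))"
  proof (rule ptimeI)
    fix a
    show "runs (fold_prog (Suc m) c) (Suc m + 2) (?F a)
        (9 * (B' a + 1) + length (xs a) * (T' a + 3 * B' a + 9)) (S (fold (h a) (xs a) (st a)))"
    proof (rule runs_fold)
      fix ys x zs assume eq: "xs a = ys @ x # zs"
      let ?s = "fold (h a) ys (st a)"
      have "size (f x) \<le> ?X a" by (rule size_le_size_enc_list) (simp add: eq)
      moreover have "size (S ?s) \<le> B a" using B(2)[OF eq] .
      ultimately have "(size (?E (a, x, ?s)) + 2) ^ e \<le> T' a"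
        unfolding T'_def by (intro power_mono) auto
      then have "T (a, x, ?s) \<le> T' a" using e[of "(a, x, ?s)"] by simp
      then show "runs c (Suc m) (Node (E a) (Node (f x) (S ?s))) (T' a) (S (fold (h a) (ys @ [x]) (st a)))"
        using runs_mono[OF c[of m "(a, x, ?s)"], of "Suc m" "T' a"] by simp
    next
      fix ys zs assume "xs a = ys @ zs"
      from B(2)[OF this] show "size (S (fold (h a) ys (st a))) \<le> B' a" by (simp add: B'_def)
    qed (auto simp: B'_def)
  next
    have "pbounded E (\<lambda>a. 9 * (B' a + 1) + length (xs a) * (T' a + 3 * B' a + 9))"
      unfolding B'_def T'_def
      by (intro pbounded_intros X B(1) pbounded_mono[OF X length_le_size_enc_list])
    then obtain e' where
      "\<And>a. 9 * (B' a + 1) + length (xs a) * (T' a + 3 * B' a + 9) \<le> (size (E a) + 2) ^ e'"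
      unfolding pbounded_def by blast
    moreover have "(size (E a) + 2) ^ e' \<le> (size (?F a) + 2) ^ e'" for a
      by (rule power_mono) auto
    ultimately show "pbounded ?F (\<lambda>a. 9 * (B' a + 1) + length (xs a) * (T' a + 3 * B' a + 9))"
      by (intro pboundedI) (rule order_trans)
  qed
  then show ?thesis
    by (rule ptime_trans_tree[rotated]) (intro ptime_Node ptime_id xs st)
qed

subsection \<open>Booleans and natural numbers\<close>

lemma ptime_True: "ptime E (\<lambda>_. enc_bool True)"
  and ptime_False: "ptime E (\<lambda>_. enc_bool False)"
  by (rule ptime_const)+

lemma ptime_If_bool:
  assumes "ptime E (\<lambda>a. enc_bool (b a))" "ptime E (\<lambda>a. enc_bool (c a))" "ptime E (\<lambda>a. enc_bool (d a))"
  shows "ptime E (\<lambda>a. enc_bool (if b a then c a else d a))"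
  using ptime_if[OF assms] by (simp add: if_distrib)

lemma if_bool_eqs:
  "(if b then False else True) = (\<not> b)" "(if b then c else False) = (b \<and> c)"
  "(if b then True else c) = (b \<or> c)" "(if b then c else True) = (b \<longrightarrow> c)"
  "(if b then c else \<not> c) = (b \<longleftrightarrow> c)"
  by auto

lemma ptime_not: "ptime E (\<lambda>a. enc_bool (b a)) \<Longrightarrow> ptime E (\<lambda>a. enc_bool (\<not> b a))"
  using ptime_If_bool[OF _ ptime_False ptime_True, of E b] by (simp only: if_bool_eqs(1))

lemma ptime_and:
  "ptime E (\<lambda>a. enc_bool (b a)) \<Longrightarrow> ptime E (\<lambda>a. enc_bool (c a)) \<Longrightarrow> ptime E (\<lambda>a. enc_bool (b a \<and> c a))"
  using ptime_If_bool[OF _ _ ptime_False, of E b c] by (simp only: if_bool_eqs)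

lemma ptime_or:
  "ptime E (\<lambda>a. enc_bool (b a)) \<Longrightarrow> ptime E (\<lambda>a. enc_bool (c a)) \<Longrightarrow> ptime E (\<lambda>a. enc_bool (b a \<or> c a))"
  using ptime_If_bool[OF _ ptime_True, of E b c] by (simp only: if_bool_eqs)

lemma ptime_imp:
  "ptime E (\<lambda>a. enc_bool (b a)) \<Longrightarrow> ptime E (\<lambda>a. enc_bool (c a)) \<Longrightarrow> ptime E (\<lambda>a. enc_bool (b a \<longrightarrow> c a))"
  using ptime_If_bool[OF _ _ ptime_True, of E b c] by (simp only: if_bool_eqs)

lemma ptime_iff:
  "ptime E (\<lambda>a. enc_bool (b a)) \<Longrightarrow> ptime E (\<lambda>a. enc_bool (c a)) \<Longrightarrow> ptime E (\<lambda>a. enc_bool (b a \<longleftrightarrow> c a))"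
  using ptime_If_bool[OF _ _ ptime_not, of E b c c] by (simp only: if_bool_eqs)

lemmas ptime_bool = ptime_True ptime_False ptime_If_bool ptime_not ptime_and ptime_or ptime_imp ptime_iff

lemma ptime_neq_Leaf:
  assumes "ptime E F" shows "ptime E (\<lambda>a. enc_bool (F a \<noteq> Leaf))"
proof (rule ptime_trans_tree[OF assms ptimeI])
  show "runs (Cond 0 (Assign 0 (exp_of_tree (Node Leaf Leaf))) (Assign 0 Const_Leaf)) 0
     (F a) 3 (enc_bool (F a \<noteq> Leaf))" for a
    by (rule runsI, rule steps_Cond[where T = 2])
       (auto simp: enc_bool_def exp_value_exp_of_tree simp del: fun_upd_apply exp_of_tree.simps
          intro!: steps_Assign[of "exp_of_tree _", simplified exp_value_exp_of_tree]
            steps_Assign[of Const_Leaf, simplified])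
qed (rule pbounded_const)

lemma enc_nat_eq_enc_list: "enc_nat n = enc_list (\<lambda>_. Leaf) (replicate n ())"
  by (induction n) auto

lemma size_enc_nat [simp]: "size (enc_nat n) = n"
  by (induction n) auto

lemma right_enc_nat: "right (enc_nat n) = enc_nat (n - 1)"
  by (cases n) auto

lemma enc_nat_eq_Leaf [simp]: "enc_nat n = Leaf \<longleftrightarrow> n = 0"
  by (cases n) auto

lemma ptime_Suc: "ptime E (\<lambda>a. enc_nat (n a)) \<Longrightarrow> ptime E (\<lambda>a. enc_nat (Suc (n a)))"
  using ptime_Node[OF ptime_const] by simp

text \<open>A unary number is a list of leaves, so iteration is a fold over the number itself. That
  \<open>h\<close> does not enlarge the state gives the bound which \<open>ptime_fold\<close> asks
  for.\<close>

lemma ptime_iterate: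
  assumes n: "ptime E (\<lambda>a. enc_nat (n a))" and st: "ptime E (\<lambda>a. S (st a))"
    and h: "ptime S (\<lambda>s. S (h s))" and "\<And>s. size (S (h s)) \<le> size (S s)"
  shows "ptime E (\<lambda>a. S ((h ^^ n a) (st a)))"
proof -
  have fold: "fold (\<lambda>_. h) xs s = (h ^^ length xs) s" for xs :: "unit list" and s
    by (induction xs arbitrary: s) (auto simp: funpow_swap1)
  have le: "size (S ((h ^^ i) s)) \<le> size (S s)" for i s
    by (induction i) (use assms(4) order_trans in auto)
  have "ptime E (\<lambda>a. S (fold (\<lambda>_. h) (replicate (n a) ()) (st a)))"
  proof (rule ptime_fold)
    show "ptime E (\<lambda>a. enc_list (\<lambda>_. Leaf) (replicate (n a) ()))"
      using n by (simp add: enc_nat_eq_enc_list)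
    show "ptime (\<lambda>z. Node (E (fst z)) (Node Leaf (S (snd (snd z))))) (\<lambda>z. S (h (snd (snd z))))"
      by (rule ptime_trans[of _ S "\<lambda>z. snd (snd z)"])
         (use ptime_right[OF ptime_right[OF ptime_id[of "\<lambda>z. Node (E (fst z)) (Node Leaf (S (snd (snd z))))"]]]
           h in auto)
    show "pbounded E (\<lambda>a. size (S (st a)))" by (rule ptime_size[OF st])
  qed (auto simp: fold le st)
  then show ?thesis by (simp add: fold)
qed

lemma ptime_diff:
  assumes "ptime E (\<lambda>a. enc_nat (m a))" "ptime E (\<lambda>a. enc_nat (n a))"
  shows "ptime E (\<lambda>a. enc_nat (m a - n a))"
proof -
  have "((\<lambda>i. i - 1) ^^ n) m = m - n" for m n :: nat
    by (induction n) auto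
  moreover have "ptime E (\<lambda>a. enc_nat (((\<lambda>i. i - 1) ^^ n a) (m a)))"
    by (rule ptime_iterate[where S = enc_nat
      and h = "\<lambda>i. i - 1", OF assms(2,1)]) (use ptime_right[OF ptime_id[of enc_nat]] in \<open>auto simp: right_enc_nat\<close>)
  ultimately show ?thesis by simp
qed

lemma ptime_less:
  assumes "ptime E (\<lambda>a. enc_nat (m a))" "ptime E (\<lambda>a. enc_nat (n a))"
  shows "ptime E (\<lambda>a. enc_bool (m a < n a))"
proof -
  have "enc_nat (n a - m a) \<noteq> Leaf \<longleftrightarrow> m a < n a" for a by auto
  then show ?thesis using ptime_neq_Leaf[OF ptime_diff[OF assms(2,1)]] by (simp only:)
qed

lemma ptime_eq_nat:
  assumes "ptime E (\<lambda>a. enc_nat (m a))" "ptime E (\<lambda>a. enc_nat (n a))"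
  shows "ptime E (\<lambda>a. enc_bool (m a = n a))"
proof -
  have "ptime E (\<lambda>a. enc_bool (\<not> m a < n a \<and> \<not> n a < m a))"
    by (intro ptime_bool ptime_less assms)
  then show ?thesis by (simp add: not_less eq_iff conj_commute)
qed

subsection \<open>Lists\<close>

abbreviation env2 :: "('a \<Rightarrow> tree) \<Rightarrow> ('b \<Rightarrow> tree) \<Rightarrow> 'a \<times> 'b \<Rightarrow> tree" where
  "env2 E f \<equiv> \<lambda>z. Node (E (fst z)) (f (snd z))"

lemma ptime_snd: "ptime (env2 E f) (\<lambda>z. f (snd z))"
  using ptime_right[OF ptime_id[of "env2 E f"]] by simp

lemma ptime_fst: "ptime E F \<Longrightarrow> ptime (env2 E f) (\<lambda>z. F (fst z))"
  by (rule ptime_trans[of _ E fst]) (use ptime_left[OF ptime_id[of "env2 E f"]] in auto)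

lemma ptime_Nil: "ptime E (\<lambda>a. enc_list f [])"
  by (simp add: ptime_const)

lemma ptime_Cons:
  "ptime E (\<lambda>a. f (x a)) \<Longrightarrow> ptime E (\<lambda>a. enc_list f (xs a)) \<Longrightarrow> ptime E (\<lambda>a. enc_list f (x a # xs a))"
  by (simp add: ptime_Node)

lemma fold_Cons: "fold (#) xs ys = rev xs @ ys"
  by (induction xs arbitrary: ys) auto

lemma ptime_fold_Cons:
  assumes "ptime E (\<lambda>a. enc_list f (xs a))" "ptime E (\<lambda>a. enc_list f (ys a))"
  shows "ptime E (\<lambda>a. enc_list f (fold (#) (xs a) (ys a)))"
proof (rule ptime_fold[where S = "enc_list f" and h = "\<lambda>_. (#)", OF assms])
  show "ptime (\<lambda>z. Node (E (fst z)) (Node (f (fst (snd z))) (enc_list f (snd (snd z)))))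
     (\<lambda>z. enc_list f (fst (snd z) # snd (snd z)))"
    using ptime_right[OF ptime_id[of "\<lambda>z. Node (E (fst z)) (Node (f (fst (snd z))) (enc_list f (snd (snd z))))"]]
    by simp
  show "pbounded E (\<lambda>a. size (enc_list f (xs a)) + size (enc_list f (ys a)))"
    by (intro pbounded_add ptime_size assms)
  show "xs a = us @ vs \<Longrightarrow> size (enc_list f (fold (#) us (ys a)))
      \<le> size (enc_list f (xs a)) + size (enc_list f (ys a))" for a us vs
    by (simp add: fold_Cons size_enc_list_append size_enc_list_rev)
qed

lemma ptime_rev:
  assumes "ptime E (\<lambda>a. enc_list f (xs a))"
    shows "ptime E (\<lambda>a. enc_list f (rev (xs a)))"
  using ptime_fold_Cons[OF assms ptime_Nil] by (simp add: fold_Cons)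

lemma ptime_append:
  assumes "ptime E (\<lambda>a. enc_list f (xs a))" "ptime E (\<lambda>a. enc_list f (ys a))"
  shows "ptime E (\<lambda>a. enc_list f (xs a @ ys a))"
  using ptime_fold_Cons[OF ptime_rev[OF assms(1)] assms(2)] by (simp add: fold_Cons)

text \<open>A fold pushes the images onto an accumulator, which reverses them. Each image is
  polynomial in its own environment, and the accumulator holds at most as many images as the list
  has entries, so it stays polynomial.\<close>

lemma ptime_map:
  assumes xs: "ptime E (\<lambda>a. enc_list f (xs a))"
    and h: "ptime (env2 E f) (\<lambda>z. g (h (fst z) (snd z)))"
  shows "ptime E (\<lambda>a. enc_list g (map (h a) (xs a)))"
proof -
  let ?E = "\<lambda>z. Node (E (fst z)) (Node (f (fst (snd z))) (enc_list g (snd (snd z))))"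
  have fold: "fold (\<lambda>x. (#) (h a x)) ys zs = rev (map (h a) ys) @ zs" for a ys zs
    by (induction ys arbitrary: zs) auto
  obtain e where e: "\<And>z. size (g (h (fst z) (snd z))) \<le> (size (env2 E f z) + 2) ^ e"
    using ptime_size[OF h] unfolding pbounded_def by blast
  let ?X = "\<lambda>a. size (enc_list f (xs a))"
  let ?B = "\<lambda>a. (size (E a) + ?X a + 3) ^ e"
  have "ptime E (\<lambda>a. enc_list g (fold (\<lambda>x. (#) (h a x)) (xs a) []))"
  proof (rule ptime_fold[where S = "enc_list g" and h = "\<lambda>a x. (#) (h a x)"
    and st = "\<lambda>_. []", OF xs ptime_Nil])
    have "ptime ?E (\<lambda>z. Node (E (fst z)) (f (fst (snd z))))"
      using ptime_Node[OF ptime_left[OF ptime_id[of ?E]] ptime_left[OF ptime_right[OF ptime_id[of ?E]]]]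
      by simp
    then have "ptime ?E (\<lambda>z. env2 E f (fst z, fst (snd z)))" by simp
    from ptime_trans[OF this h] have "ptime ?E (\<lambda>z. g (h (fst z) (fst (snd z))))" by simp
    moreover have "ptime ?E (\<lambda>z. enc_list g (snd (snd z)))"
      using ptime_right[OF ptime_right[OF ptime_id[of ?E]]] by simp
    ultimately show "ptime ?E (\<lambda>z. enc_list g (h (fst z) (fst (snd z)) # snd (snd z)))"
      by (rule ptime_Cons)
    show "pbounded E (\<lambda>a. ?X a * (?B a + 1))"
      by (intro pbounded_intros ptime_size[OF xs])
    fix a ys zs assume eq: "xs a = ys @ zs"
    have "Suc (size (g (h a y))) \<le> ?B a + 1" if "y \<in> set ys" for y
    proof -
      have "size (f y) \<le> ?X a" by (rule size_le_size_enc_list) (use that eq in auto)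
      then have "(size (env2 E f (a, y)) + 2) ^ e \<le> ?B a" by (intro power_mono) auto
      then show ?thesis using e[of "(a, y)"] by simp
    qed
    then have "(\<Sum>y\<leftarrow>ys. Suc (size (g (h a y)))) \<le> (\<Sum>y\<leftarrow>ys. ?B a + 1)" by (rule sum_list_mono)
    also have "\<dots> = length ys * (?B a + 1)" by (simp add: sum_list_triv)
    also have "\<dots> \<le> ?X a * (?B a + 1)"
      using length_le_size_enc_list[of ys f]
      by (intro mult_right_mono) (simp_all add: eq size_enc_list_append)
    finally show "size (enc_list g (fold (\<lambda>x. (#) (h a x)) ys [])) \<le> ?X a * (?B a + 1)"
      by (simp only: fold append_Nil2 size_enc_list_rev) (simp only: size_enc_list rev_map map_map o_def sum_list_rev)
  qed
  then show ?thesis using ptime_rev by (fastforce simp: fold)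
qed

lemma ptime_concat:
  assumes "ptime E (\<lambda>a. enc_list (enc_list f) (xs a))"
  shows "ptime E (\<lambda>a. enc_list f (concat (xs a)))"
proof -
  let ?E = "\<lambda>z. Node (E (fst z)) (Node (enc_list f (fst (snd z))) (enc_list f (snd (snd z))))"
  have fold: "fold (\<lambda>x acc. acc @ x) xs acc = acc @ concat xs" for xs and acc :: "'b list"
    by (induction xs arbitrary: acc) auto
  have size: "size (enc_list f (concat ys)) \<le> size (enc_list (enc_list f) ys)" for ys
    by (induction ys) (auto simp: size_enc_list_append)
  have "ptime E (\<lambda>a. enc_list f (fold (\<lambda>x acc. acc @ x) (xs a) []))"
  proof (rule ptime_fold[where S = "enc_list f" and h = "\<lambda>_ x acc. acc @ x"
    and st = "\<lambda>_. []", OF assms ptime_Nil])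
    show "ptime ?E (\<lambda>z. enc_list f (snd (snd z) @ fst (snd z)))"
      by (rule ptime_append)
         (use ptime_right[OF ptime_right[OF ptime_id[of ?E]]]
           ptime_left[OF ptime_right[OF ptime_id[of ?E]]] in auto)
    show "pbounded E (\<lambda>a. size (enc_list (enc_list f) (xs a)))"
      by (rule ptime_size[OF assms])
    show "xs a = ys @ zs \<Longrightarrow> size (enc_list f (fold (\<lambda>x acc. acc @ x) ys []))
        \<le> size (enc_list (enc_list f) (xs a))" for a ys zs
      using size[of ys] by (simp add: fold size_enc_list_append)
  qed
  then show ?thesis by (simp add: fold)
qed

lemma ptime_filter:
  assumes "ptime E (\<lambda>a. enc_list f (xs a))" "ptime (env2 E f) (\<lambda>z. enc_bool (p (fst z) (snd z)))"
  shows "ptime E (\<lambda>a. enc_list f (filter (p a) (xs a)))"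
proof -
  have "ptime (env2 E f) (\<lambda>z. if p (fst z) (snd z) then enc_list f [snd z] else enc_list f [])"
    by (intro ptime_if assms(2) ptime_Cons ptime_Nil ptime_snd)
  then have "ptime (env2 E f) (\<lambda>z. enc_list f (if p (fst z) (snd z) then [snd z] else []))"
    by (simp add: if_distrib cong: if_cong)
  from ptime_concat[OF ptime_map[where g = "enc_list f"
    and h = "\<lambda>a x. if p a x then [x] else []", OF assms(1) this]]
  have "ptime E (\<lambda>a. enc_list f (concat (map (\<lambda>x. if p a x then [x] else []) (xs a))))" by simp
  moreover have "concat (map (\<lambda>x. if p x then [x] else []) xs) = filter p xs" for p
    and xs :: "'b list"
    by (induction xs) auto
  ultimately show ?thesis by simp
qed

lemma enc_list_eq_Leaf: "enc_list f xs = Leaf \<longleftrightarrow> xs = []"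
  by (cases xs) auto

lemma ptime_bex:
  assumes "ptime E (\<lambda>a. enc_list f (xs a))" "ptime (env2 E f) (\<lambda>z. enc_bool (p (fst z) (snd z)))"
  shows "ptime E (\<lambda>a. enc_bool (\<exists>x\<in>set (xs a). p a x))"
  using ptime_neq_Leaf[OF ptime_filter[OF assms]] by (simp add: enc_list_eq_Leaf filter_empty_conv)

lemma ptime_ball:
  assumes "ptime E (\<lambda>a. enc_list f (xs a))" "ptime (env2 E f) (\<lambda>z. enc_bool (p (fst z) (snd z)))"
  shows "ptime E (\<lambda>a. enc_bool (\<forall>x\<in>set (xs a). p a x))"
  using ptime_not[OF ptime_bex[OF assms(1) ptime_not[OF assms(2)]]] by simp

lemma ptime_length:
  assumes "ptime E (\<lambda>a. enc_list f (xs a))"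
    shows "ptime E (\<lambda>a. enc_nat (length (xs a)))"
proof -
  have "ptime E (\<lambda>a. enc_list (\<lambda>_. Leaf) (map (\<lambda>_. ()) (xs a)))"
    by (rule ptime_map[OF assms ptime_const])
  then show ?thesis by (simp add: enc_nat_eq_enc_list map_replicate_const)
qed

lemma ptime_drop:
  assumes "ptime E (\<lambda>a. enc_list f (xs a))" "ptime E (\<lambda>a. enc_nat (n a))"
  shows "ptime E (\<lambda>a. enc_list f (drop (n a) (xs a)))"
proof -
  have tl: "right (enc_list f xs) = enc_list f (tl xs)" for xs by (cases xs) auto
  have "(tl ^^ n) xs = drop n xs" for n and xs :: "'b list"
    by (induction n) (auto simp: drop_Suc tl_drop)
  moreover have "ptime E (\<lambda>a. enc_list f ((tl ^^ n a) (xs a)))"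
  proof (rule ptime_iterate[where S = "enc_list f" and h = tl, OF assms(2,1)])
    show "ptime (enc_list f) (\<lambda>s. enc_list f (tl s))"
      using ptime_right[OF ptime_id[of "enc_list f"]] by (simp add: tl)
    show "size (enc_list f (tl s)) \<le> size (enc_list f s)" for s by (cases s) auto
  qed
  ultimately show ?thesis by simp
qed

text \<open>Dropping beyond the end leaves \<open>Leaf\<close>, and the left part of
  \<open>Leaf\<close> is \<open>Leaf\<close> again; hence the default has to be encoded as
  \<open>Leaf\<close>.\<close>

lemma ptime_nth:
  assumes "ptime E (\<lambda>a. enc_list f (xs a))" "ptime E (\<lambda>a. enc_nat (n a))" "f d = Leaf"
  shows "ptime E (\<lambda>a. f (if n a < length (xs a) then xs a ! n a else d))"
proof -
  have "left (enc_list f (drop n xs)) = f (if n < length xs then xs ! n else d)" for n xs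
    using assms(3) by (cases "n < length xs") (auto simp: Cons_nth_drop_Suc[symmetric])
  then show ?thesis using ptime_left[OF ptime_drop[OF assms(1,2)]] by simp
qed

lemma ptime_rev_upt:
  assumes "ptime E (\<lambda>a. enc_nat (n a))"
    shows "ptime E (\<lambda>a. enc_list enc_nat (rev [0..<n a]))"
proof -
  let ?S = "env2 enc_nat (enc_list enc_nat)" and ?h = "\<lambda>_ s. (Suc (fst s), fst s # snd s)"
  let ?E = "\<lambda>z. Node (E (fst z)) (Node Leaf (?S (snd (snd z))))"
  have fold: "fold ?h xs (i, ys) = (i + length xs, rev [i..<i + length xs] @ ys)"
    for xs :: "unit list" and i ys
    by (induction xs arbitrary: i ys) (auto simp: upt_conv_Cons simp del: upt_Suc)
  have size: "size (enc_list enc_nat [0..<k]) \<le> k * (k + 1)" for k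
    by (induction k) (auto simp: size_enc_list)
  have S: "ptime ?E (\<lambda>z. enc_nat (fst (snd (snd z))))" "ptime ?E (\<lambda>z. enc_list enc_nat (snd (snd (snd z))))"
    using ptime_left[OF ptime_right[OF ptime_right[OF ptime_id[of ?E]]]]
      ptime_right[OF ptime_right[OF ptime_right[OF ptime_id[of ?E]]]] by auto
  have "ptime E (\<lambda>a. ?S (fold ?h (replicate (n a) ()) (0, [])))"
  proof (rule ptime_fold[where f = "\<lambda>_. Leaf" and S = ?S and h = "\<lambda>_. ?h"
    and st = "\<lambda>_. (0, [])"])
    show "ptime E (\<lambda>a. enc_list (\<lambda>_. Leaf) (replicate (n a) ()))"
      using assms by (simp add: enc_nat_eq_enc_list)
    show "ptime ?E (\<lambda>z. ?S (Suc (fst (snd (snd z))), fst (snd (snd z)) # snd (snd (snd z))))"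
      using ptime_Node[OF ptime_Suc[OF S(1)] ptime_Cons[OF S]] by simp
    show "pbounded E (\<lambda>a. n a * (n a + 1) + n a + 1)"
      using ptime_size[OF assms] by (intro pbounded_intros) auto
    fix a ys zs assume "replicate (n a) () = ys @ zs"
    then have le: "length ys \<le> n a" by (metis le_add1 length_append length_replicate)
    have "length ys * (length ys + 1) \<le> n a * (n a + 1)" by (intro mult_mono) (use le in auto)
    with le size[of "length ys"]
    show "size (?S (fold ?h ys (0, []))) \<le> n a * (n a + 1) + n a + 1"
      by (simp add: fold size_enc_list_rev del: mult_Suc_right)
  qed (simp add: ptime_const)
  moreover have "fold ?h (replicate k ()) (0, []) = (k, rev [0..<k])" for k by (subst fold) simp
  ultimately show ?thesis using ptime_right by fastforce
qed

lemma ptime_upt: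
  assumes "ptime E (\<lambda>a. enc_nat (n a))"
    shows "ptime E (\<lambda>a. enc_list enc_nat [0..<n a])"
  using ptime_rev[OF ptime_rev_upt[OF assms]] by simp

text \<open>\<open>n\<close> is a constant of the program and not part of its input: each further
  entry adds one more nested map, and the exponent of the time bound may grow with \<open>n\<close>.
  This is why the tuple length must not depend on the instance.\<close>

lemma ptime_n_lists:
  assumes "ptime E (\<lambda>a. enc_list f (xs a))"
  shows "ptime E (\<lambda>a. enc_list (enc_list f) (List.n_lists n (xs a)))"
proof (induction n)
  case 0
  show ?case by (simp add: ptime_const)
next
  case (Suc n)
  have "ptime (env2 E (enc_list f)) (\<lambda>z. enc_list (enc_list f) (map (\<lambda>y. y # snd z) (xs (fst z))))"
    by (rule ptime_map[where f = f
      and h = "\<lambda>z y. y # snd z", OF ptime_fst[where F = "\<lambda>a. enc_list f (xs a)", OF assms]])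
       (intro ptime_Cons ptime_snd ptime_fst[where F = "\<lambda>z. enc_list f (snd z)", OF ptime_snd])
  from ptime_concat[OF ptime_map[where g = "enc_list (enc_list f)"
    and h = "\<lambda>a ys. map (\<lambda>y. y # ys) (xs a)", OF Suc this]] show ?case by simp
qed

lemma ptime_eq_nat_list:
  assumes xs: "ptime E (\<lambda>a. enc_list enc_nat (xs a))"
    and ys: "ptime E (\<lambda>a. enc_list enc_nat (ys a))"
  shows "ptime E (\<lambda>a. enc_bool (xs a = ys a))"
proof -
  let ?nth = "\<lambda>xs i. if i < length xs then xs ! i else 0"
  have "xs = ys"
    if "length xs = length ys" "\<forall>i\<in>set [0..<length xs]. ?nth xs i = ?nth ys i"
    for xs ys :: "nat list"
    by (rule nth_equalityI) (use that in auto)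
  then have eq: "(length xs = length ys \<and> (\<forall>i\<in>set [0..<length xs]. ?nth xs i = ?nth ys i)) = (xs = ys)"
    for xs ys :: "nat list" by blast
  have "ptime E (\<lambda>a. enc_bool (length (xs a) = length (ys a) \<and>
      (\<forall>i\<in>set [0..<length (xs a)]. ?nth (xs a) i = ?nth (ys a) i)))"
  proof (rule ptime_and)
    show "ptime E (\<lambda>a. enc_bool (length (xs a) = length (ys a)))"
      by (rule ptime_eq_nat[OF ptime_length[OF xs] ptime_length[OF ys]])
    have nth: "ptime (env2 E enc_nat) (\<lambda>z. enc_nat (?nth (xs (fst z)) (snd z)))"
      if "ptime E (\<lambda>a. enc_list enc_nat (xs a))" for xs
      using ptime_nth[OF ptime_fst[where F = "\<lambda>a. enc_list enc_nat (xs a)", OF that] ptime_snd[of E enc_nat], where d = 0]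
      by simp
    show "ptime E (\<lambda>a. enc_bool (\<forall>i\<in>set [0..<length (xs a)]. ?nth (xs a) i = ?nth (ys a) i))"
      by (rule ptime_ball[OF ptime_upt[OF ptime_length[OF xs]]], rule ptime_eq_nat) (rule nth xs ys)+
  qed
  then show ?thesis by (simp only: eq)
qed

section \<open>Evaluating circuits under partial information\<close>

text \<open>A set \<open>A\<close> of \<open>k\<close> input nodes is described by its increasing enumeration, shifted by one and
  framed by the sentinels 0 and \<open>length C + 1\<close>. Partial information about \<open>A\<close> is a set of pairs of an
  index and the value of the enumeration there. Two pairs with successive indices certify that all
  nodes in between are not in \<open>A\<close>, so that negative information is as local as positive one.\<close>

definition present :: "(nat \<times> nat) set \<Rightarrow> nat \<Rightarrow> bool" where
  "present S p \<longleftrightarrow> (\<exists>x\<in>S. snd x = Suc p)"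

definition absent :: "(nat \<times> nat) set \<Rightarrow> nat \<Rightarrow> bool" where
  "absent S p \<longleftrightarrow> (\<exists>x\<in>S. \<exists>y\<in>S. fst y = Suc (fst x) \<and> snd x < Suc p \<and> Suc p < snd y)"

definition known_true :: "(bool \<times> bool) list \<Rightarrow> nat \<Rightarrow> bool" where
  "known_true vs j \<longleftrightarrow> j < length vs \<and> fst (vs ! j)"

definition known_false :: "(bool \<times> bool) list \<Rightarrow> nat \<Rightarrow> bool" where
  "known_false vs j \<longleftrightarrow> j < length vs \<and> snd (vs ! j)"

text \<open>Small gates follow Kleene's three-valued logic. Large gates are evaluated under a closed-world
  assumption: they take their default value unless some in-neighbour is known to force the other one.\<close>

fun known_value :: "(nat \<times> nat) set \<Rightarrow> (bool \<times> bool) list \<Rightarrow> gate \<Rightarrow> bool \<times> bool" where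
  "known_value S vs Input = (present S (length vs), absent S (length vs))"
| "known_value S vs (Neg j) = (known_false vs j, known_true vs j)"
| "known_value S vs (Conj js) =
     (if 2 < length js then \<not> (\<exists>j\<in>set js. known_false vs j) else \<forall>j\<in>set js. known_true vs j,
      \<exists>j\<in>set js. known_false vs j)"
| "known_value S vs (Disj js) =
     (\<exists>j\<in>set js. known_true vs j,
      if 2 < length js then \<not> (\<exists>j\<in>set js. known_true vs j) else \<forall>j\<in>set js. known_false vs j)"

definition known_values :: "(nat \<times> nat) set \<Rightarrow> circuit \<Rightarrow> (bool \<times> bool) list" where
  "known_values S C = foldl (\<lambda>vs g. vs @ [known_value S vs g]) [] C"

definition accepts :: "(nat \<times> nat) set \<Rightarrow> circuit \<Rightarrow> bool" where
  "accepts S C \<longleftrightarrow> known_true (known_values S C) (length C - 1)"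

text \<open>Both evaluations of circuits append one value per gate, so a position never changes once
  it is written. This turns the folds into recursion equations over the nodes.\<close>

lemma foldl_snoc:
  fixes F :: "'b list \<Rightarrow> 'a \<Rightarrow> 'b"
  defines "vals \<equiv> foldl (\<lambda>vs g. vs @ [F vs g]) []"
  shows "length (vals xs) = length xs"
    and "i \<le> length xs \<Longrightarrow> take i (vals xs) = vals (take i xs)"
    and "i < length xs \<Longrightarrow> vals xs ! i = F (take i (vals xs)) (xs ! i)"
proof -
  show len: "length (vals xs) = length xs" for xs
    unfolding vals_def by (induction xs rule: rev_induct) auto
  show take: "i \<le> length xs \<Longrightarrow> take i (vals xs) = vals (take i xs)" for i
  proof (induction xs rule: rev_induct)
    case (snoc x xs)
    have "vals (xs @ [x]) = vals xs @ [F (vals xs) x]" by (simp add: vals_def)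
    with snoc len[of xs] show ?case by (cases "i = Suc (length xs)") auto
  qed (simp add: vals_def)
  assume i: "i < length xs"
  have "vals (take (Suc i) xs) = vals (take i xs) @ [F (vals (take i xs)) (xs ! i)]"
    using i by (simp add: vals_def take_Suc_conv_app_nth)
  then have "vals (take (Suc i) xs) ! i = F (vals (take i xs)) (xs ! i)"
    using len[of "take i xs"] i by (simp add: nth_append)
  moreover have "vals (take (Suc i) xs) ! i = vals xs ! i"
    using i take[of "Suc i", symmetric] by simp
  ultimately show "vals xs ! i = F (take i (vals xs)) (xs ! i)" using i take[of i] by simp
qed

locale enumerated_input_set =
  fixes C :: circuit and A :: "nat set" and k :: nat and a :: "nat \<Rightarrow> nat"
  assumes wf: "wf_circuit C"
    and a_0: "a 0 = 0" and a_Suc_k: "a (Suc k) = Suc (length C)"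
    and a_mono: "\<And>i j. i < j \<Longrightarrow> j \<le> Suc k \<Longrightarrow> a i < a j"
    and A_eq: "A = {p. \<exists>i. 0 < i \<and> i \<le> k \<and> a i = Suc p}"
begin

text \<open>The graph of the enumeration. Its subsets are exactly the truthful pieces of information
  about \<open>A\<close>, and all soundness statements are relative to it.\<close>

definition full :: "(nat \<times> nat) set" where
  "full = (\<lambda>i. (i, a i)) ` {..Suc k}"

lemma a_inj: "i \<le> Suc k \<Longrightarrow> j \<le> Suc k \<Longrightarrow> a i = a j \<Longrightarrow> i = j"
  by (metis a_mono less_irrefl nat_neq_iff)

text \<open>As \<open>p < length C\<close>, the value \<open>Suc p\<close> differs from both
  sentinels, so its index lies between 1 and \<open>k\<close>.\<close>

lemma present_sound: "S \<subseteq> full \<Longrightarrow> p < length C \<Longrightarrow> present S p \<Longrightarrow> p \<in> A"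
proof -
  assume S: "S \<subseteq> full" and p: "p < length C" and "present S p"
  then obtain i where i: "i \<le> Suc k" "a i = Suc p" unfolding present_def full_def by fastforce
  moreover have "i \<noteq> 0" using i a_0 by (metis nat.distinct(1))
  moreover have "i \<noteq> Suc k" using i a_Suc_k p by auto
  ultimately show "p \<in> A" unfolding A_eq by auto
qed

lemma absent_sound: "S \<subseteq> full \<Longrightarrow> absent S p \<Longrightarrow> p \<notin> A"
proof
  assume S: "S \<subseteq> full" and "absent S p" and "p \<in> A"
  then obtain x y where xy: "x \<in> full" "y \<in> full" "fst y = Suc (fst x)" "snd x < Suc p" "Suc p < snd y"
    unfolding absent_def by blast
  define i where "i = fst x"
  have i: "Suc i \<le> Suc k" "a i < Suc p" "Suc p < a (Suc i)"
    using xy unfolding full_def i_def by auto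
  from \<open>p \<in> A\<close> obtain j where j: "j \<le> k" "a j = Suc p" unfolding A_eq by auto
  from i j have "\<not> j \<le> i" "\<not> Suc i \<le> j"
    by (metis a_mono le_SucI le_neq_implies_less less_asym Suc_leD less_irrefl)+
  then show False by simp
qed

lemma present_complete: "p \<in> A \<Longrightarrow> \<exists>S\<subseteq>full. finite S \<and> card S \<le> 2 \<and> present S p"
proof -
  assume "p \<in> A"
  then obtain i where "i \<le> k" "a i = Suc p" unfolding A_eq by auto
  then show ?thesis
    by (intro exI[of _ "{(i, a i)}"]) (auto simp: full_def present_def)
qed

text \<open>The first index at which the enumeration reaches \<open>Suc p\<close>, together with its
  predecessor, bounds a gap around \<open>p\<close>; the sentinels ensure that both exist.\<close>

lemma absent_complete: "p \<notin> A \<Longrightarrow> p < length C \<Longrightarrow> \<exists>S\<subseteq>full. finite S \<and> card S \<le> 2 \<and> absent S p"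
proof -
  assume p: "p \<notin> A" "p < length C"
  then have "Suc p \<le> a (Suc k)" "\<not> Suc p \<le> a 0" by (simp_all add: a_0 a_Suc_k)
  then obtain i where i: "i < Suc k" "\<not> Suc p \<le> a i" "Suc p \<le> a (Suc i)"
    using ex_least_nat_less[of "\<lambda>i. Suc p \<le> a i" "Suc k"] by blast
  moreover have "a (Suc i) \<noteq> Suc p"
  proof
    assume "a (Suc i) = Suc p"
    moreover from this have "Suc i \<noteq> Suc k" using p(2) a_Suc_k by auto
    ultimately have "p \<in> A" unfolding A_eq using i(1) by (intro CollectI exI[of _ "Suc i"]) auto
    with p(1) show False ..
  qed
  ultimately show ?thesis
    by (intro exI[of _ "{(i, a i), (Suc i, a (Suc i))}"])
       (auto simp: full_def absent_def card_insert_if)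
qed

definition known :: "(nat \<times> nat) set \<Rightarrow> nat \<Rightarrow> bool \<times> bool" where
  "known S j = known_values S C ! j"

definition val :: "nat \<Rightarrow> bool" where
  "val j = circuit_values A C ! j"

lemma in_nbrs_less: "j < length C \<Longrightarrow> i \<in> set (in_nbrs (C ! j)) \<Longrightarrow> i < j"
  using wf unfolding wf_circuit_def by blast

lemma known_eq:
  assumes "j < length C"
  shows "known S j = (case C ! j of
      Input \<Rightarrow> (present S j, absent S j)
    | Neg i \<Rightarrow> (snd (known S i), fst (known S i))
    | Conj is \<Rightarrow>
        (if 2 < length is then \<not> (\<exists>i\<in>set is. snd (known S i)) else \<forall>i\<in>set is. fst (known S i),
         \<exists>i\<in>set is. snd (known S i))
    | Disj is \<Rightarrow>
        (\<exists>i\<in>set is. fst (known S i),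
         if 2 < length is then \<not> (\<exists>i\<in>set is. fst (known S i)) else \<forall>i\<in>set is. snd (known S i)))"
proof -
  let ?vs = "take j (known_values S C)"
  have len: "length ?vs = j"
    using assms foldl_snoc(1)[of "known_value S" C] unfolding known_values_def by simp
  have eq: "known S j = known_value S ?vs (C ! j)"
    using assms foldl_snoc(3)[of j C "known_value S"] unfolding known_values_def known_def by simp
  have "known_true ?vs i \<longleftrightarrow> fst (known S i)" "known_false ?vs i \<longleftrightarrow> snd (known S i)"
    if "i \<in> set (in_nbrs (C ! j))" for i
    using in_nbrs_less[OF assms that] len
    unfolding known_true_def known_false_def known_def by auto
  then show ?thesis
    unfolding eq using len by (cases "C ! j") (auto simp del: length_take)
qed

lemma val_eq:
  assumes "j < length C"
  shows "val j = (case C ! j of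
      Input \<Rightarrow> j \<in> A
    | Neg i \<Rightarrow> \<not> val i
    | Conj is \<Rightarrow> \<forall>i\<in>set is. val i
    | Disj is \<Rightarrow> \<exists>i\<in>set is. val i)"
proof -
  let ?vs = "take j (circuit_values A C)"
  have len: "length ?vs = j"
    using assms foldl_snoc(1)[of "gate_value A" C] unfolding circuit_values_def by simp
  have eq: "val j = gate_value A ?vs (C ! j)"
    using assms foldl_snoc(3)[of j C "gate_value A"] unfolding circuit_values_def val_def by simp
  have "?vs ! i = val i" if "i \<in> set (in_nbrs (C ! j))" for i
    using in_nbrs_less[OF assms that] unfolding val_def by simp
  then show ?thesis
    unfolding eq using len by (cases "C ! j") (auto simp del: length_take)
qed

section \<open>Paths from the inputs and certificates for the values of nodes\<close>

definition path_to :: "nat \<Rightarrow> nat list \<Rightarrow> bool" where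
  "path_to j p \<longleftrightarrow> p \<noteq> [] \<and> set p \<subseteq> {..<length C} \<and> hd p \<in> input_nodes C \<and> last p = j \<and>
     successively (\<lambda>i j. i \<in> set (in_nbrs (C ! j))) p"

text \<open>The bounds on depth and weft, relativised to a node so that an induction can pass them
  on to in-neighbours.\<close>

definition paths_within :: "nat \<Rightarrow> nat \<Rightarrow> nat \<Rightarrow> bool" where
  "paths_within w h j \<longleftrightarrow> (\<forall>p. path_to j p \<longrightarrow>
     length p - 1 \<le> h \<and> length (filter (\<lambda>i. large (C ! i)) p) \<le> w)"

lemma path_to_snoc:
  "path_to i p \<Longrightarrow> j < length C \<Longrightarrow> i \<in> set (in_nbrs (C ! j)) \<Longrightarrow> path_to j (p @ [j])"
  unfolding path_to_def by (auto simp: successively_append_iff)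

text \<open>Walking back along in-neighbours can end only at an input, because the fan-in condition
  leaves no other gate without in-neighbours. Without such a path, \<open>paths_within\<close> would
  hold vacuously and give no bounds.\<close>

lemma ex_path_to: "j < length C \<Longrightarrow> \<exists>p. path_to j p"
proof (induction j rule: less_induct)
  case (less j)
  show ?case
  proof (cases "in_nbrs (C ! j)")
    case Nil
    have "fan_in_ok (C ! j)" using wf less.prems unfolding wf_circuit_def by blast
    with Nil have "C ! j = Input" by (cases "C ! j") auto
    with less.prems have "path_to j [j]" by (simp add: path_to_def input_nodes_def)
    then show ?thesis ..
  next
    case (Cons i js)
    then have i: "i \<in> set (in_nbrs (C ! j))" by simp
    with less.prems in_nbrs_less have "i < j" by blast
    then obtain p where "path_to i p" using less by fastforce
    with path_to_snoc less.prems i show ?thesis by blast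
  qed
qed

lemma paths_within_in_nbr:
  assumes "paths_within w h j" "j < length C" "i \<in> set (in_nbrs (C ! j))"
  obtains h' where "h = Suc h'" "paths_within w h' i" "large (C ! j) \<Longrightarrow> 0 < w \<and> paths_within (w - 1) h' i"
proof -
  have step: "length p \<le> h \<and>
      length (filter (\<lambda>i. large (C ! i)) p) + (if large (C ! j) then 1 else 0) \<le> w"
    if "path_to i p" for p
    using assms(1) path_to_snoc[OF that assms(2,3)] unfolding paths_within_def by force
  have "i < length C" using in_nbrs_less[OF assms(2,3)] assms(2) by simp
  then obtain p where p: "path_to i p" using ex_path_to by blast
  then have "p \<noteq> []" by (simp add: path_to_def)
  then obtain h' where h': "h = Suc h'" using step[OF p] by (cases h) auto
  show thesis
  proof (rule that[OF h'])
    show "paths_within w h' i" unfolding paths_within_def using step h' by fastforce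
    assume "large (C ! j)"
    then show "0 < w \<and> paths_within (w - 1) h' i"
      unfolding paths_within_def using step p h' by fastforce
  qed
qed

text \<open>Quantifying over all truthful supersets makes the notion stable under merging with other
  certificates. A correct \<open>known\<close> value alone is not stable, because of the default
  values.\<close>

definition certifies :: "(nat \<times> nat) set \<Rightarrow> nat \<Rightarrow> bool" where
  "certifies S j \<longleftrightarrow> S \<subseteq> full \<and> finite S \<and> (\<forall>S'. S \<subseteq> S' \<longrightarrow> S' \<subseteq> full \<longrightarrow> known S' j = (val j, \<not> val j))"

lemma certifies_Input:
  assumes "j < length C" "C ! j = Input"
  shows "\<exists>S. certifies S j \<and> card S \<le> 2"
proof -
  have "\<exists>S\<subseteq>full. finite S \<and> card S \<le> 2 \<and> (if j \<in> A then present S j else absent S j)"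
    using present_complete[of j] absent_complete[of j] assms(1) by (cases "j \<in> A") simp_all
  then obtain S where S: "S \<subseteq> full" "finite S" "card S \<le> 2" "if j \<in> A then present S j else absent S j"
    by blast
  have "known S' j = (val j, \<not> val j)" if S': "S \<subseteq> S'" "S' \<subseteq> full" for S'
  proof (cases "j \<in> A")
    case True
    then have "present S' j" using S(4) S'(1) unfolding present_def by auto
    moreover have "\<not> absent S' j" using absent_sound S'(2) True by blast
    ultimately show ?thesis using True by (simp add: known_eq val_eq assms)
  next
    case False
    then have "absent S' j" using S(4) S'(1) unfolding absent_def by auto
    moreover have "\<not> present S' j" using present_sound S'(2) assms(1) False by blast
    ultimately show ?thesis using False by (simp add: known_eq val_eq assms)
  qed
  with S show ?thesis unfolding certifies_def by blast
qed

lemma certifies_small: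
  assumes "j < length C" "C ! j \<noteq> Input" "\<not> large (C ! j)"
    and "\<And>i. i \<in> set (in_nbrs (C ! j)) \<Longrightarrow> \<exists>S. certifies S i \<and> card S \<le> n"
  shows "\<exists>S. certifies S j \<and> card S \<le> 2 * n"
proof -
  from assms(4) obtain S where
    S: "\<And>i. i \<in> set (in_nbrs (C ! j)) \<Longrightarrow> certifies (S i) i \<and> card (S i) \<le> n" by metis
  let ?S = "\<Union>i\<in>set (in_nbrs (C ! j)). S i"
  have "card ?S \<le> (\<Sum>i\<in>set (in_nbrs (C ! j)). card (S i))" by (rule card_UN_le) simp
  also have "\<dots> \<le> card (set (in_nbrs (C ! j))) * n"
    using sum_bounded_above[of _ "\<lambda>i. card (S i)" n] S by simp
  also have "card (set (in_nbrs (C ! j))) \<le> 2"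
    using assms(3) card_length[of "in_nbrs (C ! j)"] unfolding large_def by simp
  finally have card: "card ?S \<le> 2 * n" by simp
  have "certifies ?S j"
    unfolding certifies_def
  proof (intro conjI allI impI)
    show "?S \<subseteq> full" "finite ?S" using S unfolding certifies_def by auto
    fix S' assume S': "?S \<subseteq> S'" "S' \<subseteq> full"
    have "known S' i = (val i, \<not> val i)" if "i \<in> set (in_nbrs (C ! j))" for i
      using S[OF that] S' that unfolding certifies_def by blast
    then show "known S' j = (val j, \<not> val j)"
      using assms(1-3) by (cases "C ! j") (auto simp: known_eq val_eq large_def)
  qed
  with card show ?thesis by blast
qed

text \<open>Without large gates no default value is ever used; only Kleene's logic is at work, and
  it derives true conclusions from truthful information.\<close>

lemma known_sound:
  assumes "j < length C" "paths_within 0 h j" "S \<subseteq> full"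
  shows "(fst (known S j) \<longrightarrow> val j) \<and> (snd (known S j) \<longrightarrow> \<not> val j)"
  using assms(1,2)
proof (induction j arbitrary: h rule: less_induct)
  case (less j)
  note prems = less.prems
  have IH: "(fst (known S i) \<longrightarrow> val i) \<and> (snd (known S i) \<longrightarrow> \<not> val i)" "\<not> large (C ! j)"
    if i: "i \<in> set (in_nbrs (C ! j))" for i
  proof -
    obtain h' where h': "paths_within 0 h' i" "large (C ! j) \<Longrightarrow> 0 < (0::nat)"
      using paths_within_in_nbr[OF prems(2,1) i] by blast
    then show "\<not> large (C ! j)" by blast
    show "(fst (known S i) \<longrightarrow> val i) \<and> (snd (known S i) \<longrightarrow> \<not> val i)"
      using less.IH[OF in_nbrs_less[OF prems(1) i] _ h'(1)] in_nbrs_less[OF prems(1) i] prems(1)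
        by simp
  qed
  show ?case
  proof (cases "C ! j")
    case Input
    with prems assms(3) present_sound absent_sound show ?thesis by (auto simp: known_eq val_eq)
  next
    case (Neg i)
    with prems IH show ?thesis by (auto simp: known_eq val_eq)
  next
    case (Conj "is")
    have "fan_in_ok (C ! j)" using wf prems unfolding wf_circuit_def by blast
    \<comment> \<open>The absence of large gates is a statement about paths and has been transferred
      to gate \<open>j\<close> by way of an in-neighbour, so one has to exist.\<close>
    then have "is \<noteq> []" using Conj by auto
    then have "\<not> 2 < length is" using IH(2)[of "hd is"] Conj by (auto simp: large_def)
    with Conj prems IH(1) show ?thesis by (auto simp: known_eq val_eq)
  next
    case (Disj "is")
    have "fan_in_ok (C ! j)" using wf prems unfolding wf_circuit_def by blast
    then have ne: "is \<noteq> []" using Disj by auto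
    then have "\<not> 2 < length is" using IH(2)[of "hd is"] Disj by (auto simp: large_def)
    with Disj prems IH(1) ne show ?thesis by (auto simp: known_eq val_eq)
  qed
qed

text \<open>A large gate has its default value unless one in-neighbour forces the other one, and then it
  suffices to certify that in-neighbour: this is why weft one matters.\<close>

lemma certifies_large:
  assumes "j < length C" "large (C ! j)"
    and cert: "\<And>i. i \<in> set (in_nbrs (C ! j)) \<Longrightarrow> \<exists>S. certifies S i \<and> card S \<le> n"
    and sound: "\<And>i S. i \<in> set (in_nbrs (C ! j)) \<Longrightarrow> S \<subseteq> full \<Longrightarrow>
      (fst (known S i) \<longrightarrow> val i) \<and> (snd (known S i) \<longrightarrow> \<not> val i)"
  shows "\<exists>S. certifies S j \<and> card S \<le> n"
proof -
  obtain "is" b where g: "2 < length is" "C ! j = (if b then Conj is else Disj is)"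
  proof (cases "C ! j")
    case (Conj js)
    then show thesis using that[of js True] assms(2) by (simp add: large_def)
  next
    case (Disj js)
    then show thesis using that[of js False] assms(2) by (simp add: large_def)
  qed (use assms(2) in \<open>simp_all add: large_def\<close>)
  then have is_in: "set (in_nbrs (C ! j)) = set is" by simp
  show ?thesis
  proof (cases "\<exists>i\<in>set is. val i \<noteq> b")
    case True
    then obtain i where i: "i \<in> set is" "val i \<noteq> b" by blast
    then obtain S where S: "certifies S i" "card S \<le> n" using cert is_in by blast
    have "certifies S j"
      unfolding certifies_def
    proof (intro conjI allI impI)
      show "S \<subseteq> full" "finite S" using S(1) unfolding certifies_def by auto
      fix S' assume "S \<subseteq> S'" "S' \<subseteq> full"
      then have "known S' i = (val i, \<not> val i)" using S(1) unfolding certifies_def by blast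
      with g i assms(1) show "known S' j = (val j, \<not> val j)"
        by (cases b) (auto simp: known_eq val_eq intro: bexI[of _ i])
    qed
    with S(2) show ?thesis by blast
  next
    case False
    \<comment> \<open>No in-neighbour forces the other value. By soundness, no truthful information
      can ever claim that one does, so the default remains in force for all supersets of the empty
      set.\<close>
    have "certifies {} j"
      unfolding certifies_def
    proof (intro conjI allI impI)
      fix S' assume "S' \<subseteq> full"
      with sound is_in have "\<And>i. i \<in> set is \<Longrightarrow> (fst (known S' i) \<longrightarrow> val i) \<and> (snd (known S' i) \<longrightarrow> \<not> val i)"
        by blast
      with g False assms(1) show "known S' j = (val j, \<not> val j)"
        by (cases b) (auto simp: known_eq val_eq)
    qed auto
    then show ?thesis by (intro exI[of _ "{}"]) simp
  qed
qed

text \<open>Each step to an in-neighbour uses up one unit of \<open>h\<close>, which pays for the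
  doubling at small gates. At a large gate the weft is used up, so its in-neighbours satisfy
  \<open>paths_within 0\<close> and \<open>known_sound\<close> applies to them.\<close>

lemma ex_certificate:
  assumes "j < length C" "paths_within w h j" "w \<le> 1"
  shows "\<exists>S. certifies S j \<and> card S \<le> 2 ^ Suc h"
  using assms
proof (induction j arbitrary: w h rule: less_induct)
  case (less j)
  note prems = less.prems
  show ?case
  proof (cases "C ! j = Input")
    case True
    then obtain S where "certifies S j" "card S \<le> 2" using certifies_Input prems(1) by blast
    moreover have "(2::nat) \<le> 2 ^ Suc h" by simp
    ultimately show ?thesis using order_trans by blast
  next
    case False
    have "fan_in_ok (C ! j)" using wf prems(1) unfolding wf_circuit_def by blast
    with False have "in_nbrs (C ! j) \<noteq> []" by (cases "C ! j") auto
    then obtain i0 where "i0 \<in> set (in_nbrs (C ! j))" using hd_in_set by blast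
    then obtain h' where h: "h = Suc h'" using paths_within_in_nbr[OF prems(2,1)] by metis
    have nbr: "\<exists>S. certifies S i \<and> card S \<le> 2 ^ Suc h'"
      "large (C ! j) \<Longrightarrow> paths_within 0 h' i" if i: "i \<in> set (in_nbrs (C ! j))"
        for i
    proof -
      have w: "paths_within w h' i" "large (C ! j) \<Longrightarrow> 0 < w \<and> paths_within (w - 1) h' i"
        using paths_within_in_nbr[OF prems(2,1) i] h by (metis nat.inject)+
      show "\<exists>S. certifies S i \<and> card S \<le> 2 ^ Suc h'"
        using less.IH[OF in_nbrs_less[OF prems(1) i] _ w(1) prems(3)] in_nbrs_less[OF prems(1) i] prems(1)
        by simp
      show "large (C ! j) \<Longrightarrow> paths_within 0 h' i" using w(2) prems(3) by simp
    qed
    show ?thesis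
    proof (cases "large (C ! j)")
      case True
      have "\<exists>S. certifies S j \<and> card S \<le> 2 ^ Suc h'"
      proof (rule certifies_large[OF prems(1) True nbr(1)])
        fix i S assume i: "i \<in> set (in_nbrs (C ! j))" and "S \<subseteq> full"
        then show "(fst (known S i) \<longrightarrow> val i) \<and> (snd (known S i) \<longrightarrow> \<not> val i)"
          using known_sound[OF _ nbr(2)[OF i True]] in_nbrs_less[OF prems(1) i] prems(1) by simp
      qed
      then show ?thesis unfolding h
        by (meson order_trans power_increasing lessI less_imp_le one_le_numeral)
    next
      case small: False
      from certifies_small[OF prems(1) False small nbr(1)] show ?thesis unfolding h by simp
    qed
  qed
qed

lemma ex_output_certificate:
  assumes "weft_at_most 1 C" "depth_at_most d C"
  shows "\<exists>S\<subseteq>full. finite S \<and> card S \<le> 2 ^ Suc d \<and>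
    (\<forall>S'. S \<subseteq> S' \<longrightarrow> S' \<subseteq> full \<longrightarrow> accepts S' C = satisfies A C)"
proof -
  have ne: "C \<noteq> []" using wf by (simp add: wf_circuit_def)
  have "io_path C p \<longleftrightarrow> path_to (length C - 1) p" for p
    unfolding io_path_def path_to_def by blast
  then have "paths_within 1 d (length C - 1)"
    using assms unfolding paths_within_def weft_at_most_def depth_at_most_def by simp
  then obtain S where S: "certifies S (length C - 1)" "card S \<le> 2 ^ Suc d"
    using ex_certificate[of "length C - 1" 1 d] ne by auto
  have len: "length (circuit_values A C) = length C" "length (known_values S' C) = length C" for S'
    using foldl_snoc(1)[of "gate_value A" C] foldl_snoc(1)[of "known_value S'" C]
    unfolding circuit_values_def known_values_def by auto
  have "circuit_values A C \<noteq> []" using len(1) ne by auto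
  then have "satisfies A C = val (length C - 1)"
    unfolding satisfies_def val_def by (simp add: last_conv_nth len)
  moreover have "accepts S' C = fst (known S' (length C - 1))" for S'
    unfolding accepts_def known_true_def known_def using ne by (simp add: len)
  ultimately show ?thesis using S unfolding certifies_def by (intro exI[of _ S]) auto
qed

end

section \<open>Graphs given by an adjacency relation on a list of vertices\<close>

text \<open>Vertices are represented by their positions in \<open>vs\<close>. The construction can
  thus use structured vertices although instances live on initial segments of the natural
  numbers.\<close>

definition list_graph :: "'v list \<Rightarrow> ('v \<Rightarrow> 'v \<Rightarrow> bool) \<Rightarrow> nat pair_pre_digraph" where
  "list_graph vs R = \<lparr>pverts = {..<length vs},
     parcs = {(i, j). i < length vs \<and> j < length vs \<and> R (vs ! i) (vs ! j)}\<rparr>"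

lemma enc_list_map: "enc_list f (map g xs) = enc_list (f \<circ> g) xs"
  by (induction xs) auto

lemma enc_list_cong: "(\<And>x. x \<in> set xs \<Longrightarrow> f x = g x) \<Longrightarrow> enc_list f xs = enc_list g xs"
  by (induction xs) auto

text \<open>The matrix can be written without positions, as two nested maps over the vertex list;
  this is the form in which a program produces it.\<close>

lemma enc_graph_list_graph:
  "enc_graph (list_graph vs R) = enc_list (\<lambda>u. enc_list (\<lambda>v. enc_bool (R u v)) vs) vs"
proof -
  have nth: "enc_list g vs = enc_list (\<lambda>i. g (vs ! i)) [0..<length vs]" for g
    using enc_list_map[of g "(!) vs" "[0..<length vs]"] by (simp add: map_nth comp_def)
  have "enc_graph (list_graph vs R) =
      enc_list (\<lambda>i. enc_list (\<lambda>j. enc_bool (R (vs ! i) (vs ! j))) [0..<length vs]) [0..<length vs]"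
    unfolding enc_graph_def Let_def by (auto simp: list_graph_def intro!: enc_list_cong)
  also have "\<dots> = enc_list (\<lambda>i. enc_list (\<lambda>v. enc_bool (R (vs ! i) v)) vs) [0..<length vs]"
    by (simp only: nth[of "\<lambda>v. enc_bool (R u v)" for u])
  also have "\<dots> = enc_list (\<lambda>u. enc_list (\<lambda>v. enc_bool (R u v)) vs) vs"
    by (simp only: nth[of "\<lambda>u. enc_list (\<lambda>v. enc_bool (R u v)) vs"])
  finally show ?thesis .
qed

lemma instance_graph_list_graph:
  assumes "\<And>u v. R u v \<Longrightarrow> R v u" "\<And>u. \<not> R u u"
  shows "instance_graph (list_graph vs R)"
proof -
  have "finite (parcs (list_graph vs R))"
    by (rule finite_subset[of _ "{..<length vs} \<times> {..<length vs}"]) (auto simp: list_graph_def)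
  moreover have "symmetric (with_proj (list_graph vs R))"
    using assms(1) by (auto simp: symmetric_def list_graph_def sym_def)
  ultimately have "pair_graph (list_graph vs R)"
    by unfold_locales (use assms in \<open>auto simp: list_graph_def\<close>)
  then show ?thesis unfolding instance_graph_def by (auto simp: list_graph_def)
qed

lemma two_club_list_graph:
  assumes "\<And>u v. R u v \<Longrightarrow> R v u" "\<And>u. \<not> R u u"
    and near: "\<And>u v. u \<in> set vs \<Longrightarrow> v \<in> set vs \<Longrightarrow> u = v \<or> R u v \<or> (\<exists>w\<in>set vs. R u w \<and> R w v)"
    and "distinct vs"
  shows "two_club (list_graph vs R)"
  unfolding two_club_def
proof (intro ballI)
  let ?G = "list_graph vs R"
  interpret pair_graph ?G
    using instance_graph_list_graph[of R vs, OF assms(1,2)] unfolding instance_graph_def by blast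
  fix i j assume "i \<in> pverts ?G" "j \<in> pverts ?G"
  then have ij: "i < length vs" "j < length vs" by (auto simp: list_graph_def)
  \<comment> \<open>The distance is an infimum over walks, and with unit weights the cost of a walk
    is its length. So it suffices to exhibit a walk with at most two arcs.\<close>
  have walk: "\<mu> (\<lambda>_. 1) i j \<le> 2" if "awalk i p j" "length p \<le> 2" for p
  proof -
    have "\<mu> (\<lambda>_. 1) i j \<le> awalk_cost (\<lambda>_. 1) p"
      by (rule min_cost_le_walk_cost[OF that(1)])
    also have "awalk_cost (\<lambda>_. 1) p = real (length p)"
      by (simp add: awalk_cost_def sum_list_triv)
    also have "ereal (real (length p)) \<le> 2" using that(2) by simp
    finally show ?thesis .
  qed
  consider "vs ! i = vs ! j" | "R (vs ! i) (vs ! j)"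
    | w where "w \<in> set vs" "R (vs ! i) w" "R w (vs ! j)"
    using near[of "vs ! i" "vs ! j"] ij by auto
  then show "\<mu> (\<lambda>_. 1) i j \<le> 2"
  proof cases
    case 1
    then have "awalk i [] j"
      using ij assms(4) by (simp add: awalk_Nil_iff nth_eq_iff_index_eq) (simp add: list_graph_def)
    then show ?thesis using walk by fastforce
  next
    case 2
    then have "awalk i [(i, j)] j" using ij by (simp add: awalk_simps) (simp add: list_graph_def)
    then show ?thesis using walk by fastforce
  next
    case 3
    then obtain l where "l < length vs" "vs ! l = w" by (auto simp: in_set_conv_nth)
    then have "awalk i [(i, l), (l, j)] j" using ij 3
      by (simp add: awalk_simps) (simp add: list_graph_def)
    then show ?thesis using walk by fastforce
  qed
qed

text \<open>As \<open>vs\<close> has no repetitions, \<open>(!) vs\<close> is a bijection from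
  positions to vertices and preserves the cardinality of vertex sets.\<close>

lemma ex_independent_dominating_set_list_graph:
  assumes "distinct vs" and sym: "\<And>u v. R u v \<Longrightarrow> R v u"
  shows "(\<exists>D. independent_dominating_set (list_graph vs R) D \<and> card D \<le> K) \<longleftrightarrow>
    (\<exists>D\<subseteq>set vs. (\<forall>u\<in>D. \<forall>v\<in>D. \<not> R u v) \<and> (\<forall>v\<in>set vs. v \<in> D \<or> (\<exists>u\<in>D. R u v)) \<and> card D \<le> K)"
    (is "?L \<longleftrightarrow> ?R")
proof -
  have inj: "inj_on ((!) vs) {..<length vs}" using assms(1) by (simp add: inj_on_nth)
  have surj: "(!) vs ` {..<length vs} = set vs" by (auto simp: in_set_conv_nth)
  have ids: "independent_dominating_set (list_graph vs R) I \<longleftrightarrow>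
      (\<forall>u\<in>(!) vs ` I. \<forall>v\<in>(!) vs ` I. \<not> R u v) \<and>
      (\<forall>v\<in>set vs. v \<in> (!) vs ` I \<or> (\<exists>u\<in>(!) vs ` I. R u v))" if I: "I \<subseteq> {..<length vs}" for I
  proof -
    have "(\<Union>i\<in>I. closed_nbhd (list_graph vs R) i) = {..<length vs} \<longleftrightarrow>
        (\<forall>j<length vs. j \<in> I \<or> (\<exists>i\<in>I. R (vs ! i) (vs ! j)))"
      using I by (fastforce simp: closed_nbhd_def list_graph_def)
    moreover have "(\<forall>j<length vs. j \<in> I \<or> (\<exists>i\<in>I. R (vs ! i) (vs ! j))) \<longleftrightarrow>
        (\<forall>v\<in>set vs. v \<in> (!) vs ` I \<or> (\<exists>u\<in>(!) vs ` I. R u v))"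
      using I inj_on_image_mem_iff[OF inj _ I] unfolding surj[symmetric] by (auto simp: image_iff)
    moreover have "independent (list_graph vs R) I \<longleftrightarrow> (\<forall>u\<in>I. \<forall>v\<in>I. \<not> R (vs ! u) (vs ! v))"
      using I unfolding independent_def list_graph_def by (auto simp: subset_iff)
    ultimately show ?thesis
      using I by (simp add: independent_dominating_set_def) (simp add: list_graph_def)
  qed
  show ?thesis
  proof
    assume ?L
    then obtain I where I: "independent_dominating_set (list_graph vs R) I" "card I \<le> K"
      by blast
    then have sub: "I \<subseteq> {..<length vs}"
      by (simp add: independent_dominating_set_def list_graph_def)
    have "card ((!) vs ` I) \<le> K" using I(2) card_image_le[OF finite_subset[OF sub]]
      by (meson finite_lessThan order_trans)
    then show ?R using I(1) ids[OF sub] sub surj by (intro exI[of _ "(!) vs ` I"]) blast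
  next
    assume ?R
    then obtain D where D: "D \<subseteq> set vs" "\<forall>u\<in>D. \<forall>v\<in>D. \<not> R u v"
      "\<forall>v\<in>set vs. v \<in> D \<or> (\<exists>u\<in>D. R u v)" "card D \<le> K" by blast
    then obtain I where I: "I \<subseteq> {..<length vs}" "D = (!) vs ` I"
      unfolding surj[symmetric] by (auto simp: subset_image_iff)
    have "card I = card D" unfolding I(2)
      by (rule card_image[symmetric]) (rule inj_on_subset[OF inj I(1)])
    then show ?L using ids[OF I(1)] D I by (intro exI[of _ I]) auto
  qed
qed

section \<open>Injectivity of the graph encoding\<close>

lemma enc_list_eqD: "enc_list f xs = enc_list g ys \<Longrightarrow> map f xs = map g ys"
proof (induction xs arbitrary: ys)
  case Nil
  then show ?case by (cases ys) auto
next
  case (Cons x xs)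
  then show ?case by (cases ys) auto
qed

lemma enc_bool_inj: "enc_bool b = enc_bool c \<longleftrightarrow> b = c"
  by (simp add: enc_bool_def)

text \<open>Membership in the problem only asks for some graph with the given code, so the code has
  to determine the graph. The number of rows gives the vertices, and as arcs join vertices only, the
  matrix gives all arcs.\<close>

lemma enc_graph_inj:
  assumes "instance_graph G" "instance_graph H" "enc_graph G = enc_graph H" shows "G = H"
proof -
  obtain m n where mn: "pverts G = {..<m}" "pverts H = {..<n}"
    using assms(1,2) unfolding instance_graph_def by blast
  interpret G: pair_graph G using assms(1) by (simp add: instance_graph_def)
  interpret H: pair_graph H using assms(2) by (simp add: instance_graph_def)
  let ?row = "\<lambda>G n u. enc_list (\<lambda>v. enc_bool ((u, v) \<in> parcs G)) [0..<n]"
  have "enc_list (?row G m) [0..<m] = enc_list (?row H n) [0..<n]"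
    using assms(3) by (simp add: enc_graph_def mn Let_def)
  then have rows: "map (?row G m) [0..<m] = map (?row H n) [0..<n]" by (rule enc_list_eqD)
  from arg_cong[OF this, of length] have n: "n = m" by simp
  have "?row G m u = ?row H m u" if "u < m" for u
    using rows that unfolding n by simp
  then have "(u, v) \<in> parcs G \<longleftrightarrow> (u, v) \<in> parcs H" if "u < m" "v < m"
    for u v
    using enc_list_eqD[of _ "[0..<m]" _ "[0..<m]"] that by (fastforce simp: enc_bool_inj)
  then have "parcs G = parcs H"
    using G.in_arcsD1 G.in_arcsD2 H.in_arcsD1 H.in_arcsD2 unfolding mn n
    by (intro set_eqI) (metis lessThan_iff surj_pair)
  then show ?thesis using mn n by simp
qed

section \<open>The reduction\<close>

definition input_list :: "circuit \<Rightarrow> nat list" where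
  "input_list C = filter (\<lambda>i. i < length C \<and> C ! i = Input) [0..<length C]"

definition info_pairs :: "circuit \<Rightarrow> nat \<Rightarrow> (nat \<times> nat) list" where
  "info_pairs C k = (0, 0) # (Suc k, Suc (length C)) #
     concat (map (\<lambda>i. map (\<lambda>p. (Suc i, Suc p)) (input_list C)) [0..<k])"

text \<open>The slot \<open>[]\<close> holds the certificate of the output; the slot \<open>s\<close> holds the values of the
  enumeration at the indices in \<open>s\<close>.\<close>

definition slots :: "nat \<Rightarrow> nat \<Rightarrow> nat list list" where
  "slots r k = [] # List.n_lists r [0..<Suc (Suc k)]"

type_synonym vertex = "nat \<times> nat list \<times> (nat \<times> nat) list"

abbreviation kind :: "vertex \<Rightarrow> nat" where "kind \<equiv> fst"
abbreviation slot :: "vertex \<Rightarrow> nat list" where "slot v \<equiv> fst (snd v)"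
abbreviation info :: "vertex \<Rightarrow> (nat \<times> nat) list" where "info v \<equiv> snd (snd v)"

text \<open>Kind 0: a choice of information for a slot. Kinds 1 and 2: two vertices per slot that force a
  choice for this slot. Kind 4: a single vertex that joins kinds 0 to 2 and thus makes the graph a
  2-club. Kind 3: one vertex per slot; they make kind 4 useless for domination.\<close>

definition vertices :: "nat \<Rightarrow> circuit \<Rightarrow> nat \<Rightarrow> vertex list" where
  "vertices r C k =
     map (\<lambda>t. (0, [], t)) (List.n_lists r (info_pairs C k)) @
     map (\<lambda>t. (0, map fst t, t)) (List.n_lists r (info_pairs C k)) @
     concat (map (\<lambda>s. map (\<lambda>j. (j, s, [])) [1, 2, 3]) (slots r k)) @
     [(4, [], [])]"

text \<open>If two pairs have equal indices, neither index is less than the other, so neither value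
  is. The condition therefore says that the pairs form a strictly increasing partial
  function.\<close>

definition consistent :: "(nat \<times> nat) list \<Rightarrow> bool" where
  "consistent t \<longleftrightarrow> (\<forall>x\<in>set t. \<forall>y\<in>set t. fst x < fst y \<longleftrightarrow> snd x < snd y)"

definition compatible :: "circuit \<Rightarrow> vertex \<Rightarrow> vertex \<Rightarrow> bool" where
  "compatible C u v \<longleftrightarrow> consistent (info u @ info v) \<and>
     (slot u = [] \<or> slot v = [] \<longrightarrow> accepts (set (info u @ info v)) C)"

definition arc :: "circuit \<Rightarrow> vertex \<Rightarrow> vertex \<Rightarrow> bool" where
  "arc C u v \<longleftrightarrow>
     kind u = 0 \<and> (kind v = 0 \<and> (if slot u = slot v then info u \<noteq> info v else \<not> compatible C u v) \<or>
       0 < kind v \<and> kind v < 3 \<and> slot u = slot v \<or> 2 < kind v) \<or>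
     0 < kind u \<and> kind u < 3 \<and> kind v = 4"

definition adjacent :: "circuit \<Rightarrow> vertex \<Rightarrow> vertex \<Rightarrow> bool" where
  "adjacent C u v \<longleftrightarrow> arc C u v \<or> arc C v u"

section \<open>Slots, candidates and distances in the graph\<close>

lemma consistentD:
  "consistent t \<Longrightarrow> (i, v) \<in> set t \<Longrightarrow> (j, w) \<in> set t \<Longrightarrow> i < j \<longleftrightarrow> v < w"
  unfolding consistent_def by fastforce

lemma adjacent_sym: "adjacent C u v \<Longrightarrow> adjacent C v u"
  unfolding adjacent_def by blast

lemma adjacent_irrefl: "\<not> adjacent C u u"
  unfolding adjacent_def arc_def by auto

lemma set_input_list: "set (input_list C) = input_nodes C"
  by (auto simp: input_list_def input_nodes_def)

lemma set_info_pairs: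
  "(i, v) \<in> set (info_pairs C k) \<longleftrightarrow> i = 0 \<and> v = 0 \<or> i = Suc k \<and> v = Suc (length C) \<or>
     0 < i \<and> i \<le> k \<and> (\<exists>p\<in>input_nodes C. v = Suc p)"
  by (cases i) (auto simp: info_pairs_def set_input_list image_iff)

lemma distinct_info_pairs: "distinct (info_pairs C k)"
proof -
  have "distinct (map (\<lambda>p. (Suc i, Suc p)) (input_list C))" for i
    by (simp add: distinct_map input_list_def inj_on_def)
  then have "distinct (concat (map (\<lambda>i. map (\<lambda>p. (Suc i, Suc p)) (input_list C)) [0..<k]))"
    by (induction k) auto
  then show ?thesis by (auto simp: info_pairs_def)
qed

lemma slots_eq: "set (slots r k) = insert [] {s. length s = r \<and> set s \<subseteq> {..Suc k}}"
  unfolding slots_def by (auto simp: set_n_lists atLeast0LessThan lessThan_Suc_atMost)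

lemma distinct_slots: "0 < r \<Longrightarrow> distinct (slots r k)"
  unfolding slots_def by (auto simp: set_n_lists distinct_n_lists simp del: upt_Suc)

lemma set_vertices:
  assumes "0 < r"
  shows "(j, s, t) \<in> set (vertices r C k) \<longleftrightarrow>
    j = 0 \<and> (s = [] \<or> s = map fst t) \<and> length t = r \<and> set t \<subseteq> set (info_pairs C k) \<or>
    j \<in> {1, 2, 3} \<and> s \<in> set (slots r k) \<and> t = [] \<or>
    j = 4 \<and> s = [] \<and> t = []"
  unfolding vertices_def set_append Un_iff set_map set_concat set_n_lists image_iff by auto

text \<open>For positive \<open>r\<close> no tuple is empty, so a candidate of the slot
  \<open>map fst t\<close> is never one of the slot \<open>[]\<close>; for \<open>r = 0\<close> the
  first two lists would coincide.\<close>

lemma distinct_vertices: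
  assumes "0 < r" shows "distinct (vertices r C k)"
proof -
  let ?T = "List.n_lists r (info_pairs C k)"
  let ?Z = "\<lambda>ss. concat (map (\<lambda>s. map (\<lambda>j. (j, s, [])) [1, 2, 3]) ss) :: vertex list"
  have T: "distinct ?T" by (rule distinct_n_lists[OF distinct_info_pairs])
  then have "distinct (map (\<lambda>t. (0::nat, [] :: nat list, t)) ?T)"
    "distinct (map (\<lambda>t. (0::nat, map fst t, t)) ?T)"
    by (simp_all add: distinct_map inj_on_def)
  moreover have "distinct (?Z (slots r k))"
  proof -
    have "distinct (?Z ss)" if "distinct ss" for ss using that by (induction ss) auto
    then show ?thesis using distinct_slots[OF assms] .
  qed
  moreover have "[] \<notin> set ?T" using assms by (auto simp: set_n_lists)
  ultimately show ?thesis unfolding vertices_def by (simp add: image_iff) blast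
qed

lemma slot_vertices:
  assumes "0 < r" "(0, s, t) \<in> set (vertices r C k)" shows "s \<in> set (slots r k)"
proof -
  have "fst x \<le> Suc k" if "x \<in> set (info_pairs C k)" for x
    using that set_info_pairs[of "fst x" "snd x"] by auto
  then show ?thesis
    using assms(2) unfolding set_vertices[OF assms(1)] slots_eq by (fastforce dest: subsetD)
qed

text \<open>In a topological order the first gate has no in-neighbours and must be an input, so
  every index has a possible value. As inconsistent tuples are candidates too, this holds even if
  there are fewer than \<open>k\<close> inputs.\<close>

lemma ex_choice:
  assumes "0 < r" "wf_circuit C" "s \<in> set (slots r k)"
  shows "\<exists>t. (0, s, t) \<in> set (vertices r C k)"
proof -
  have "fan_in_ok (C ! 0)" "\<forall>j\<in>set (in_nbrs (C ! 0)). j < 0" "0 < length C"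
    using assms(2) unfolding wf_circuit_def by auto
  then have "0 \<in> input_nodes C"
    unfolding input_nodes_def by (cases "C ! 0") (auto simp: Suc_le_length_iff numeral_2_eq_2)
  then have "\<exists>v. (i, v) \<in> set (info_pairs C k)" if "i \<le> Suc k" for i
    unfolding set_info_pairs using that by (cases "i = 0"; cases "i = Suc k") auto
  then obtain f where f: "\<And>i. i \<le> Suc k \<Longrightarrow> (i, f i) \<in> set (info_pairs C k)" by metis
  show ?thesis
  proof (cases "s = []")
    case True
    then have "(0, s, replicate r (0, f 0)) \<in> set (vertices r C k)"
      using f[of 0] by (auto simp: set_vertices[OF assms(1)])
    then show ?thesis ..
  next
    case False
    then have "(0, s, map (\<lambda>i. (i, f i)) s) \<in> set (vertices r C k)"
      using assms(3) f by (auto simp: set_vertices[OF assms(1)] slots_eq comp_def)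
    then show ?thesis ..
  qed
qed

lemma vertices_kind:
  assumes "0 < r" "u \<in> set (vertices r C k)"
  shows "kind u \<le> 4 \<and> (kind u = 4 \<longrightarrow> u = (4, [], [])) \<and> slot u \<in> set (slots r k)"
proof -
  obtain j s t where u: "u = (j, s, t)" by (rule prod_cases3)
  have "s \<in> set (slots r k)"
  proof (cases "j = 0")
    case True
    with assms u slot_vertices show ?thesis by blast
  next
    case False
    with assms(2) show ?thesis unfolding u set_vertices[OF assms(1)] by (auto simp: slots_eq)
  qed
  with assms(2) show ?thesis unfolding u set_vertices[OF assms(1)] by auto
qed

text \<open>Kinds 0 to 2 meet in the hub \<open>(4, [], [])\<close>, and kinds 3 and 4 in any
  candidate. A vertex of kind 1 or 2 meets kind 3 in a candidate of its own slot, for which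
  \<open>ex_choice\<close> is needed.\<close>

lemma vertices_near:
  assumes "0 < r" "wf_circuit C" and u: "u \<in> set (vertices r C k)"
    and v: "v \<in> set (vertices r C k)"
  shows "u = v \<or> adjacent C u v \<or> (\<exists>w\<in>set (vertices r C k). adjacent C u w \<and> adjacent C w v)"
proof -
  let ?V = "set (vertices r C k)"
  have hub: "(4, [], []) \<in> ?V" by (simp add: set_vertices[OF assms(1)])
  obtain t0 where t0: "(0, [], t0) \<in> ?V" using ex_choice[OF assms(1,2), of "[]" k]
    by (auto simp: slots_eq)
  have kinds: "kind w \<le> 4" "kind w = 4 \<Longrightarrow> w = (4, [], [])" "slot w \<in> set (slots r k)" if "w \<in> ?V" for w
    using vertices_kind[OF assms(1) that] by blast+
  have *: "adjacent C u v \<or> (\<exists>w\<in>?V. adjacent C u w \<and> adjacent C w v)"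
    if uv: "kind u < 3" "kind v = 3" "u \<in> ?V" for u v
  proof -
    obtain t where t: "(0, slot u, t) \<in> ?V" using ex_choice[OF assms(1,2) kinds(3)[OF uv(3)]]
      by blast
    show ?thesis
    proof (cases "kind u = 0")
      case True
      with uv show ?thesis by (simp add: adjacent_def arc_def)
    next
      case False
      with uv have "adjacent C u (0, slot u, t)" "adjacent C (0, slot u, t) v"
        by (simp_all add: adjacent_def arc_def)
      with t show ?thesis by blast
    qed
  qed
  consider "kind u < 3" "kind v < 3" | "kind u < 3" "kind v = 3" | "kind u = 3" "kind v < 3"
    | "3 \<le> kind u" "3 \<le> kind v" | "kind u < 3" "kind v = 4" | "kind u = 4" "kind v < 3"
    using kinds(1)[OF u] kinds(1)[OF v] by linarith
  then show ?thesis
  proof cases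
    case 1
    then have "adjacent C u (4, [], [])" "adjacent C (4, [], []) v"
      by (auto simp: adjacent_def arc_def)
    with hub show ?thesis by blast
  next
    case 2
    then show ?thesis using * u by blast
  next
    case 3
    then show ?thesis using *[of v u] v adjacent_sym by blast
  next
    case 4
    then have "adjacent C u (0, [], t0)" "adjacent C (0, [], t0) v"
      by (auto simp: adjacent_def arc_def)
    with t0 show ?thesis by blast
  qed (auto simp: adjacent_def arc_def)
qed

subsection \<open>From independent dominating sets to satisfying assignments\<close>

text \<open>A counting argument. If the hub is chosen, no candidate is, so all vertices of kind 3
  have to be chosen as well, one vertex too many. Otherwise a slot without a chosen candidate costs
  two vertices, and every other slot costs at least one.\<close>

lemma choices_of_dominating_set:
  assumes "0 < r" and D: "D \<subseteq> set (vertices r C k)"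
    and indep: "\<And>u v. u \<in> D \<Longrightarrow> v \<in> D \<Longrightarrow> \<not> adjacent C u v"
    and dom: "\<And>v. v \<in> set (vertices r C k) \<Longrightarrow> v \<in> D \<or> (\<exists>u\<in>D. adjacent C u v)"
    and card: "card D \<le> length (slots r k)"
    and s: "s \<in> set (slots r k)"
  shows "\<exists>t. (0, s, t) \<in> D"
proof (rule ccontr)
  assume no: "\<nexists>t. (0, s, t) \<in> D"
  let ?S = "set (slots r k)"
  have fin: "finite D" using D finite_subset by blast
  have length: "length (slots r k) = card ?S" using distinct_card[OF distinct_slots[OF assms(1)]]
    by simp
  have force: "(j, s', []) \<in> D"
    if "(4, [], []) \<notin> D" "j = 1 \<or> j = 2" "s' \<in> ?S" "\<nexists>t. (0, s', t) \<in> D"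
      for j s'
  proof (rule ccontr)
    assume "(j, s', []) \<notin> D"
    moreover have "(j, s', []) \<in> set (vertices r C k)" using that(2,3)
      by (auto simp: set_vertices[OF assms(1)])
    ultimately obtain u where u: "u \<in> D" "adjacent C u (j, s', [])" using dom by blast
    then have "kind u = 0 \<and> slot u = s' \<or> kind u = 4"
      using that(2) unfolding adjacent_def arc_def by auto
    then show False
    proof
      assume "kind u = 4"
      then have "u = (4, [], [])" using u(1) D vertices_kind[OF assms(1), of u C k] by blast
      with u(1) that(1) show False by simp
    next
      assume "kind u = 0 \<and> slot u = s'"
      then have "u = (0, s', info u)" by (simp add: prod_eq_iff)
      then show False using u(1) that(4) by metis
    qed
  qed
  show False
  proof (cases "(4, [], []) \<in> D")
    case True
    have "(3, s', []) \<in> D" if "s' \<in> ?S" for s'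
    proof (rule ccontr)
      assume "(3, s', []) \<notin> D"
      moreover have "(3, s', []) \<in> set (vertices r C k)" using that
        by (simp add: set_vertices[OF assms(1)])
      ultimately obtain u where u: "u \<in> D" "adjacent C u (3, s', [])" using dom by blast
      then have "adjacent C u (4, [], [])" unfolding adjacent_def arc_def by auto
      with indep u(1) True show False by blast
    qed
    then have "insert (4, [], []) ((\<lambda>s'. (3, s', [])) ` ?S) \<subseteq> D" using True
      by auto
    from card_mono[OF fin this] have "Suc (card ((\<lambda>s'. (3::nat, s', [] :: (nat \<times> nat) list)) ` ?S)) \<le> card D"
      by (subst (asm) card_insert_disjoint) auto
    moreover have "card ((\<lambda>s'. (3::nat, s', [] :: (nat \<times> nat) list)) ` ?S) = card ?S"
      by (rule card_image) (simp add: inj_on_def)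
    ultimately show False using card length by simp
  next
    case False
    \<comment> \<open>One vertex of \<open>D\<close> per slot: a candidate if possible and the
      vertex of kind 1 otherwise. All these have kind less than 2, so \<open>(2, s, [])\<close> is
      an additional one.\<close>
    define g :: "nat list \<Rightarrow> vertex" where "g s' = (if \<exists>t. (0, s', t) \<in> D then (0, s', SOME t. (0, s', t) \<in> D) else (1, s', []))" for s' :: "nat list"
    have g: "g s' \<in> D" "slot (g s') = s'" "kind (g s') < 2" if "s' \<in> ?S" for s'
    proof -
      have "g s' \<in> D \<and> slot (g s') = s' \<and> kind (g s') < 2"
      proof (cases "\<exists>t. (0, s', t) \<in> D")
        case True
        then have "(0, s', SOME t. (0, s', t) \<in> D) \<in> D" by (rule someI_ex)
        with True show ?thesis by (simp add: g_def)
      next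
        case no: False
        from force[OF False _ that no, of 1] have "(1, s', []) \<in> D" by simp
        with no show ?thesis by (simp add: g_def)
      qed
      then show "g s' \<in> D" "slot (g s') = s'" "kind (g s') < 2" by auto
    qed
    have "(2, s, []) \<in> D" using force[OF False, of 2 s] s no by blast
    then have "insert (2, s, []) (g ` ?S) \<subseteq> D" using g by auto
    moreover have "(2, s, []) \<notin> g ` ?S" using g(3) by (metis fst_conv imageE less_irrefl)
    ultimately have "Suc (card (g ` ?S)) \<le> card D"
      using card_mono[OF fin, of "insert (2, s, []) (g ` ?S)"] by simp
    moreover have "card (g ` ?S) = card ?S" by (rule card_image) (metis inj_onI g(2))
    ultimately show False using card length by simp
  qed
qed

lemma ex_list_superset:
  assumes "finite S" "card S \<le> r" "S \<subseteq> F" "x \<in> F"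
  shows "\<exists>t. length t = r \<and> S \<subseteq> set t \<and> set t \<subseteq> F"
proof -
  obtain xs where "set xs = S" "length xs = card S"
    using assms(1) finite_distinct_list distinct_card by metis
  then show ?thesis using assms by (intro exI[of _ "xs @ replicate (r - card S) x"]) auto
qed

text \<open>The constant slots \<open>replicate r i\<close> fix the enumeration. Consistency makes
  it increasing and forces the candidates of all slots, including \<open>[]\<close>, to agree with
  it. Hence some slot holds a certificate of the true output value, and its compatibility with
  \<open>[]\<close> rules out rejection.\<close>

lemma satisfiable_of_choices:
  assumes wf: "wf_circuit C" and weft: "weft_at_most 1 C" and depth: "depth_at_most d C"
    and r: "r = 2 ^ Suc d"
    and \<tau>: "\<And>s. s \<in> set (slots r k) \<Longrightarrow> (0, s, \<tau> s) \<in> set (vertices r C k)"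
    and comp: "\<And>s s'. s \<in> set (slots r k) \<Longrightarrow> s' \<in> set (slots r k) \<Longrightarrow> s \<noteq> s' \<Longrightarrow>
      compatible C (0, s, \<tau> s) (0, s', \<tau> s')"
  shows "\<exists>A\<subseteq>input_nodes C. card A = k \<and> satisfies A C"
proof -
  have r0: "0 < r" by (simp add: r)
  let ?S = "set (slots r k)"
  define a where "a i = snd (hd (\<tau> (replicate r i)))" for i
  have rep: "replicate r i \<in> ?S" "replicate r i \<noteq> []" if "i \<le> Suc k" for i
    using that r0 by (auto simp: slots_eq)
  have Nil: "[] \<in> ?S" by (simp add: slots_eq)
  have \<tau>_sub: "length (\<tau> s) = r" "set (\<tau> s) \<subseteq> set (info_pairs C k)" "s \<noteq> [] \<Longrightarrow> map fst (\<tau> s) = s"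
    if "s \<in> ?S" for s
    using \<tau>[OF that] by (auto simp: set_vertices[OF r0])
  have a_in: "(i, a i) \<in> set (\<tau> (replicate r i))" if "i \<le> Suc k" for i
  proof -
    let ?t = "\<tau> (replicate r i)"
    have "?t \<noteq> []" using \<tau>_sub(1)[OF rep(1)[OF that]] r0 by auto
    then obtain x t where t: "?t = x # t" by (cases ?t) auto
    have "map fst ?t = replicate r i" using \<tau>_sub(3)[OF rep[OF that]] .
    then have "fst x = i" using t r0 by (cases r) auto
    then show ?thesis using t by (cases x) (simp add: a_def)
  qed
  have cons: "(i < j) = (v < w)"
    if "s \<in> ?S" "s' \<in> ?S" "(i, v) \<in> set (\<tau> s)" "(j, w) \<in> set (\<tau> s')"
    for i j v w s s'
  proof -
    \<comment> \<open>A candidate is compared only with candidates of other slots; its own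
      consistency follows from merging it with any of these, so a second slot is needed.\<close>
    obtain s'' where s'': "s'' \<in> ?S" "s'' \<noteq> s" using Nil rep[of 0] by (metis zero_le)
    have "consistent (\<tau> s @ \<tau> s') \<or> s = s' \<and> consistent (\<tau> s @ \<tau> s'')"
      using comp that(1,2) s'' unfolding compatible_def by (cases "s = s'") auto
    then show ?thesis
    proof
      assume "consistent (\<tau> s @ \<tau> s')"
      from consistentD[OF this] show ?thesis using that(3,4) by simp
    next
      assume "s = s' \<and> consistent (\<tau> s @ \<tau> s'')"
      then show ?thesis using consistentD[of "\<tau> s @ \<tau> s''" i v j w] that(3,4) by auto
    qed
  qed
  have a_pairs: "(i, a i) \<in> set (info_pairs C k)" if "i \<le> Suc k" for i
    using a_in[OF that] \<tau>_sub(2)[OF rep(1)[OF that]] by blast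
  have a_mono: "a i < a j" if "i < j" "j \<le> Suc k" for i j
    using cons[OF rep(1) rep(1) a_in a_in, of i j] that by simp
  define A where "A = {p. \<exists>i. 0 < i \<and> i \<le> k \<and> a i = Suc p}"
  interpret enumerated_input_set C A k a
  proof
    show "a 0 = 0" "a (Suc k) = Suc (length C)" using a_pairs[of 0] a_pairs[of "Suc k"]
      by (auto simp: set_info_pairs)
  qed (use wf a_mono in \<open>auto simp: A_def\<close>)
  have a_input: "a i - 1 \<in> input_nodes C" "Suc (a i - 1) = a i" if "0 < i" "i \<le> k" for i
    using a_pairs[of i] that by (auto simp: set_info_pairs)
  have A_image: "A = (\<lambda>i. a i - 1) ` {1..k}"
  proof (intro set_eqI iffI)
    fix p assume "p \<in> A"
    then obtain i where "0 < i" "i \<le> k" "a i = Suc p" unfolding A_def by blast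
    then show "p \<in> (\<lambda>i. a i - 1) ` {1..k}" by (intro image_eqI[of _ _ i]) auto
  next
    fix p assume "p \<in> (\<lambda>i. a i - 1) ` {1..k}"
    then obtain i where i: "1 \<le> i" "i \<le> k" "p = a i - 1" by auto
    then have "a i = Suc p" using a_input(2)[of i] by simp
    then show "p \<in> A" unfolding A_def using i by (intro CollectI exI[of _ i]) simp
  qed
  have "inj_on (\<lambda>i. a i - 1) {1..k}"
  proof (rule inj_onI)
    fix i j assume "i \<in> {1..k}" "j \<in> {1..k}" "a i - 1 = a j - 1"
    then show "i = j" using a_input(2)[of i] a_input(2)[of j] a_inj[of i j] by simp
  qed
  then have "card A = k" unfolding A_image by (simp add: card_image)
  moreover have "A \<subseteq> input_nodes C" unfolding A_image using a_input(1) by auto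
  moreover have "satisfies A C"
  proof -
    have \<tau>_full: "set (\<tau> s) \<subseteq> full" if s: "s \<in> ?S" for s
    proof
      fix x assume x: "x \<in> set (\<tau> s)"
      obtain i v where iv: "x = (i, v)" by (cases x)
      have i: "i \<le> Suc k" using \<tau>_sub(2)[OF s] x iv by (force simp: set_info_pairs)
      have "\<not> v < a i" "\<not> a i < v"
        using cons[OF s rep(1)[OF i] _ a_in[OF i]] cons[OF rep(1)[OF i] s a_in[OF i]] x iv by blast+
      then have "v = a i" by simp
      then show "x \<in> full" using i iv by (auto simp: full_def)
    qed
    obtain S where S: "S \<subseteq> full" "finite S" "card S \<le> r"
      "\<And>S'. S \<subseteq> S' \<Longrightarrow> S' \<subseteq> full \<Longrightarrow> accepts S' C = satisfies A C"
      using ex_output_certificate[OF weft depth] unfolding r by blast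
    \<comment> \<open>A truthful pair to pad the certificate to length \<open>r\<close>. Among
      truthful tuples the indices determine the values, so the padded tuple is the candidate chosen
      for the slot of its indices.\<close>
    have "(0, a 0) \<in> full" by (simp add: full_def)
    from ex_list_superset[OF S(2,3,1) this] obtain t
      where t: "length t = r" "S \<subseteq> set t" "set t \<subseteq> full" by blast
    let ?s = "map fst t"
    have full_eq: "x = (fst x, a (fst x))" if "x \<in> full" for x using that
      by (auto simp: full_def)
    have s: "?s \<in> ?S" "?s \<noteq> []" using t r0 by (auto simp: slots_eq full_def)
    have "\<tau> ?s = map (\<lambda>x. (fst x, a (fst x))) (\<tau> ?s)"
      by (rule map_idI[symmetric]) (rule full_eq[symmetric], rule subsetD[OF \<tau>_full[OF s(1)]])
    also have "\<dots> = map (\<lambda>i. (i, a i)) (map fst (\<tau> ?s))" by simp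
    also have "\<dots> = map (\<lambda>i. (i, a i)) (map fst t)" using \<tau>_sub(3)[OF s] by simp
    also have "\<dots> = map (\<lambda>x. (fst x, a (fst x))) t" by simp
    also have "\<dots> = t" by (rule map_idI) (rule full_eq[symmetric], rule subsetD[OF t(3)])
    finally have "\<tau> ?s = t" .
    then have "accepts (set (t @ \<tau> [])) C"
      using comp[OF s(1) Nil s(2)] unfolding compatible_def by simp
    moreover have "accepts (set (t @ \<tau> [])) C = satisfies A C"
      using t \<tau>_full[OF Nil] by (intro S(4)) auto
    ultimately show ?thesis by simp
  qed
  ultimately show ?thesis by blast
qed

subsection \<open>From satisfying assignments to independent dominating sets\<close>

text \<open>Every vertex, whatever its kind, is equal or adjacent to the choice made for its own
  slot.\<close>

lemma dominating_set_of_choices: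
  assumes "0 < r"
    and \<tau>: "\<And>s. s \<in> set (slots r k) \<Longrightarrow> (0, s, \<tau> s) \<in> set (vertices r C k)"
    and comp: "\<And>s s'. s \<in> set (slots r k) \<Longrightarrow> s' \<in> set (slots r k) \<Longrightarrow> s \<noteq> s' \<Longrightarrow>
      compatible C (0, s, \<tau> s) (0, s', \<tau> s')"
  shows "\<exists>D\<subseteq>set (vertices r C k). (\<forall>u\<in>D. \<forall>v\<in>D. \<not> adjacent C u v) \<and>
    (\<forall>v\<in>set (vertices r C k). v \<in> D \<or> (\<exists>u\<in>D. adjacent C u v)) \<and> card D \<le> length (slots r k)"
proof (intro exI conjI)
  let ?S = "set (slots r k)" and ?D = "(\<lambda>s. (0, s, \<tau> s)) ` set (slots r k)"
  show "?D \<subseteq> set (vertices r C k)" using \<tau> by blast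
  show "\<forall>u\<in>?D. \<forall>v\<in>?D. \<not> adjacent C u v" using comp
    by (auto simp: adjacent_def arc_def)
  show "card ?D \<le> length (slots r k)" using card_image_le[of ?S] card_length[of "slots r k"]
    by (meson List.finite_set order_trans)
  show "\<forall>v\<in>set (vertices r C k). v \<in> ?D \<or> (\<exists>u\<in>?D. adjacent C u v)"
  proof
    fix v assume v: "v \<in> set (vertices r C k)"
    obtain j s t where jst: "v = (j, s, t)" by (rule prod_cases3)
    have "s \<in> ?S" using vertices_kind[OF assms(1) v] by (simp add: jst)
    then have "(0, s, \<tau> s) \<in> ?D" by blast
    moreover have "v = (0, s, \<tau> s) \<or> adjacent C (0, s, \<tau> s) v"
      unfolding jst adjacent_def arc_def by auto
    ultimately show "v \<in> ?D \<or> (\<exists>u\<in>?D. adjacent C u v)" by blast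
  qed
qed

text \<open>All choices come from a single enumeration and are therefore consistent; the slot
  \<open>[]\<close> receives a certificate, so acceptance survives merging with any other
  choice.\<close>

lemma choices_of_satisfying_set:
  assumes wf: "wf_circuit C" and weft: "weft_at_most 1 C" and depth: "depth_at_most d C"
    and r: "r = 2 ^ Suc d"
    and A: "A \<subseteq> input_nodes C" "card A = k" "satisfies A C"
  shows "\<exists>\<tau>. (\<forall>s\<in>set (slots r k). (0, s, \<tau> s) \<in> set (vertices r C k)) \<and>
    (\<forall>s\<in>set (slots r k). \<forall>s'\<in>set (slots r k). s \<noteq> s' \<longrightarrow> compatible C (0, s, \<tau> s) (0, s', \<tau> s'))"
proof -
  have r0: "0 < r" by (simp add: r)
  let ?S = "set (slots r k)"
  have fin: "finite A" by (rule finite_subset[OF A(1)]) (auto simp: input_nodes_def)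
  define xs where "xs = sorted_list_of_set A"
  have xs: "length xs = k" "set xs = A" "sorted_wrt (<) xs"
    using fin A(2) unfolding xs_def by simp_all
  \<comment> \<open>Index \<open>i\<close> refers to entry \<open>i - 1\<close> of the sorted list
    because index 0 belongs to the lower sentinel; node numbers are shifted because the value 0
    does.\<close>
  define a where "a i = (if i = 0 then 0 else if i \<le> k then Suc (xs ! (i - 1)) else Suc (length C))" for i
  have xs_less: "xs ! i < length C" if "i < k" for i
    using that xs A(1) nth_mem[of i xs] by (auto simp: input_nodes_def)
  interpret enumerated_input_set C A k a
  proof
    show "a i < a j" if "i < j" "j \<le> Suc k" for i j
    proof (cases "i = 0")
      case False
      then have "0 < i" "i \<le> k" using that by auto
      with that show ?thesis
        using sorted_wrt_nth_less[OF xs(3), of "i - 1" "j - 1"] xs(1) xs_less[of "i - 1"]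
          unfolding a_def by auto
    qed (use that in \<open>simp add: a_def\<close>)
    show "A = {p. \<exists>i. 0 < i \<and> i \<le> k \<and> a i = Suc p}"
    proof -
      have "p \<in> A \<longleftrightarrow> (\<exists>i<k. xs ! i = p)" for p using xs
        by (metis in_set_conv_nth)
      moreover have "(\<exists>i<k. xs ! i = p) \<longleftrightarrow> (\<exists>i. 0 < i \<and> i \<le> k \<and> a i = Suc p)" for p
      proof
        assume "\<exists>i<k. xs ! i = p"
        then obtain i where "i < k" "xs ! i = p" by blast
        then show "\<exists>i. 0 < i \<and> i \<le> k \<and> a i = Suc p"
          by (intro exI[of _ "Suc i"]) (simp add: a_def)
      next
        assume "\<exists>i. 0 < i \<and> i \<le> k \<and> a i = Suc p"
        then obtain i where "0 < i" "i \<le> k" "a i = Suc p" by blast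
        then show "\<exists>i<k. xs ! i = p" by (intro exI[of _ "i - 1"]) (auto simp: a_def)
      qed
      ultimately show ?thesis by blast
    qed
  qed (use wf in \<open>auto simp: a_def\<close>)
  have full_pairs: "full \<subseteq> set (info_pairs C k)"
  proof
    fix x assume "x \<in> full"
    then obtain i where i: "i \<le> Suc k" "x = (i, a i)" by (auto simp: full_def)
    have "xs ! (i - 1) \<in> input_nodes C" if "0 < i" "i \<le> k"
      using that xs A(1) nth_mem[of "i - 1" xs] by auto
    then show "x \<in> set (info_pairs C k)" unfolding i(2) set_info_pairs using i(1)
      by (auto simp: a_def)
  qed
  have consistent: "consistent t" if "set t \<subseteq> full" for t
  proof -
    have "(i < j) = (a i < a j)" if "i \<le> Suc k" "j \<le> Suc k" for i j
      using a_mono that by (metis less_asym linorder_neqE_nat less_irrefl)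
    then have "(fst x < fst y) = (snd x < snd y)" if "x \<in> full" "y \<in> full" for x y
      using that by (auto simp: full_def)
    then show ?thesis using that unfolding consistent_def by blast
  qed
  obtain S where S: "S \<subseteq> full" "finite S" "card S \<le> r"
    "\<And>S'. S \<subseteq> S' \<Longrightarrow> S' \<subseteq> full \<Longrightarrow> accepts S' C"
    using ex_output_certificate[OF weft depth] A(3) unfolding r by blast
  have "(0, a 0) \<in> full" by (simp add: full_def)
  from ex_list_superset[OF S(2,3,1) this] obtain t
    where t: "length t = r" "S \<subseteq> set t" "set t \<subseteq> full" by blast
  define \<tau> where "\<tau> s = (if s = [] then t else map (\<lambda>i. (i, a i)) s)" for s
  have \<tau>_full: "set (\<tau> s) \<subseteq> full" if "s \<in> ?S" for s
    using that t(3) by (auto simp: \<tau>_def slots_eq full_def)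
  show ?thesis
  proof (intro exI[of _ \<tau>] conjI ballI impI)
    fix s assume s: "s \<in> ?S"
    then show "(0, s, \<tau> s) \<in> set (vertices r C k)"
      using subset_trans[OF \<tau>_full[OF s] full_pairs] t(1)
      by (auto simp: set_vertices[OF r0] slots_eq \<tau>_def comp_def)
    fix s' assume s': "s' \<in> ?S" "s \<noteq> s'"
    have "consistent (\<tau> s @ \<tau> s')" using consistent \<tau>_full s s'(1) by simp
    moreover have "accepts (set (\<tau> s @ \<tau> s')) C" if "s = [] \<or> s' = []"
      using that t(2) \<tau>_full[OF s] \<tau>_full[OF s'(1)]
        by (intro S(4)) (auto simp: \<tau>_def)
    ultimately show "compatible C (0, s, \<tau> s) (0, s', \<tau> s')" by (simp add: compatible_def)
  qed
qed

definition reduced_graph :: "nat \<Rightarrow> circuit \<Rightarrow> nat \<Rightarrow> nat pair_pre_digraph" where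
  "reduced_graph r C k = list_graph (vertices r C k) (adjacent C)"

theorem reduced_graph_correct:
  assumes "wf_circuit C" "weft_at_most 1 C" "depth_at_most d C" "r = 2 ^ Suc d"
  shows "(\<exists>D. independent_dominating_set (reduced_graph r C k) D \<and> card D \<le> length (slots r k)) \<longleftrightarrow>
    (\<exists>A\<subseteq>input_nodes C. card A = k \<and> satisfies A C)" (is "?L \<longleftrightarrow> ?R")
proof -
  have r0: "0 < r" by (simp add: assms(4))
  let ?S = "set (slots r k)"
  have "?L \<longleftrightarrow> (\<exists>D\<subseteq>set (vertices r C k). (\<forall>u\<in>D. \<forall>v\<in>D. \<not> adjacent C u v) \<and>
    (\<forall>v\<in>set (vertices r C k). v \<in> D \<or> (\<exists>u\<in>D. adjacent C u v)) \<and> card D \<le> length (slots r k))"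
    (is "_ \<longleftrightarrow> ?D")
    unfolding reduced_graph_def
    by (rule ex_independent_dominating_set_list_graph[OF distinct_vertices[OF r0] adjacent_sym])
  also have "\<dots> \<longleftrightarrow> ?R"
  proof
    assume ?D
    then obtain D where D: "D \<subseteq> set (vertices r C k)" "\<And>u v. u \<in> D \<Longrightarrow> v \<in> D \<Longrightarrow> \<not> adjacent C u v"
      "\<And>v. v \<in> set (vertices r C k) \<Longrightarrow> v \<in> D \<or> (\<exists>u\<in>D. adjacent C u v)" "card D \<le> length (slots r k)"
      by blast
    have "\<forall>s\<in>?S. \<exists>t. (0, s, t) \<in> D" using choices_of_dominating_set[OF r0 D]
      by blast
    then obtain \<tau> where \<tau>: "\<And>s. s \<in> ?S \<Longrightarrow> (0, s, \<tau> s) \<in> D" by metis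
    show ?R
    proof (rule satisfiable_of_choices[OF assms])
      show "s \<in> ?S \<Longrightarrow> (0, s, \<tau> s) \<in> set (vertices r C k)" for s
        using \<tau> D(1) by blast
      fix s s' assume "s \<in> ?S" "s' \<in> ?S" "s \<noteq> s'"
      then show "compatible C (0, s, \<tau> s) (0, s', \<tau> s')"
        using D(2)[OF \<tau> \<tau>, of s s'] by (auto simp: adjacent_def arc_def)
    qed
  next
    assume ?R
    then obtain A where "A \<subseteq> input_nodes C" "card A = k" "satisfies A C" by blast
    from choices_of_satisfying_set[OF assms this] obtain \<tau> where
      "\<forall>s\<in>?S. (0, s, \<tau> s) \<in> set (vertices r C k)"
      "\<forall>s\<in>?S. \<forall>s'\<in>?S. s \<noteq> s' \<longrightarrow> compatible C (0, s, \<tau> s) (0, s', \<tau> s')" by blast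
    then show ?D by (intro dominating_set_of_choices[OF r0, of k \<tau>]) blast+
  qed
  finally show ?thesis .
qed

lemma instance_reduced_graph: "instance_graph (reduced_graph r C k)"
  unfolding reduced_graph_def by (rule instance_graph_list_graph[OF adjacent_sym adjacent_irrefl])

lemma two_club_reduced_graph: "0 < r \<Longrightarrow> wf_circuit C \<Longrightarrow> two_club (reduced_graph r C k)"
  unfolding reduced_graph_def
  by (rule two_club_list_graph[OF adjacent_sym adjacent_irrefl vertices_near distinct_vertices])

section \<open>The reduction takes polynomial time\<close>

abbreviation enc_pair :: "nat \<times> nat \<Rightarrow> tree" where "enc_pair \<equiv> env2 enc_nat enc_nat"
abbreviation enc_info :: "(nat \<times> nat) list \<Rightarrow> tree" where "enc_info \<equiv> enc_list enc_pair"
abbreviation enc_slot :: "nat list \<Rightarrow> tree" where "enc_slot \<equiv> enc_list enc_nat"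
abbreviation enc_vertex :: "vertex \<Rightarrow> tree" where "enc_vertex \<equiv> env2 enc_nat (env2 enc_slot enc_info)"
abbreviation enc_known :: "bool \<times> bool \<Rightarrow> tree" where "enc_known \<equiv> env2 enc_bool enc_bool"

lemma ptime_projl: "ptime E (\<lambda>a. Node (F a) (G a)) \<Longrightarrow> ptime E F"
  using ptime_left[of E "\<lambda>a. Node (F a) (G a)"] by simp

lemma ptime_projr: "ptime E (\<lambda>a. Node (F a) (G a)) \<Longrightarrow> ptime E G"
  using ptime_right[of E "\<lambda>a. Node (F a) (G a)"] by simp

lemma ptime_present:
  assumes t: "ptime E (\<lambda>a. enc_info (t a))" and p: "ptime E (\<lambda>a. enc_nat (p a))"
  shows "ptime E (\<lambda>a. enc_bool (present (set (t a)) (p a)))"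
  unfolding present_def
proof (rule ptime_bex[OF t])
  have x: "ptime (env2 E enc_pair) (\<lambda>z. enc_pair (snd z))" by (rule ptime_snd)
  show "ptime (env2 E enc_pair) (\<lambda>z. enc_bool (snd (snd z) = Suc (p (fst z))))"
    by (rule ptime_eq_nat[OF ptime_projr[OF x] ptime_Suc[OF ptime_fst[OF p]]])
qed

lemma ptime_absent:
  assumes t: "ptime E (\<lambda>a. enc_info (t a))" and p: "ptime E (\<lambda>a. enc_nat (p a))"
  shows "ptime E (\<lambda>a. enc_bool (absent (set (t a)) (p a)))"
  unfolding absent_def
proof (rule ptime_bex[OF t], rule ptime_bex[where f = enc_pair])
  show "ptime (env2 E enc_pair) (\<lambda>z. enc_info (t (fst z)))" by (rule ptime_fst[OF t])
  let ?E = "env2 (env2 E enc_pair) enc_pair"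
  have y: "ptime ?E (\<lambda>z. enc_pair (snd z))" by (rule ptime_snd)
  have x: "ptime ?E (\<lambda>z. enc_pair (snd (fst z)))"
    by (rule ptime_fst[where F = "\<lambda>z. enc_pair (snd z)", OF ptime_snd])
  have p': "ptime ?E (\<lambda>z. enc_nat (Suc (p (fst (fst z)))))"
    by (rule ptime_Suc, rule ptime_fst[where F = "\<lambda>z. enc_nat (p (fst z))"], rule ptime_fst[OF p])
  show "ptime ?E (\<lambda>z. enc_bool (fst (snd z) = Suc (fst (snd (fst z))) \<and>
      snd (snd (fst z)) < Suc (p (fst (fst z))) \<and> Suc (p (fst (fst z))) < snd (snd z)))"
    by (intro ptime_and)
       (rule ptime_eq_nat[OF ptime_projl[OF y] ptime_Suc[OF ptime_projl[OF x]]]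
         ptime_less[OF ptime_projr[OF x] p'] ptime_less[OF p' ptime_projr[OF y]])+
qed

lemma ptime_consistent:
  assumes t: "ptime E (\<lambda>a. enc_info (t a))"
  shows "ptime E (\<lambda>a. enc_bool (consistent (t a)))"
  unfolding consistent_def
proof (rule ptime_ball[OF t], rule ptime_ball[where f = enc_pair])
  show "ptime (env2 E enc_pair) (\<lambda>z. enc_info (t (fst z)))" by (rule ptime_fst[OF t])
  let ?E = "env2 (env2 E enc_pair) enc_pair"
  have y: "ptime ?E (\<lambda>z. enc_pair (snd z))" by (rule ptime_snd)
  have x: "ptime ?E (\<lambda>z. enc_pair (snd (fst z)))"
    by (rule ptime_fst[where F = "\<lambda>z. enc_pair (snd z)", OF ptime_snd])
  show "ptime ?E (\<lambda>z. enc_bool ((fst (snd (fst z)) < fst (snd z)) = (snd (snd (fst z)) < snd (snd z))))"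
    by (rule ptime_iff[OF ptime_less[OF ptime_projl[OF x] ptime_projl[OF y]]
          ptime_less[OF ptime_projr[OF x] ptime_projr[OF y]]])
qed

text \<open>Reading beyond the end yields \<open>Leaf\<close>, the code of false, in accordance with
  the length test in \<open>known_true\<close> and \<open>known_false\<close>.\<close>

lemma ptime_known:
  assumes vs: "ptime E (\<lambda>a. enc_list enc_known (vs a))"
    and j: "ptime E (\<lambda>a. enc_nat (j a))"
  shows "ptime E (\<lambda>a. enc_bool (known_true (vs a) (j a)))"
    and "ptime E (\<lambda>a. enc_bool (known_false (vs a) (j a)))"
proof -
  have "left (left (enc_list enc_known (drop j vs))) = enc_bool (known_true vs j)"
    "right (left (enc_list enc_known (drop j vs))) = enc_bool (known_false vs j)" for vs j
    by (cases "j < length vs";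
        simp add: known_true_def known_false_def Cons_nth_drop_Suc[symmetric] enc_bool_def)+
  then show "ptime E (\<lambda>a. enc_bool (known_true (vs a) (j a)))"
    "ptime E (\<lambda>a. enc_bool (known_false (vs a) (j a)))"
    using ptime_left[OF ptime_left[OF ptime_drop[OF vs j]]]
      ptime_right[OF ptime_left[OF ptime_drop[OF vs j]]] by simp_all
qed

fun gate_kind :: "gate \<Rightarrow> nat" where
  "gate_kind Input = 0" | "gate_kind (Neg j) = 1" | "gate_kind (Conj js) = 2" | "gate_kind (Disj js) = 3"

text \<open>The unary number in the encoding of a negation gate is also the encoding of a list of zeros.\<close>

fun gate_args :: "gate \<Rightarrow> nat list" where
  "gate_args Input = []" | "gate_args (Neg j) = replicate j 0" |
  "gate_args (Conj js) = js" | "gate_args (Disj js) = js"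

lemma enc_gate_eq: "enc_gate g = Node (enc_nat (gate_kind g)) (enc_slot (gate_args g))"
proof -
  have "enc_nat j = enc_slot (replicate j 0)" for j by (induction j) auto
  then show ?thesis by (cases g) (auto simp: numeral_2_eq_2 numeral_3_eq_3)
qed

text \<open>Programs cannot match on gates, so the cases are distinguished by number. The argument
  of a negation is recovered as the length of its list of zeros.\<close>

lemma known_value_eq:
  "known_value S vs g =
    (if gate_kind g = 0 then present S (length vs)
     else if gate_kind g = 1 then known_false vs (length (gate_args g))
     else if gate_kind g = 2 then
       (if 2 < length (gate_args g) then \<not> (\<exists>j\<in>set (gate_args g). known_false vs j)
        else \<forall>j\<in>set (gate_args g). known_true vs j)
     else \<exists>j\<in>set (gate_args g). known_true vs j,
     if gate_kind g = 0 then absent S (length vs)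
     else if gate_kind g = 1 then known_true vs (length (gate_args g))
     else if gate_kind g = 2 then \<exists>j\<in>set (gate_args g). known_false vs j
     else if 2 < length (gate_args g) then \<not> (\<exists>j\<in>set (gate_args g). known_true vs j)
       else \<forall>j\<in>set (gate_args g). known_false vs j)"
  by (cases g) auto

lemma ptime_known_value:
  assumes t: "ptime E (\<lambda>a. enc_info (t a))"
    and vs: "ptime E (\<lambda>a. enc_list enc_known (vs a))"
    and g: "ptime E (\<lambda>a. enc_gate (g a))"
  shows "ptime E (\<lambda>a. enc_known (known_value (set (t a)) (vs a) (g a)))"
proof -
  have g': "ptime E (\<lambda>a. enc_nat (gate_kind (g a)))" "ptime E (\<lambda>a. enc_slot (gate_args (g a)))"
    using ptime_projl[OF g[unfolded enc_gate_eq]] ptime_projr[OF g[unfolded enc_gate_eq]] .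
  have kind: "ptime E (\<lambda>a. enc_bool (gate_kind (g a) = n))" for n
    by (rule ptime_eq_nat[OF g'(1) ptime_const])
  have args: "ptime E (\<lambda>a. enc_nat (length (gate_args (g a))))"
    by (rule ptime_length[OF g'(2)])
  have large: "ptime E (\<lambda>a. enc_bool (2 < length (gate_args (g a))))"
    by (rule ptime_less[OF ptime_const args])
  have j: "ptime (env2 E enc_nat) (\<lambda>z. enc_nat (snd z))"
    "ptime (env2 E enc_nat) (\<lambda>z. enc_list enc_known (vs (fst z)))"
    by (rule ptime_snd, rule ptime_fst[OF vs])
  note quant = ptime_ball[OF g'(2) ptime_known(1)[OF j(2,1)]] ptime_ball[OF g'(2) ptime_known(2)[OF j(2,1)]]
    ptime_bex[OF g'(2) ptime_known(1)[OF j(2,1)]] ptime_bex[OF g'(2) ptime_known(2)[OF j(2,1)]]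
  show ?thesis
    unfolding known_value_eq fst_conv snd_conv
    by (intro ptime_Node ptime_If_bool kind large quant ptime_not[OF quant(3)] ptime_not[OF quant(4)]
        ptime_known[OF vs args] ptime_present[OF t ptime_length[OF vs]] ptime_absent[OF t ptime_length[OF vs]])
qed

lemma ptime_accepts:
  assumes t: "ptime E (\<lambda>a. enc_info (t a))" and C: "ptime E (\<lambda>a. enc_circuit (C a))"
  shows "ptime E (\<lambda>a. enc_bool (accepts (set (t a)) (C a)))"
proof -
  let ?h = "\<lambda>a g vs. vs @ [known_value (set (t a)) vs g]"
  let ?E = "env2 E (env2 enc_gate (enc_list enc_known))"
  note C' = C[unfolded enc_circuit_def]
  \<comment> \<open>Two truth values, the node joining them and the list cell: at most four nodes
    per gate.\<close>
  have size: "size (enc_list enc_known vs) \<le> 4 * length vs" for vs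
  proof (induction vs)
    case (Cons x vs)
    moreover have "size (enc_known x) \<le> 3" by (simp add: enc_bool_def)
    ultimately show ?case by simp
  qed simp
  have length: "length (fold (?h a) gs []) = length gs" for a gs
    using foldl_snoc(1)[of "known_value (set (t a))" gs] by (simp add: foldl_conv_fold)
  have "ptime E (\<lambda>a. enc_list enc_known (fold (?h a) (C a) []))"
  proof (rule ptime_fold[where f = enc_gate and S = "enc_list enc_known" and st = "\<lambda>_. []"
    and h = ?h,
        OF C' ptime_Nil])
    have z: "ptime ?E (\<lambda>z. Node (enc_gate (fst (snd z))) (enc_list enc_known (snd (snd z))))"
      by (rule ptime_snd[where f = "env2 enc_gate (enc_list enc_known)"])
    have t': "ptime ?E (\<lambda>z. enc_info (t (fst z)))" by (rule ptime_fst[OF t])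
    show "ptime ?E (\<lambda>z. enc_list enc_known (snd (snd z) @ [known_value (set (t (fst z))) (snd (snd z)) (fst (snd z))]))"
      by (intro ptime_append ptime_Cons ptime_Nil ptime_projr[OF z]
          ptime_known_value[OF t' ptime_projr[OF z] ptime_projl[OF z]])
    show "pbounded E (\<lambda>a. 4 * size (enc_list enc_gate (C a)))"
      by (intro pbounded_intros ptime_size[OF C'])
    fix a gs gs' assume "C a = gs @ gs'"
    then have "length gs \<le> size (enc_list enc_gate (C a))"
      using length_le_size_enc_list[of "C a" enc_gate] by simp
    then show "size (enc_list enc_known (fold (?h a) gs [])) \<le> 4 * size (enc_list enc_gate (C a))"
      using size[of "fold (?h a) gs []"] unfolding length by linarith
  qed
  then have "ptime E (\<lambda>a. enc_list enc_known (known_values (set (t a)) (C a)))"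
    by (simp add: known_values_def foldl_conv_fold)
  then show ?thesis
    unfolding accepts_def
      by (rule ptime_known(1)) (rule ptime_diff[OF ptime_length[OF C'] ptime_const])
qed

lemma ptime_adjacent:
  assumes C: "ptime E (\<lambda>a. enc_circuit (C a))"
    and u: "ptime E (\<lambda>a. enc_vertex (u a))" and v: "ptime E (\<lambda>a. enc_vertex (v a))"
  shows "ptime E (\<lambda>a. enc_bool (adjacent (C a) (u a) (v a)))"
proof -
  have arc: "ptime E (\<lambda>a. enc_bool (arc (C a) (u a) (v a)))"
    if u: "ptime E (\<lambda>a. enc_vertex (u a))" and v: "ptime E (\<lambda>a. enc_vertex (v a))"
      for u v
  proof -
    note u_kind = ptime_projl[OF u] and u_slot = ptime_projl[OF ptime_projr[OF u]]
      and u_info = ptime_projr[OF ptime_projr[OF u]]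
    note v_kind = ptime_projl[OF v] and v_slot = ptime_projl[OF ptime_projr[OF v]]
      and v_info = ptime_projr[OF ptime_projr[OF v]]
    have kinds: "ptime E (\<lambda>a. enc_bool (kind (u a) = n))" "ptime E (\<lambda>a. enc_bool (kind (v a) = n))"
      "ptime E (\<lambda>a. enc_bool (n < kind (u a)))" "ptime E (\<lambda>a. enc_bool (n < kind (v a)))"
      "ptime E (\<lambda>a. enc_bool (kind (u a) < n))" "ptime E (\<lambda>a. enc_bool (kind (v a) < n))" for n
      by (rule ptime_eq_nat[OF u_kind ptime_const] ptime_eq_nat[OF v_kind ptime_const]
          ptime_less[OF ptime_const u_kind] ptime_less[OF ptime_const v_kind]
          ptime_less[OF u_kind ptime_const] ptime_less[OF v_kind ptime_const])+
    have slots: "ptime E (\<lambda>a. enc_bool (slot (u a) = slot (v a)))"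
      "ptime E (\<lambda>a. enc_bool (slot (u a) = []))" "ptime E (\<lambda>a. enc_bool (slot (v a) = []))"
      by (rule ptime_eq_nat_list[OF u_slot v_slot] ptime_eq_nat_list[OF u_slot ptime_Nil]
          ptime_eq_nat_list[OF v_slot ptime_Nil])+
    have map: "ptime E (\<lambda>a. enc_slot (map fst (info (u a))))" "ptime E (\<lambda>a. enc_slot (map snd (info (u a))))"
      if "ptime E (\<lambda>a. enc_info (info (u a)))" for u
    proof -
      have x: "ptime (env2 E enc_pair) (\<lambda>z. enc_pair (snd z))" by (rule ptime_snd)
      show "ptime E (\<lambda>a. enc_slot (map fst (info (u a))))"
        by (rule ptime_map[where h = "\<lambda>_. fst", OF that ptime_projl[OF x]])
      show "ptime E (\<lambda>a. enc_slot (map snd (info (u a))))"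
        by (rule ptime_map[where h = "\<lambda>_. snd", OF that ptime_projr[OF x]])
    qed
    \<comment> \<open>Reduces the comparison of lists of pairs to that of lists of numbers.\<close>
    have eq: "(s = t) = (map fst s = map fst t \<and> map snd s = map snd t)"
      for s t :: "(nat \<times> nat) list"
      by (metis zip_map_fst_snd)
    have infos: "ptime E (\<lambda>a. enc_bool (info (u a) = info (v a)))"
      unfolding eq
      by (rule ptime_and[OF ptime_eq_nat_list[OF map(1)[OF u_info] map(1)[OF v_info]]
            ptime_eq_nat_list[OF map(2)[OF u_info] map(2)[OF v_info]]])
    note append = ptime_append[OF u_info v_info]
    have compatible: "ptime E (\<lambda>a. enc_bool (compatible (C a) (u a) (v a)))"
      unfolding compatible_def
      by (rule ptime_and[OF ptime_consistent[OF append]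
            ptime_imp[OF ptime_or[OF slots(2,3)] ptime_accepts[OF append C]]])
    show ?thesis
      unfolding arc_def
      by (intro ptime_or ptime_and ptime_If_bool kinds slots(1) ptime_not[OF infos] ptime_not[OF compatible])
  qed
  show ?thesis unfolding adjacent_def by (rule ptime_or[OF arc[OF u v] arc[OF v u]])
qed

lemma ptime_input_list:
  assumes C: "ptime E (\<lambda>a. enc_circuit (C a))"
    shows "ptime E (\<lambda>a. enc_slot (input_list (C a)))"
  unfolding input_list_def
proof (rule ptime_filter)
  note C' = C[unfolded enc_circuit_def]
  show "ptime E (\<lambda>a. enc_slot [0..<length (C a)])"
    by (rule ptime_upt[OF ptime_length[OF C']])
  \<comment> \<open>The left part of the code of a gate is its kind, which is \<open>Leaf\<close>
    exactly for inputs. The length test stays, since reading beyond the end yields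
    \<open>Leaf\<close> as well.\<close>
  have eq: "(i < length gs \<and> gs ! i = Input) =
      (i < length gs \<and> \<not> left (left (enc_list enc_gate (drop i gs))) \<noteq> Leaf)" for i gs
    by (cases "i < length gs"; cases "gs ! i") (auto simp: Cons_nth_drop_Suc[symmetric])
  have C'': "ptime (env2 E enc_nat) (\<lambda>z. enc_list enc_gate (C (fst z)))"
    by (rule ptime_fst[OF C'])
  have i: "ptime (env2 E enc_nat) (\<lambda>z. enc_nat (snd z))" by (rule ptime_snd)
  show "ptime (env2 E enc_nat) (\<lambda>z. enc_bool (snd z < length (C (fst z)) \<and> C (fst z) ! snd z = Input))"
    unfolding eq
    by (intro ptime_and ptime_not ptime_neq_Leaf ptime_left ptime_drop[OF C'' i] ptime_less[OF i ptime_length[OF C'']])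
qed

lemma ptime_info_pairs:
  assumes C: "ptime E (\<lambda>a. enc_circuit (C a))" and k: "ptime E (\<lambda>a. enc_nat (k a))"
  shows "ptime E (\<lambda>a. enc_info (info_pairs (C a) (k a)))"
proof -
  let ?h = "\<lambda>a i. map (\<lambda>p. (Suc i, Suc p)) (input_list (C a))"
  have z: "ptime (env2 (env2 E enc_nat) enc_nat) (\<lambda>z. enc_pair (Suc (snd (fst z)), Suc (snd z)))"
    unfolding fst_conv snd_conv
    by (rule ptime_Node[OF ptime_Suc[OF ptime_fst[where F = "\<lambda>z. enc_nat (snd z)", OF ptime_snd]]
          ptime_Suc[OF ptime_snd]])
  have "ptime (env2 E enc_nat) (\<lambda>z. enc_info (map (\<lambda>p. (Suc (snd z), Suc p)) (input_list (C (fst z)))))"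
    by (rule ptime_map[where g = enc_pair
      and h = "\<lambda>z p. (Suc (snd z), Suc p)", OF ptime_fst[OF ptime_input_list[OF C]] z])
  from ptime_concat[OF ptime_map[where g = enc_info and h = ?h, OF ptime_upt[OF k] this]]
  have pairs: "ptime E (\<lambda>a. enc_info (concat (map (?h a) [0..<k a])))" .
  have "ptime E (\<lambda>a. enc_pair (0, 0))" by (rule ptime_const)
  moreover have "ptime E (\<lambda>a. enc_pair (Suc (k a), Suc (length (C a))))"
    unfolding fst_conv snd_conv
    by (rule ptime_Node[OF ptime_Suc[OF k] ptime_Suc[OF ptime_length[OF C[unfolded enc_circuit_def]]]])
  ultimately show ?thesis
    unfolding info_pairs_def using pairs by (intro ptime_Cons)
qed

lemma ptime_slots:
  assumes k: "ptime E (\<lambda>a. enc_nat (k a))"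
    shows "ptime E (\<lambda>a. enc_list enc_slot (slots r (k a)))"
  unfolding slots_def
    by (rule ptime_Cons[OF ptime_Nil ptime_n_lists[OF ptime_upt[OF ptime_Suc[OF ptime_Suc[OF k]]]]])

lemma ptime_vertices:
  assumes C: "ptime E (\<lambda>a. enc_circuit (C a))" and k: "ptime E (\<lambda>a. enc_nat (k a))"
  shows "ptime E (\<lambda>a. enc_list enc_vertex (vertices r (C a) (k a)))"
proof -
  note tuples = ptime_n_lists[OF ptime_info_pairs[OF C k], of r]
  have t: "ptime (env2 E enc_info) (\<lambda>z. enc_info (snd z))" by (rule ptime_snd)
  have pair: "ptime (env2 (env2 E enc_info) enc_pair) (\<lambda>z. enc_pair (snd z))"
    by (rule ptime_snd)
  have 1: "ptime (env2 E enc_info) (\<lambda>z. enc_vertex (0, [], snd z))"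
    unfolding fst_conv snd_conv by (rule ptime_Node[OF ptime_const ptime_Node[OF ptime_Nil t]])
  have 2: "ptime (env2 E enc_info) (\<lambda>z. enc_vertex (0, map fst (snd z), snd z))"
    unfolding fst_conv snd_conv
    by (rule ptime_Node[OF ptime_const ptime_Node[OF ptime_map[where h = "\<lambda>_. fst", OF t ptime_projl[OF pair]] t]])
  have s: "ptime (env2 E enc_slot) (\<lambda>z. enc_vertex (j, snd z, []))" for j
    unfolding fst_conv snd_conv
      by (rule ptime_Node[OF ptime_const ptime_Node[OF ptime_snd ptime_Nil]])
  have 3: "ptime (env2 E enc_slot) (\<lambda>z. enc_list enc_vertex (map (\<lambda>j. (j, snd z, [])) [1, 2, 3]))"
    unfolding list.map by (intro ptime_Cons[where f = enc_vertex] s ptime_Nil)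
  have 4: "ptime E (\<lambda>a. enc_list enc_vertex [(4, [], [])])" by (rule ptime_const)
  show ?thesis
    unfolding vertices_def
    by (intro ptime_append[where f = enc_vertex] 4
        ptime_map[where g = enc_vertex and h = "\<lambda>_ t. (0, [], t)", OF tuples 1]
        ptime_map[where g = enc_vertex and h = "\<lambda>_ t. (0, map fst t, t)", OF tuples 2]
        ptime_concat[OF ptime_map[where g = "enc_list enc_vertex" and
          h = "\<lambda>_ s. map (\<lambda>j. (j, s, [])) [1, 2, 3]", OF ptime_slots[OF k] 3]])
qed

lemma ptime_reduced_graph:
  assumes C: "ptime E (\<lambda>a. enc_circuit (C a))" and k: "ptime E (\<lambda>a. enc_nat (k a))"
  shows "ptime E (\<lambda>a. enc_graph (reduced_graph r (C a) (k a)))"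
proof -
  let ?V = "\<lambda>a. vertices r (C a) (k a)"
  note V = ptime_vertices[OF C k, of r]
  \<comment> \<open>The entries of a row depend on the environment, whereas \<open>ptime_map\<close>
    expects a fixed encoding of entries; so the entries become trees that encode themselves.\<close>
  have eq: "enc_list f xs = enc_list (\<lambda>t. t) (map f xs)" for f :: "'x \<Rightarrow> tree"
    and xs
    by (simp add: enc_list_map comp_def)
  have C': "ptime (env2 (env2 E enc_vertex) enc_vertex) (\<lambda>z. enc_circuit (C (fst (fst z))))"
    by (rule ptime_fst[where F = "\<lambda>z. enc_circuit (C (fst z))", OF ptime_fst[OF C]])
  have u: "ptime (env2 (env2 E enc_vertex) enc_vertex) (\<lambda>z. enc_vertex (snd (fst z)))"
    by (rule ptime_fst[where F = "\<lambda>z. enc_vertex (snd z)", OF ptime_snd])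
  have v: "ptime (env2 (env2 E enc_vertex) enc_vertex) (\<lambda>z. enc_vertex (snd z))"
    by (rule ptime_snd)
  have row: "ptime (env2 E enc_vertex) (\<lambda>z. enc_list (\<lambda>t. t)
      (map (\<lambda>v. enc_bool (adjacent (C (fst z)) (snd z) v)) (?V (fst z))))"
    by (rule ptime_map[where g = "\<lambda>t. t"
      and h = "\<lambda>z v. enc_bool (adjacent (C (fst z)) (snd z) v)",
          OF ptime_fst[OF V] ptime_adjacent[OF C' u v]])
  have "ptime E (\<lambda>a. enc_list (\<lambda>t. t) (map (\<lambda>u. enc_list (\<lambda>t. t)
      (map (\<lambda>v. enc_bool (adjacent (C a) u v)) (?V a))) (?V a)))"
    by (rule ptime_map[where g = "\<lambda>t. t" and
          h = "\<lambda>a u. enc_list (\<lambda>t. t) (map (\<lambda>v. enc_bool (adjacent (C a) u v)) (?V a))", OF V row])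
  then show ?thesis
    by (simp only: reduced_graph_def enc_graph_list_graph eq[symmetric])
qed

section \<open>Programs with a bounded workspace\<close>

primrec exp_vars :: "exp \<Rightarrow> nat set" where
  "exp_vars (Var i) = {i}"
| "exp_vars Const_Leaf = {}"
| "exp_vars (Mk_Node e1 e2) = exp_vars e1 \<union> exp_vars e2"
| "exp_vars (exp.Left e) = exp_vars e"
| "exp_vars (exp.Right e) = exp_vars e"

primrec com_vars :: "com \<Rightarrow> nat set" where
  "com_vars (Assign i e) = insert i (exp_vars e)"
| "com_vars (Seq c1 c2) = com_vars c1 \<union> com_vars c2"
| "com_vars (Cond i c1 c2) = insert i (com_vars c1 \<union> com_vars c2)"
| "com_vars (While i c) = insert i (com_vars c)"

lemma finite_com_vars: "finite (com_vars c)"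
proof -
  have "finite (exp_vars e)" for e by (induction e) auto
  then show ?thesis by (induction c) auto
qed

lemma exp_value_cong: "(\<And>i. i \<in> exp_vars e \<Longrightarrow> s i = s' i) \<Longrightarrow> exp_value e s = exp_value e s'"
  by (induction e) auto

text \<open>A program touches only the variables that it mentions. Its run from an otherwise empty
  store, the only one that \<open>computes\<close> describes, can thus be replayed while other
  variables hold data.\<close>

lemma exec_frame:
  "exec c s t s' \<Longrightarrow> com_vars c \<subseteq> V \<Longrightarrow> exec c (override_on r s V) t (override_on r s' V)"
proof (induction rule: exec.induct)
  case (Assign i e s)
  have "exp_value e (override_on r s V) = exp_value e s"
    by (rule exp_value_cong) (use Assign in \<open>auto simp: override_on_def\<close>)
  moreover have "(override_on r s V)(i := x) = override_on r (s(i := x)) V" for x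
    using Assign by (auto simp: override_on_def fun_eq_iff)
  ultimately show ?case using exec.Assign[of i e "override_on r s V"] by (simp del: fun_upd_apply)
next
  case (Seq c1 s t1 s' c2 t2 s'')
  then show ?case by (auto intro: exec.Seq)
next
  case (Cond_True s i c1 t s' c2)
  then show ?case by (intro exec.Cond_True) (auto simp: override_on_def)
next
  case (Cond_False s i c2 t s' c1)
  then show ?case by (intro exec.Cond_False) (auto simp: override_on_def)
next
  case (While_False s i c)
  then show ?case by (intro exec.While_False) (auto simp: override_on_def)
next
  case While_True
  then show ?case by (intro exec.While_True) (auto simp: override_on_def)
qed

text \<open>As there is no empty command, the base case clears variable 1, which accounts for the
  \<open>max 1 n\<close> below. Variable 0 is spared because it holds the output.\<close>

primrec clear_vars :: "nat \<Rightarrow> com" where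
  "clear_vars 0 = Assign 1 Const_Leaf"
| "clear_vars (Suc n) = Seq (Assign (Suc n) Const_Leaf) (clear_vars n)"

lemma steps_clear_vars:
  "steps (clear_vars n) s (n + 1) (\<lambda>i. if 0 < i \<and> i \<le> max 1 n then Leaf else s i)"
proof (induction n arbitrary: s)
  case 0
  have "(\<lambda>i. if 0 < i \<and> i \<le> max 1 0 then Leaf else s i) = s(1 := exp_value Const_Leaf s)"
    by (auto simp: fun_eq_iff)
  then show ?case using steps_Assign[of Const_Leaf s 1 1] by simp
next
  case (Suc n)
  let ?s = "s(Suc n := exp_value Const_Leaf s)"
  have "(\<lambda>i. if 0 < i \<and> i \<le> max 1 n then Leaf else ?s i) =
      (\<lambda>i. if 0 < i \<and> i \<le> max 1 (Suc n) then Leaf else s i)"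
    by (auto simp: fun_eq_iff)
  with Suc[of ?s] have "steps (clear_vars n) ?s (n + 1) (\<lambda>i. if 0 < i \<and> i \<le> max 1 (Suc n) then Leaf else s i)"
    by (simp only:)
  moreover have "steps (Assign (Suc n) Const_Leaf) s 1 ?s" by (rule steps_Assign) simp
  ultimately show ?case by (auto intro: steps_Seq)
qed

text \<open>The reduction of the given problem is an arbitrary program that may leave its variables
  filled. Clearing all variables that it mentions makes it a subroutine, at a cost independent of
  the input.\<close>

lemma ex_runs_of_computes:
  "\<exists>c' m. \<forall>x t y. computes c x t y \<longrightarrow> runs c' m x (t + m) y"
proof -
  obtain m where m: "com_vars c \<subseteq> {..m}" "1 \<le> m"
  proof -
    have "com_vars c \<subseteq> {..Max (insert 1 (com_vars c))}" using finite_com_vars[of c]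
      by auto
    moreover have "1 \<le> Max (insert 1 (com_vars c))" using finite_com_vars[of c] by simp
    ultimately show thesis by (rule that)
  qed
  have "runs (Seq c (clear_vars m)) (Suc m) x (t + Suc m) y" if comp: "computes c x t y" for x t y
  proof (rule runsI)
    fix s assume s: "s 0 = x" "\<And>i. 0 < i \<Longrightarrow> i < Suc m \<Longrightarrow> s i = Leaf"
    from comp obtain s' where s': "exec c ((\<lambda>_. Leaf)(0 := x)) t s'" "s' 0 = y"
      unfolding computes_def by blast
    have "override_on s ((\<lambda>_. Leaf)(0 := x)) {..m} = s"
      using s by (auto simp: override_on_def fun_eq_iff)
    with exec_frame[OF s'(1) m(1), of s] have "steps c s t (override_on s s' {..m})"
      unfolding steps_def by auto
    moreover have "(\<lambda>i. if 0 < i \<and> i \<le> max 1 m then Leaf else override_on s s' {..m} i) = s(0 := y)"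
      using s s'(2) m(2) by (auto simp: override_on_def fun_eq_iff)
    then have "steps (clear_vars m) (override_on s s' {..m}) (m + 1) (s(0 := y))"
      using steps_clear_vars[of m "override_on s s' {..m}"] by simp
    ultimately show "steps (Seq c (clear_vars m)) s (t + Suc m) (s(0 := y))"
      by (rule steps_Seq) simp
  qed
  then show ?thesis by blast
qed

section \<open>Computable bounds on time and parameter\<close>

lemma computable_comp:
  assumes "computable g" "ptime enc_nat (\<lambda>n. enc_nat (h n))"
  shows "computable (\<lambda>n. h (g n))"
proof -
  obtain c where c: "\<And>n. \<exists>t. computes c (enc_nat n) t (enc_nat (g n))"
    using assms(1) unfolding computable_def by blast
  obtain c' m where c': "\<And>x t y. computes c x t y \<Longrightarrow> runs c' m x (t + m) y"
    using ex_runs_of_computes by blast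
  obtain T m2 c2 where 2: "pbounded enc_nat T" "\<forall>n m'. m2 \<le> m' \<longrightarrow> runs c2 m' (enc_nat n) (T n) (enc_nat (h n))"
    by (rule ptimeE[OF assms(2)])
  have "\<exists>t. computes (Seq c' c2) (enc_nat n) t (enc_nat (h (g n)))" for n
  proof -
    obtain t where "computes c (enc_nat n) t (enc_nat (g n))" using c by blast
    then have "runs c' (max m m2) (enc_nat n) (t + m) (enc_nat (g n))"
      using c' runs_mono by (meson max.cobounded1 order_refl)
    moreover have "runs c2 (max m m2) (enc_nat (g n)) (T (g n)) (enc_nat (h (g n)))"
      using 2(2) by simp
    ultimately show ?thesis using runs_computes[OF runs_Seq] by blast
  qed
  then show ?thesis unfolding computable_def by blast
qed

text \<open>The new time bound involves both \<open>f k\<close> and \<open>k\<close>. As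
  \<open>f\<close> is merely computable, \<open>k\<close> has to be kept while \<open>f k\<close> is
  computed.\<close>

lemma computable_pair:
  assumes "computable f" "ptime (env2 enc_nat enc_nat) (\<lambda>z. enc_nat (h (fst z) (snd z)))"
  shows "computable (\<lambda>n. h (f n) n)"
proof -
  let ?E = "env2 enc_nat enc_nat"
  obtain c where c: "\<And>n. \<exists>t. computes c (enc_nat n) t (enc_nat (f n))"
    using assms(1) unfolding computable_def by blast
  obtain c1 m1 where c1: "\<And>x t y. computes c x t y \<Longrightarrow> runs c1 m1 x (t + m1) y"
    using ex_runs_of_computes by blast
  obtain T2 m2 c2 where 2: "pbounded enc_nat T2" "\<forall>n m'. m2 \<le> m' \<longrightarrow> runs c2 m' (enc_nat n) (T2 n) (enc_nat n)"
    by (rule ptimeE[OF ptime_id])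
  obtain T3 m3 c3 where 3: "pbounded ?E T3"
    "\<forall>z m'. m3 \<le> m' \<longrightarrow> runs c3 m' (?E z) (T3 z) (enc_nat (h (fst z) (snd z)))"
    by (rule ptimeE[OF assms(2)])
  define m where "m = Suc (m1 + m2 + m3)"
  have "\<exists>t. computes (Seq (pair_prog m c1 c2) c3) (enc_nat n) t (enc_nat (h (f n) n))" for n
  proof -
    obtain t where "computes c (enc_nat n) t (enc_nat (f n))" using c by blast
    then have "runs c1 m (enc_nat n) (t + m1) (enc_nat (f n))"
      using runs_mono[OF c1] by (simp add: m_def)
    moreover have "runs c2 m (enc_nat n) (T2 n) (enc_nat n)" using 2(2) by (simp add: m_def)
    ultimately obtain T where "runs (pair_prog m c1 c2) (m + 2) (enc_nat n) T (?E (f n, n))"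
      using runs_pair[of c1 m "enc_nat n"] by (fastforce simp: m_def)
    moreover have "runs c3 (m + 2) (?E (f n, n)) (T3 (f n, n)) (enc_nat (h (f n) n))"
      using 3(2) by (metis fst_conv snd_conv m_def le_add1 le_add2 le_SucI le_trans)
    ultimately show ?thesis using runs_computes[OF runs_Seq] by blast
  qed
  then show ?thesis unfolding computable_def by blast
qed

lemma ptime_add:
  assumes "ptime E (\<lambda>a. enc_nat (m a))" "ptime E (\<lambda>a. enc_nat (n a))"
  shows "ptime E (\<lambda>a. enc_nat (m a + n a))"
  using ptime_append[OF assms[unfolded enc_nat_eq_enc_list]]
  by (simp add: enc_nat_eq_enc_list replicate_add)

lemma length_n_lists_eq: "length (List.n_lists n xs) = length xs ^ n"
  by (induction n) (auto simp: length_concat comp_def sum_list_triv)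

text \<open>In unary, a power is obtained by counting the lists of length \<open>e\<close> over
  \<open>n\<close> elements.\<close>

lemma ptime_power:
  assumes "ptime E (\<lambda>a. enc_nat (n a))" shows "ptime E (\<lambda>a. enc_nat (n a ^ e))"
  using ptime_length[OF ptime_n_lists[OF ptime_upt[OF assms]], of e]
    by (simp add: length_n_lists_eq)

lemma length_slots: "length (slots r k) = Suc ((k + 2) ^ r)"
  by (simp add: slots_def length_n_lists_eq del: upt_Suc)

section \<open>Hardness\<close>

lemma enc_nat_inj: "enc_nat m = enc_nat n \<longleftrightarrow> m = n"
  by (metis size_enc_nat)

lemma enc_list_inj: "(\<And>x y. f x = f y \<Longrightarrow> x = y) \<Longrightarrow> enc_list f xs = enc_list f ys \<Longrightarrow> xs = ys"
  using enc_list_eqD[of f xs f ys] by (metis injI inj_map_eq_map)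

lemma enc_circuit_inj: "enc_circuit C = enc_circuit C' \<Longrightarrow> C = C'"
proof -
  have slot: "enc_slot js = enc_slot js' \<Longrightarrow> js = js'" for js js'
    by (rule enc_list_inj) (simp_all add: enc_nat_inj)
  have "enc_gate g = enc_gate g' \<Longrightarrow> g = g'" for g g'
    by (cases g; cases g') (auto simp: enc_nat_inj numeral_2_eq_2 numeral_3_eq_3 dest: slot)
  then show "enc_circuit C = enc_circuit C' \<Longrightarrow> C = C'"
    unfolding enc_circuit_def by (rule enc_list_inj)
qed

lemma weighted_circuit_sat_iff:
  "wf_circuit C \<Longrightarrow> (enc_circuit C, k) \<in> weighted_circuit_sat \<longleftrightarrow>
    (\<exists>A\<subseteq>input_nodes C. card A = k \<and> satisfies A C)"
  unfolding weighted_circuit_sat_def by (auto dest: enc_circuit_inj)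

lemma independent_dominating_set_problem_iff:
  "instance_graph G \<Longrightarrow> (enc_graph G, k) \<in> independent_dominating_set_problem \<longleftrightarrow>
    (\<exists>D. independent_dominating_set G D \<and> card D \<le> k)"
  unfolding independent_dominating_set_problem_def by (auto dest: enc_graph_inj)

text \<open>\<open>N\<close> is the input size plus one, and \<open>f * N ^ e + m\<close> the time
  of the given reduction including the cleaning. The size of its output, plus 2, is at most the base
  of the second summand, which bounds the time for the graph.\<close>

lemma fpt_time_bound:
  fixes N f k m e e' :: nat
  assumes "1 \<le> N" and a: "a = f + k + m + 3"
  shows "f * N ^ e + m + (N + k + 2 + (f * N ^ e + m)) ^ e' \<le> a ^ (e' + 2) * N ^ (Suc e * (e' + 2))"
proof -
  let ?M = "N ^ Suc e"
  have M: "N \<le> ?M" "N ^ e \<le> ?M" "1 \<le> ?M" using assms(1) by simp_all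
  have le: "N + k + 2 + (f * N ^ e + m) \<le> a * ?M"
  proof -
    \<comment> \<open>The coefficients 1, \<open>k + 2 + m\<close> and \<open>f\<close> of
      \<open>?M\<close> add up to \<open>a\<close>.\<close>
    have "N + (k + 2 + m) * 1 + f * N ^ e \<le> ?M + (k + 2 + m) * ?M + f * ?M"
      by (intro add_mono M(1) mult_le_mono2 M(2,3))
    then have "N + k + 2 + (f * N ^ e + m) \<le> ?M + (k + 2 + m) * ?M + f * ?M"
      by (simp only: mult_1_right mult_1_left ac_simps)
    also have "\<dots> = a * ?M" by (simp add: a algebra_simps)
    finally show ?thesis .
  qed
  have aM: "2 \<le> a * ?M" using mult_le_mono[of 2 a 1 ?M] M(3) a by simp
  then have aM1: "1 \<le> a * ?M" by linarith
  have "f * N ^ e + m \<le> (a * ?M) ^ Suc e'"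
    using le self_le_power[of "a * ?M" "Suc e'"] aM by linarith
  moreover have "(N + k + 2 + (f * N ^ e + m)) ^ e' \<le> (a * ?M) ^ Suc e'"
    by (rule order_trans[OF power_mono[OF le zero_le] power_increasing[OF _ aM1]]) simp
  ultimately have "f * N ^ e + m + (N + k + 2 + (f * N ^ e + m)) ^ e' \<le> 2 * (a * ?M) ^ Suc e'"
    by linarith
  \<comment> \<open>As \<open>a * ?M\<close> is at least 2, one more factor of it absorbs the
    2.\<close>
  also have "\<dots> \<le> (a * ?M) * (a * ?M) ^ Suc e'" using aM by (intro mult_right_mono) auto
  also have "\<dots> = (a * ?M) ^ (e' + 2)" by (simp only: power_Suc[symmetric] add_2_eq_Suc')
  also have "\<dots> = a ^ (e' + 2) * N ^ (Suc e * (e' + 2))"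
    by (simp only: power_mult_distrib power_mult)
  finally show ?thesis .
qed

text \<open>The given reduction turns every input into the code of a well-formed circuit of weft one
  and depth at most \<open>d\<close>, so the graph construction needs to be correct on such codes
  only, and \<open>r\<close> depends only on \<open>d\<close>.\<close>

theorem theorem3:
  shows "W_hard_on 1 independent_dominating_set_problem two_club_instances"
  unfolding W_hard_on_def
proof
  fix P assume "P \<in> W_class 1"
  then obtain d where "fpt_reducible P weighted_circuit_sat (weft_depth_instances 1 d)"
    unfolding W_class_def by blast
  then obtain c f g e where f: "computable f" and g: "computable g" and
    red: "\<And>x k. \<exists>x' k' t. computes c (Node x (enc_nat k)) t (Node x' (enc_nat k')) \<and>
      t \<le> f k * (size x + 1) ^ e \<and> k' \<le> g k \<and> (x', k') \<in> weft_depth_instances 1 d \<and>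
      ((x, k) \<in> P \<longleftrightarrow> (x', k') \<in> weighted_circuit_sat)"
    unfolding fpt_reducible_def by blast
  define r :: nat where "r = 2 ^ Suc d"
  let ?E = "env2 enc_circuit enc_nat"
  let ?R = "\<lambda>z. Node (enc_graph (reduced_graph r (fst z) (snd z))) (enc_nat (length (slots r (snd z))))"
  obtain c1 m1 where c1: "\<And>x t y. computes c x t y \<Longrightarrow> runs c1 m1 x (t + m1) y"
    using ex_runs_of_computes by blast
  have z: "ptime ?E (\<lambda>z. Node (enc_circuit (fst z)) (enc_nat (snd z)))" by (rule ptime_id)
  have "ptime ?E ?R"
    by (rule ptime_Node[OF ptime_reduced_graph[OF ptime_projl[OF z] ptime_projr[OF z]]
          ptime_length[OF ptime_slots[OF ptime_projr[OF z]]]])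
  then obtain T2 m2 c2 where T2: "pbounded ?E T2" and
    c2: "\<forall>z m'. m2 \<le> m' \<longrightarrow> runs c2 m' (?E z) (T2 z) (?R z)"
    by (rule ptimeE)
  obtain e2 where e2: "\<And>z. T2 z \<le> (size (?E z) + 2) ^ e2" using T2 unfolding pbounded_def
    by blast
  define F where "F k = (f k + k + (m1 + 3)) ^ (e2 + 2)" for k
  define G where "G k = length (slots r (g k))" for k
  have "computable F"
    unfolding F_def
    by (rule computable_pair[where h = "\<lambda>a k. (a + k + (m1 + 3)) ^ (e2 + 2)", OF f],
        rule ptime_power[OF ptime_add[OF ptime_add[OF ptime_projl ptime_projr] ptime_const]])
       (rule ptime_id)+
  moreover have "computable G"
    unfolding G_def
      by (rule computable_comp[where h = "\<lambda>k. length (slots r k)", OF g ptime_length[OF ptime_slots[OF ptime_id]]])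
  moreover have "\<exists>x' k' t. computes (Seq c1 c2) (Node x (enc_nat k)) t (Node x' (enc_nat k')) \<and>
      t \<le> F k * (size x + 1) ^ (Suc e * (e2 + 2)) \<and> k' \<le> G k \<and> (x', k') \<in> two_club_instances \<and>
      ((x, k) \<in> P \<longleftrightarrow> (x', k') \<in> independent_dominating_set_problem)" for x k
  proof -
    obtain x' k' t where t: "computes c (Node x (enc_nat k)) t (Node x' (enc_nat k'))"
      "t \<le> f k * (size x + 1) ^ e" and k': "k' \<le> g k" and
      inst: "(x', k') \<in> weft_depth_instances 1 d" and
      iff: "(x, k) \<in> P \<longleftrightarrow> (x', k') \<in> weighted_circuit_sat"
      using red by blast
    obtain C where C: "x' = enc_circuit C" "wf_circuit C" "weft_at_most 1 C" "depth_at_most d C"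
      using inst unfolding weft_depth_instances_def by blast
    let ?G = "reduced_graph r C k'" and ?k = "length (slots r k')"
    let ?T1 = "f k * (size x + 1) ^ e + m1"
    let ?m = "max m1 m2"
    have 1: "runs c1 ?m (Node x (enc_nat k)) ?T1 (?E (C, k'))"
      using runs_mono[OF c1[OF t(1)], of ?m ?T1] t(2) C(1) by simp
    have 2: "runs c2 ?m (?E (C, k')) (T2 (C, k')) (Node (enc_graph ?G) (enc_nat ?k))"
      using c2[rule_format, of ?m "(C, k')"] by simp
    obtain t' where t': "computes (Seq c1 c2) (Node x (enc_nat k)) t' (Node (enc_graph ?G) (enc_nat ?k))"
      "t' \<le> ?T1 + T2 (C, k')"
      using runs_computes[OF runs_Seq[OF 1 2]] by blast
    have "size (?E (C, k')) + 2 \<le> (size x + 1) + k + 2 + ?T1" using runs_size[OF 1] by simp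
    then have "T2 (C, k') \<le> ((size x + 1) + k + 2 + ?T1) ^ e2"
      using e2[of "(C, k')"] power_mono[of "size (?E (C, k')) + 2" _ e2]
        by (meson order_trans zero_le)
    with t'(2) have "t' \<le> ?T1 + ((size x + 1) + k + 2 + ?T1) ^ e2" by linarith
    also have "\<dots> \<le> F k * (size x + 1) ^ (Suc e * (e2 + 2))"
      unfolding F_def by (rule fpt_time_bound) simp_all
    finally have time: "t' \<le> F k * (size x + 1) ^ (Suc e * (e2 + 2))" .
    \<comment> \<open>The number of slots is monotone in the parameter, so
      \<open>k' \<le> g k\<close> suffices.\<close>
    have "?k \<le> G k" unfolding G_def length_slots using k' by (simp add: power_mono)
    moreover have "(enc_graph ?G, ?k) \<in> two_club_instances"
      unfolding two_club_instances_def
        using instance_reduced_graph two_club_reduced_graph[OF _ C(2)]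
      by (auto simp: r_def)
    moreover have "(x, k) \<in> P \<longleftrightarrow> (enc_graph ?G, ?k) \<in> independent_dominating_set_problem"
      unfolding iff C(1) weighted_circuit_sat_iff[OF C(2)]
        independent_dominating_set_problem_iff[OF instance_reduced_graph]
        reduced_graph_correct[OF C(2-4) r_def] ..
    ultimately show ?thesis using t'(1) time by blast
  qed
  ultimately show "fpt_reducible P independent_dominating_set_problem two_club_instances"
    unfolding fpt_reducible_def by blast
qed

end
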